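(* Let $k,m\ge 1$ and $n_1,\dots,n_k\ge 1$ be integers and put $n=n_1\cdots n_k$. Let $W$ be a complex Wishart matrix of parameters $(dn,dm)$, and let $\varphi:M_n(\mathbb C)\to M_n(\mathbb C)$ be a linear map whose associated matrix $\Lambda\in M_n(\mathbb C)\otimes M_n(\mathbb C)$ is given by a "strings and beads" diagram, $\Lambda\in\mathcal P$, which is symmetric (that is, $\Lambda=\Lambda^*$) and has undecorated through strings. Then the $d\to\infty$ asymptotic eigenvalue distribution of the block-modified Wishart matrix $\tilde W=(id\otimes\varphi)W$ is given by $$\delta m\tilde W\sim\pi_{mn\rho}\boxtimes\nu,$$ where $\rho=law(\Lambda)$, $\nu=law(D)$, $\delta=tr(D)$ and $D=\varphi(1)$.
   Context: **Wishart matrices.** $n,m\ge1$ are fixed. For $d\ge 1$, a complex Wishart matrix of parameters $(dn,dm)$ is $W=\frac{1}{dm}GG^*$, with $G$ a $dn\times dm$ matrix with independent complex $\mathcal N(0,1)$ entries (centered complex Gaussian, $\mathbb E|G_{xy}|^2=1$). View $W\in M_d(\mathbb C)\otimes M_n(\mathbb C)$; then $\tilde W=(id\otimes\varphi)W$. **Notation $\sim$.** For random matrices $X=X_d\in M_{dn}(\mathbb C)$, $X\sim\mu$ means that the $d\to\infty$ asymptotic eigenvalue distribution of $X$ is $\mu$, in the sense of moments: $\lim_{d\to\infty}(\mathbb E\circ tr)(X^p)$ is the $p$-th moment of $\mu$ for all $p\in\mathbb N$. Here $tr$ is the normalized trace and $Tr$ the unnormalized one. The law of a self-adjoint matrix is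 its eigenvalue distribution with respect to $tr$. **The matrix $\Lambda$.** The matrix $\Lambda=\sum_{abcd}\Lambda_{ab,cd}\,e_{ac}\otimes e_{bd}$ associated to $\varphi$ is defined by $\varphi(A)_{bd}=\sum_{ac}\Lambda_{ab,cd}A_{ac}$. **Compound free Poisson laws.** $\pi_t$ ($t\ge 0$) is the free Poisson (Marchenko-Pastur) law $\max(1-t,0)\delta_0+\frac{\sqrt{4t-(x-1-t)^2}}{2\pi x}1_{[(\sqrt t-1)^2,(\sqrt t+1)^2]}(x)\,dx$ (with $\pi_0=\delta_0$). For $\mu=\sum_{i=1}^s c_i\delta_{z_i}$ with $c_i>0$, $z_i\in\mathbb R$ (not necessarily of mass 1), $\pi_\mu$ is the law of $\sum_i z_i\alpha_i$, where the $\alpha_i$ are free and $\alpha_i$ has law $\pi_{c_i}$. **Free multiplicative convolution.** $\mu\boxtimes\nu$ is the distribution of a product $ab$ with $a,b$ free (in a tracial noncommutative probability space with trace $\tau$), self-adjoint, with laws $\mu,\nu$; it is determined by its moments $\tau((ab)^p)$, $p\in\mathbb N$ (no positivity of the supports is assumed). **Strings and beads diagrams $\mathcal P$.** Elements are matrices $\Lambda\in(M_{n_1}(\mathbb C)\otimes\cdots\otimes M_{n_k}(\mathbb C))^{\otimes 2}$, represented by boxes with $2k$ left legs (carrying row indices $i_1,\dots,i_{2k}$) and $2k$ right legs (carrying column indices $j_1,\dots,j_{2k}$). On each side the legs are colored, from top to bottom, $n_1,\dots,n_k,n_k,\dots,n_1$, and the index at a leg of color $n_r$ ranges over $\{1,\dots,n_r\}$.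 The diagram consists of a partition of the $2k+2k$ legs into blocks of even size ($\pi\in P_{even}(2k,2k)$), with all legs of a block having the same color; the blocks are the "strings". Each string may be decorated with "beads", i.e. matrices in $M_N(\mathbb C)$, $N$ being the color of the string. A block of size $2$ with end indices $u,v$ contributes $A_{uv}$, where $A$ is its bead ($A=1$ if undecorated), for a chosen orientation. A block of size $\ge4$ ("multi-leg string") has at its multi-crossing a "small bead" of generalized ${\rm Center}_c$ type ($c\in\mathbb C$): when undecorated it contributes $c$ if all indices on its legs are equal and $0$ otherwise; if its legs $\ell$ carry beads $A^{(\ell)}$ it contributes $c\sum_{y}\prod_\ell A^{(\ell)}_{y,u_\ell}$, where $u_\ell$ is the index at $\ell$. The entry $\Lambda_{i_1\ldots i_{2k},j_1\ldots j_{2k}}$ is the product of the contributions of all blocks. A string is "through" if it joins left and right legs; it is undecorated if it carries no beads (the small bead $c$ of a multi-leg string is allowed). By grouping the first $k$ and last $k$ legs on each side, and identifying $n_1\cdots n_k$ and $n_k\cdots n_1$ multi-indices with $\{1,\dots,n\}$ (by reversing the order of the second group), $\Lambda$ is viewed as an element $\Lambda_{ab,cd}$ of $M_n(\mathbb C)\otimes M_n(\mathbb C)$, with $a=(i_1,\dots,i_k)$, $b=(i_{k+1},\dots,i_{2k})$, $c=(j_1,\dots,j_k)$, $d=(j_{k+1},\dots,j_{2k})$. *)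

theory Defs
  imports "HOL-Probability.Probability" "Jordan_Normal_Form.Char_Poly"
    "Jordan_Normal_Form.Schur_Decomposition"
begin

section \<open>Matrices, traces and eigenvalue laws\<close>

text \<open>
  \<open>M_d \<otimes> M_n\<close> is identified with \<open>M_{dn}\<close> by sending the index pair \<open>(x, a)\<close>, with \<open>x < d\<close> and
  \<open>a < n\<close>, to \<open>x * n + a\<close>; all indices start at 0.
\<close>

definition ntr :: "complex mat \<Rightarrow> complex" where
  "ntr A = (\<Sum>i<dim_row A. A $$ (i, i)) / of_nat (dim_row A)"

text \<open>Only used for nonempty Hermitian matrices, whose eigenvalues are real.\<close>

definition eigenvalue_law :: "complex mat \<Rightarrow> real pmf" where
  "eigenvalue_law A = map_pmf Re (pmf_of_multiset (proots (char_poly A)))"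

definition linear_on_mats :: "nat \<Rightarrow> (complex mat \<Rightarrow> complex mat) \<Rightarrow> bool" where
  "linear_on_mats n \<phi> \<longleftrightarrow>
     (\<forall>A \<in> carrier_mat n n. \<phi> A \<in> carrier_mat n n) \<and>
     (\<forall>A \<in> carrier_mat n n. \<forall>B \<in> carrier_mat n n. \<phi> (A + B) = \<phi> A + \<phi> B) \<and>
     (\<forall>A \<in> carrier_mat n n. \<forall>c. \<phi> (c \<cdot>\<^sub>m A) = c \<cdot>\<^sub>m \<phi> A)"

definition associated_matrix :: "nat \<Rightarrow> (complex mat \<Rightarrow> complex mat) \<Rightarrow> complex mat \<Rightarrow> bool" where
  "associated_matrix n \<phi> \<Lambda> \<longleftrightarrow>
     \<Lambda> \<in> carrier_mat (n * n) (n * n) \<and>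
     (\<forall>A \<in> carrier_mat n n. \<forall>b<n. \<forall>d<n.
        \<phi> A $$ (b, d) = (\<Sum>a<n. \<Sum>c<n. \<Lambda> $$ (a * n + b, c * n + d) * A $$ (a, c)))"

definition block_of :: "nat \<Rightarrow> complex mat \<Rightarrow> nat \<Rightarrow> nat \<Rightarrow> complex mat" where
  "block_of n W x y = mat n n (\<lambda>(a, c). W $$ (x * n + a, y * n + c))"

text \<open>\<open>(id \<otimes> \<phi>) W\<close> for \<open>W \<in> M_d \<otimes> M_n\<close>: the map \<open>\<phi>\<close> is applied to each of the \<open>d\<^sup>2\<close> blocks.\<close>

definition block_modified ::
  "nat \<Rightarrow> nat \<Rightarrow> (complex mat \<Rightarrow> complex mat) \<Rightarrow> complex mat \<Rightarrow> complex mat" where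
  "block_modified d n \<phi> W =
     mat (d * n) (d * n)
       (\<lambda>(i, j). \<phi> (block_of n W (i div n) (j div n)) $$ (i mod n, j mod n))"


section \<open>Wishart matrices\<close>

text \<open>Centred complex Gaussian with \<open>E |Z|\<^sup>2 = 1\<close>, so each of the two real parts has variance 1/2.\<close>

definition std_complex_gaussian :: "'w measure \<Rightarrow> ('w \<Rightarrow> complex) \<Rightarrow> bool" where
  "std_complex_gaussian M Z \<longleftrightarrow>
     distributed M lborel (\<lambda>\<omega>. Re (Z \<omega>)) (normal_density 0 (sqrt (1/2))) \<and>
     distributed M lborel (\<lambda>\<omega>. Im (Z \<omega>)) (normal_density 0 (sqrt (1/2))) \<and>
     prob_space.indep_var M borel (\<lambda>\<omega>. Re (Z \<omega>)) borel (\<lambda>\<omega>. Im (Z \<omega>))"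

definition complex_gaussian_matrix ::
  "'w measure \<Rightarrow> nat \<Rightarrow> nat \<Rightarrow> ('w \<Rightarrow> complex mat) \<Rightarrow> bool" where
  "complex_gaussian_matrix M N K G \<longleftrightarrow>
     (\<forall>\<omega>\<in>space M. G \<omega> \<in> carrier_mat N K) \<and>
     (\<forall>x<N. \<forall>y<K. std_complex_gaussian M (\<lambda>\<omega>. G \<omega> $$ (x, y))) \<and>
     prob_space.indep_vars M (\<lambda>_. borel) (\<lambda>(x, y) \<omega>. G \<omega> $$ (x, y)) ({..<N} \<times> {..<K})"

definition complex_wishart ::
  "'w measure \<Rightarrow> nat \<Rightarrow> nat \<Rightarrow> ('w \<Rightarrow> complex mat) \<Rightarrow> bool" where
  "complex_wishart M N K W \<longleftrightarrow>
     prob_space M \<and>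
     (\<exists>G. complex_gaussian_matrix M N K G \<and>
          (\<forall>\<omega>\<in>space M. W \<omega> = (1 / of_nat K) \<cdot>\<^sub>m (G \<omega> * mat_adjoint (G \<omega>))))"

text \<open>
  A distribution is represented by its sequence of moments, indexed from 0.
  This is all that \<open>\<sim>\<close> refers to, and since no positivity of the supports is required,
  \<open>\<mu> \<boxtimes> \<nu>\<close> need not be a measure on the real line.
\<close>

type_synonym moment_seq = "nat \<Rightarrow> complex"

definition moments :: "real measure \<Rightarrow> moment_seq" where
  "moments \<mu> p = complex_of_real (LINT x|\<mu>. x ^ p)"

definition asymptotic_law ::
  "(nat \<Rightarrow> 'w measure) \<Rightarrow> (nat \<Rightarrow> 'w \<Rightarrow> complex mat) \<Rightarrow> moment_seq \<Rightarrow> bool" where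
  "asymptotic_law M X s \<longleftrightarrow>
     (\<forall>p. (\<lambda>d. LINT \<omega>|M d. ntr (X d \<omega> ^\<^sub>m p)) \<longlonglongrightarrow> s p)"


section \<open>Noncommutative probability spaces and freeness\<close>

text \<open>A complex unital *-algebra structure on a ring, together with a functional.\<close>

record 'a nc_space =
  scl :: "complex \<Rightarrow> 'a \<Rightarrow> 'a"
  adj :: "'a \<Rightarrow> 'a"
  st :: "'a \<Rightarrow> complex"

definition tracial_ncps :: "('a::ring_1) nc_space \<Rightarrow> bool" where
  "tracial_ncps S \<longleftrightarrow>
     vector_space (scl S) \<and>
     (\<forall>c a b. scl S c a * b = scl S c (a * b) \<and> a * scl S c b = scl S c (a * b)) \<and>
     (\<forall>a b. adj S (a + b) = adj S a + adj S b \<and> adj S (a * b) = adj S b * adj S a) \<and>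
     (\<forall>c a. adj S (scl S c a) = scl S (cnj c) (adj S a) \<and> adj S (adj S a) = a) \<and>
     (\<forall>a b. st S (a + b) = st S a + st S b) \<and>
     (\<forall>c a. st S (scl S c a) = c * st S a) \<and>
     st S 1 = 1 \<and>
     (\<forall>a. Im (st S (adj S a * a)) = 0 \<and> Re (st S (adj S a * a)) \<ge> 0) \<and>
     (\<forall>a b. st S (a * b) = st S (b * a))"

definition has_law :: "('a::ring_1) nc_space \<Rightarrow> 'a \<Rightarrow> moment_seq \<Rightarrow> bool" where
  "has_law S a s \<longleftrightarrow> adj S a = a \<and> (\<forall>p. st S (a ^ p) = s p)"

definition unital_star_subalgebra :: "('a::ring_1) nc_space \<Rightarrow> 'a set \<Rightarrow> bool" where
  "unital_star_subalgebra S B \<longleftrightarrow>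
     1 \<in> B \<and>
     (\<forall>a\<in>B. \<forall>b\<in>B. a + b \<in> B \<and> a * b \<in> B) \<and>
     (\<forall>c. \<forall>a\<in>B. scl S c a \<in> B) \<and>
     (\<forall>a\<in>B. adj S a \<in> B)"

definition generated_subalgebra :: "('a::ring_1) nc_space \<Rightarrow> 'a set \<Rightarrow> 'a set" where
  "generated_subalgebra S X = \<Inter>{B. unital_star_subalgebra S B \<and> X \<subseteq> B}"

text \<open>Freeness of the elements \<open>x i\<close>, \<open>i \<in> I\<close>: alternating products of centred elements of the
  generated subalgebras are centred.\<close>

definition free_elements ::
  "('a::ring_1) nc_space \<Rightarrow> ('i \<Rightarrow> 'a) \<Rightarrow> 'i set \<Rightarrow> bool" where
  "free_elements S x I \<longleftrightarrow>
     (\<forall>js ys. js \<noteq> [] \<and> length ys = length js \<and> set js \<subseteq> I \<and> distinct_adj js \<and>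
        (\<forall>l<length js. ys ! l \<in> generated_subalgebra S {x (js ! l)} \<and> st S (ys ! l) = 0)
        \<longrightarrow> st S (prod_list ys) = 0)"


section \<open>Free Poisson laws and free multiplicative convolution\<close>

definition free_poisson_density :: "real \<Rightarrow> real \<Rightarrow> real" where
  "free_poisson_density t x =
     indicator {(sqrt t - 1)\<^sup>2 .. (sqrt t + 1)\<^sup>2} x * (sqrt (4 * t - (x - 1 - t)\<^sup>2) / (2 * pi * x))"

text \<open>For \<open>t = 0\<close> the absolutely continuous part vanishes, leaving the point mass at 0.\<close>

definition free_poisson :: "real \<Rightarrow> real measure" where
  "free_poisson t =
     measure_of UNIV (sets borel)
       (\<lambda>A. ennreal (max (1 - t) 0) * indicator A 0 +
            (\<integral>\<^sup>+ x \<in> A. ennreal (free_poisson_density t x) \<partial>lborel))"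

text \<open>
  \<open>s\<close> is the moment sequence of \<open>\<pi>\<^sub>\<mu>\<close>, where \<open>\<mu> = \<Sum> w z \<delta>\<^sub>z\<close> is a finitely supported
  measure of arbitrary mass given by its weights \<open>w\<close>; the variables \<open>\<alpha> z\<close> live in \<open>S\<close>.
\<close>

definition compound_free_poisson_law ::
  "('a::ring_1) nc_space \<Rightarrow> (real \<Rightarrow> real) \<Rightarrow> moment_seq \<Rightarrow> bool" where
  "compound_free_poisson_law S w s \<longleftrightarrow>
     tracial_ncps S \<and> (\<forall>z. w z \<ge> 0) \<and> finite {z. w z > 0} \<and>
     (\<exists>\<alpha>. (\<forall>z. w z > 0 \<longrightarrow> has_law S (\<alpha> z) (moments (free_poisson (w z)))) \<and>
          free_elements S \<alpha> {z. w z > 0} \<and>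
          has_law S (\<Sum>z | w z > 0. scl S (complex_of_real z) (\<alpha> z)) s)"

text \<open>\<open>s\<close> is the moment sequence of \<open>\<mu> \<boxtimes> \<nu>\<close>, realised in \<open>S\<close>; the product \<open>a * b\<close> itself is in
  general not self-adjoint.\<close>

definition free_mult_conv_law ::
  "('a::ring_1) nc_space \<Rightarrow> moment_seq \<Rightarrow> moment_seq \<Rightarrow> moment_seq \<Rightarrow> bool" where
  "free_mult_conv_law S \<mu> \<nu> s \<longleftrightarrow>
     tracial_ncps S \<and>
     (\<exists>a b. has_law S a \<mu> \<and> has_law S b \<nu> \<and>
            free_elements S (\<lambda>i. if i then a else b) (UNIV :: bool set) \<and>
            (\<forall>p. s p = st S ((a * b) ^ p)))"


section \<open>Strings and beads diagrams\<close>

text \<open>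
  For dimensions \<open>ns = [n\<^sub>1, \<dots>, n\<^sub>k]\<close> the legs on each side are numbered \<open>0, \<dots>, 2k - 1\<close> from top to
  bottom.  The colours \<open>n\<^sub>1, \<dots>, n\<^sub>k, n\<^sub>k, \<dots>, n\<^sub>1\<close> are the \<open>k\<close> labels of the tensor factors, not
  their numerical values: legs belonging to two different factors never have the same colour, even
  if these factors happen to have the same dimension.  (With colours compared by value, for
  \<open>n\<^sub>1 = n\<^sub>2\<close> the map \<open>\<phi>(A) = Tr(A) F\<close>, with \<open>F\<close> the flip, would be given by a diagram of four
  undecorated through strings, and for it the formula for the limit law is false.)
\<close>

datatype leg = LeftLeg nat | RightLeg nat

definition legs :: "nat \<Rightarrow> leg set" where
  "legs k = LeftLeg ` {..<2 * k} \<union> RightLeg ` {..<2 * k}"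

definition colour_at :: "nat \<Rightarrow> nat \<Rightarrow> nat" where
  "colour_at k p = (if p < k then p else 2 * k - 1 - p)"

fun leg_colour :: "nat \<Rightarrow> leg \<Rightarrow> nat" where
  "leg_colour k (LeftLeg p) = colour_at k p"
| "leg_colour k (RightLeg p) = colour_at k p"

text \<open>
  A string of size 2 is oriented from \<open>fst (ends B)\<close> to \<open>snd (ends B)\<close> and carries the bead
  \<open>bead B\<close>.  A multi-leg string \<open>B\<close> carries the small bead \<open>center B\<close> at its crossing, and the
  bead \<open>leg_bead l\<close> on each of its legs \<open>l\<close>.  Absence of a bead means the identity matrix.
\<close>

record diagram =
  strings :: "leg set set"
  ends :: "leg set \<Rightarrow> leg \<times> leg"
  bead :: "leg set \<Rightarrow> complex mat"
  center :: "leg set \<Rightarrow> complex"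
  leg_bead :: "leg \<Rightarrow> complex mat"

definition string_dim :: "nat list \<Rightarrow> leg set \<Rightarrow> nat" where
  "string_dim ns B = ns ! (THE r. \<forall>l\<in>B. leg_colour (length ns) l = r)"

definition is_diagram :: "nat list \<Rightarrow> diagram \<Rightarrow> bool" where
  "is_diagram ns P \<longleftrightarrow>
     partition_on (legs (length ns)) (strings P) \<and>
     (\<forall>B \<in> strings P. even (card B) \<and>
        (\<forall>l\<in>B. \<forall>l'\<in>B. leg_colour (length ns) l = leg_colour (length ns) l') \<and>
        (if card B = 2
         then B = {fst (ends P B), snd (ends P B)} \<and>
              bead P B \<in> carrier_mat (string_dim ns B) (string_dim ns B)
         else \<forall>l\<in>B. leg_bead P l \<in> carrier_mat (string_dim ns B) (string_dim ns B)))"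

definition through :: "leg set \<Rightarrow> bool" where
  "through B \<longleftrightarrow> (\<exists>p. LeftLeg p \<in> B) \<and> (\<exists>q. RightLeg q \<in> B)"

definition undecorated :: "nat list \<Rightarrow> diagram \<Rightarrow> leg set \<Rightarrow> bool" where
  "undecorated ns P B \<longleftrightarrow>
     (if card B = 2 then bead P B = 1\<^sub>m (string_dim ns B)
      else \<forall>l\<in>B. leg_bead P l = 1\<^sub>m (string_dim ns B))"

text \<open>\<open>u l\<close> is the index at the leg \<open>l\<close>.  If all \<open>leg_bead\<close>s are identities, the sum below is 1 if
  the indices at all legs are equal and 0 otherwise.\<close>

definition contribution ::
  "nat list \<Rightarrow> diagram \<Rightarrow> (leg \<Rightarrow> nat) \<Rightarrow> leg set \<Rightarrow> complex" where
  "contribution ns P u B =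
     (if card B = 2 then bead P B $$ (u (fst (ends P B)), u (snd (ends P B)))
      else center P B * (\<Sum>y<string_dim ns B. \<Prod>l\<in>B. leg_bead P l $$ (y, u l)))"

text \<open>The \<open>r\<close>-th component of \<open>a < n\<^sub>1 \<cdots> n\<^sub>k\<close> in the lexicographic enumeration of multi-indices.\<close>

definition digit :: "nat list \<Rightarrow> nat \<Rightarrow> nat \<Rightarrow> nat" where
  "digit ns r a = (a div prod_list (drop (Suc r) ns)) mod (ns ! r)"

text \<open>
  A row (or column) index \<open>i = a * n + b\<close> of the matrix, with \<open>a, b < n = n\<^sub>1 \<cdots> n\<^sub>k\<close>, determines
  the indices at the \<open>2k\<close> legs: those of the first \<open>k\<close> legs are the components of \<open>a\<close>, and those of
  the last \<open>k\<close> legs are the components of \<open>b\<close> in reverse order.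
\<close>

definition index_at :: "nat list \<Rightarrow> nat \<Rightarrow> nat \<Rightarrow> nat" where
  "index_at ns i p =
     digit ns (colour_at (length ns) p)
       (if p < length ns then i div prod_list ns else i mod prod_list ns)"

fun leg_index :: "nat list \<Rightarrow> nat \<Rightarrow> nat \<Rightarrow> leg \<Rightarrow> nat" where
  "leg_index ns i j (LeftLeg p) = index_at ns i p"
| "leg_index ns i j (RightLeg p) = index_at ns j p"

definition diagram_mat :: "nat list \<Rightarrow> diagram \<Rightarrow> complex mat" where
  "diagram_mat ns P =
     mat (prod_list ns * prod_list ns) (prod_list ns * prod_list ns)
       (\<lambda>(i, j). \<Prod>B \<in> strings P. contribution ns P (leg_index ns i j) B)"

end

theory Submission
  imports Defs
begin

text \<open>
  Gaussian integration by parts gives loop equations for the mixed moments of the \<open>n\<^sup>2\<close> blocks of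
  \<open>W\<close>.  As \<open>d \<rightarrow> \<infinity>\<close> they close up: traces factorise, and the limits satisfy a Schwinger-Dyson
  recursion.  Contracting with \<open>\<Lambda>\<close>, the moments of \<open>(id \<otimes> \<phi>) W\<close> become sums over noncrossing
  partitions, a block contributing a partial trace of \<open>\<Lambda> (1 \<otimes> D\<^bsup>g1\<^esup>) \<Lambda> (1 \<otimes> D\<^bsup>g2\<^esup>) \<dots>\<close>.  For a
  strings and beads diagram with undecorated through strings these factorise, after multiplication
  by powers of \<open>Tr D\<close>, into traces of powers of \<open>\<Lambda>\<close> and of \<open>D\<close>: the colours decouple, and for each
  single colour the property holds by inspection of the shapes of the partition of its four legs.
  What remains is the recursion for \<open>\<tau>((a b)\<^sup>p)\<close> with \<open>a, b\<close> free, \<open>a\<close> having the free cumulants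
  \<open>mn \<integral>x\<^sup>l d\<rho>\<close> of \<open>\<pi>\<^bsub>mn\<rho>\<^esub>\<close> and \<open>b\<close> the moments of \<open>D\<close>.  For \<open>\<delta> = 0\<close> the
  moments of positive order vanish on both sides.

  Joint moments of free elements are determined by their laws, so to compute them it suffices to exhibit a functional with the right marginals that kills alternating
  centred words, and weighted lattice paths (annihilation and creation operators on the full Fock
  space) provide one.
\<close>

section \<open>Free random variables and lattice paths\<close>

text \<open>The spaces \<open>S\<close> and \<open>T\<close> are arbitrary, so the moments in
  \<open>conv\<close> have to be derived from freeness alone. The path models used for this never
  form vectors of a Fock space: a letter acts on functions of a stack, a word is a composition of
  such actions evaluated at the initial stack, and all sums are finite because cumulants are cut off
  at an order \<open>N\<close> that the words in question do not exceed. On the matrix side the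
  obstacle is that limits of partial traces are matrices, not scalars. The recursion closes on
  scalars only because these limits stay in the span of the powers of D, and the factorisation
  property is what keeps them there. It is stated with a power of Tr D as a factor rather than a
  divisor, so it is multiplicative over colours even if some colour has a traceless D. A block of l
  letters contributes Tr(\<Lambda>^l) / (Tr D)^l, and scaling every letter by \<delta> m absorbs
  these denominators. The free Poisson law enters through one identity: x times its density is t
  times the density of a semicircle law of mean 1 + t and variance t, whose moments are Chebyshev
  integrals.\<close>

fun centred :: "('i list \<Rightarrow> complex) \<Rightarrow> 'i list \<Rightarrow> ('i \<times> nat) list \<Rightarrow> complex" where
  "centred f u [] = f u"
| "centred f u ((j, e) # bs) =
     centred f (u @ replicate e j) bs - f (replicate e j) * centred f u bs"

definition flatten :: "('i \<times> nat) list \<Rightarrow> 'i list" where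
  "flatten bs = concat (map (\<lambda>(j, e). replicate e j) bs)"

text \<open>\<open>centred f u bs\<close> expands by linearity the value of \<open>f\<close> at the
  word \<open>u\<close> followed by the factors x_j^e - f(x_j^e). Centred powers are enough because
  they span the centred polynomials in one letter.\<close>

definition free_functional :: "'i set \<Rightarrow> ('i list \<Rightarrow> complex) \<Rightarrow> bool" where
  "free_functional I f \<longleftrightarrow>
     (\<forall>bs. bs \<noteq> [] \<and> distinct_adj (map fst bs) \<and> fst ` set bs \<subseteq> I \<longrightarrow> centred f [] bs = 0)"

text \<open>Expanding the centred factors, every word except \<open>u @ flatten bs\<close> has lost
  a whole block, hence is shorter than \<open>N\<close>, and the scalars in front are one-letter
  moments of order at most \<open>N\<close>. On all of these \<open>f\<close> and \<open>g\<close>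
  agree, so only the full word survives in the difference.\<close>

lemma centred_diff:
  assumes short: "\<And>w. set w \<subseteq> I \<Longrightarrow> length w < N \<Longrightarrow> f w = g w"
    and marginal: "\<And>j e. j \<in> I \<Longrightarrow> e \<le> N \<Longrightarrow> f (replicate e j) = g (replicate e j)"
    and "set u \<subseteq> I" "fst ` set bs \<subseteq> I" "\<forall>b\<in>set bs. snd b \<ge> 1"
    and "length u + length (flatten bs) \<le> N"
  shows "centred f u bs - centred g u bs = f (u @ flatten bs) - g (u @ flatten bs)"
  using assms(3-)
proof (induction bs arbitrary: u)
  case Nil
  then show ?case by (simp add: flatten_def)
next
  case (Cons b bs)
  obtain j e where b: "b = (j, e)" by (cases b)
  have e: "e \<ge> 1" and j: "j \<in> I" using Cons.prems b by auto
  have len: "length u + (e + length (flatten bs)) \<le> N"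
    using Cons.prems(4) b by (simp add: flatten_def)
  have "set (u @ flatten bs) \<subseteq> I"
    using Cons.prems(1,2) by (force simp: flatten_def)
  \<comment> \<open>The word without the block \<open>b\<close>, shorter than \<open>N\<close>
    because \<open>e\<close> is at least 1.\<close>
  then have eq: "f (u @ flatten bs) = g (u @ flatten bs)"
    using short len e by auto
  have "centred f (u @ replicate e j) bs - centred g (u @ replicate e j) bs
      = f ((u @ replicate e j) @ flatten bs) - g ((u @ replicate e j) @ flatten bs)"
    using Cons.prems j len by (intro Cons.IH) auto
  moreover have "centred f u bs - centred g u bs = f (u @ flatten bs) - g (u @ flatten bs)"
    using Cons.prems len by (intro Cons.IH) auto
  moreover have "f (replicate e j) = g (replicate e j)"
    using marginal j len by auto
  ultimately show ?case
    using eq by (simp add: b flatten_def)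
qed

text \<open>Run-length encoding. Exponents at least 1 guarantee that dropping a block shortens the
  word.\<close>

lemma alternating_blocks_exist:
  "\<exists>bs. flatten bs = w \<and> distinct_adj (map fst bs) \<and> (\<forall>b\<in>set bs. snd b \<ge> 1) \<and> fst ` set bs \<subseteq> set w"
proof (induction w)
  case Nil
  show ?case by (rule exI[of _ "[]"]) (simp add: flatten_def)
next
  case (Cons x w)
  then obtain bs where bs: "flatten bs = w" "distinct_adj (map fst bs)"
    "\<forall>b\<in>set bs. snd b \<ge> 1" "fst ` set bs \<subseteq> set w" by blast
  show ?case
  proof (cases "\<exists>e bs'. bs = (x, e) # bs'")
    case True
    then obtain e bs' where b: "bs = (x, e) # bs'" by blast
    show ?thesis
      using bs b by (intro exI[of _ "(x, Suc e) # bs'"]) (auto simp: flatten_def)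
  next
    case False
    then have "distinct_adj (map fst ((x, 1) # bs))"
      using bs(2) by (cases bs) auto
    then show ?thesis
      using bs by (intro exI[of _ "(x, 1) # bs"]) (auto simp: flatten_def)
  qed
qed

text \<open>Induction on the length, cutting the word into maximal runs: both centred values vanish,
  and their difference is the difference of \<open>f\<close> and \<open>g\<close> at the full word.
  The bound \<open>N\<close> permits comparison with models whose marginals are right only up to a
  finite order.\<close>

theorem free_functional_unique:
  assumes "free_functional I f" "free_functional I g" "f [] = g []"
    and marginal: "\<And>j e. j \<in> I \<Longrightarrow> e \<le> N \<Longrightarrow> f (replicate e j) = g (replicate e j)"
    and "set w \<subseteq> I" "length w \<le> N"
  shows "f w = g w"
  using assms(5,6)
proof (induction "length w" arbitrary: w rule: less_induct)
  case less
  show ?case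
  proof (cases "w = []")
    case True
    then show ?thesis using assms(3) by simp
  next
    case False
    obtain bs where bs: "flatten bs = w" "distinct_adj (map fst bs)"
      "\<forall>b\<in>set bs. snd b \<ge> 1" "fst ` set bs \<subseteq> set w"
      using alternating_blocks_exist[of w] by blast
    have ne: "bs \<noteq> []" using False bs(1) by (auto simp: flatten_def)
    have "centred f [] bs - centred g [] bs = f ([] @ flatten bs) - g ([] @ flatten bs)"
    proof (rule centred_diff[where I = I and N = "length w"])
      show "f v = g v" if "set v \<subseteq> I" "length v < length w" for v
        using less that by auto
      show "f (replicate e j) = g (replicate e j)" if "j \<in> I" "e \<le> length w" for j e
        using marginal less that by auto
    qed (use bs less in auto)
    moreover have "centred f [] bs = 0" "centred g [] bs = 0"
      using assms(1,2) ne bs less.prems unfolding free_functional_def by blast+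
    ultimately show ?thesis using bs(1) by simp
  qed
qed

section \<open>From freeness in an algebra to functionals on words\<close>

definition joint_moment :: "('a::ring_1) nc_space \<Rightarrow> ('i \<Rightarrow> 'a) \<Rightarrow> 'i list \<Rightarrow> complex" where
  "joint_moment S x w = st S (prod_list (map x w))"

context
  fixes S :: "('a::ring_1) nc_space"
  assumes S: "tracial_ncps S"
begin

lemma st_add: "st S (a + b) = st S a + st S b"
  and st_scl: "st S (scl S c a) = c * st S a"
  and st_one: "st S 1 = 1"
  and scl_mult_left: "scl S c a * b = scl S c (a * b)"
  and scl_mult_right: "a * scl S c b = scl S c (a * b)"
  using S by (auto simp: tracial_ncps_def)

lemma scl_vector_space: "vector_space (scl S)"
  using S by (simp add: tracial_ncps_def)

lemma scl_minus_one: "scl S (- 1) a = - a"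
  using module.scale_minus_left[of "scl S" 1 a] module.scale_one[of "scl S" a]
    scl_vector_space by (simp add: module_iff_vector_space)

lemma st_diff: "st S (a - b) = st S a - st S b"
  using st_add[of a "- b"] st_scl[of "- 1" b] by (simp add: scl_minus_one)

lemma st_zero: "st S 0 = 0"
  using st_diff[of 0 0] by simp

lemma st_sum: "st S (sum f A) = (\<Sum>x\<in>A. st S (f x))"
  by (induction A rule: infinite_finite_induct) (auto simp: st_zero st_add)

lemma generated_subalgebra_diff_power:
  "x ^ e - scl S c 1 \<in> generated_subalgebra S {x}"
proof -
  have "x ^ e - scl S c 1 \<in> B" if B: "unital_star_subalgebra S B" "{x} \<subseteq> B" for B
  proof -
    have "x ^ e \<in> B"
      by (induction e) (use B in \<open>auto simp: unital_star_subalgebra_def\<close>)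
    moreover have "scl S (- 1) (scl S c 1) \<in> B"
      using B by (auto simp: unital_star_subalgebra_def)
    ultimately have "x ^ e + scl S (- 1) (scl S c 1) \<in> B"
      using B unfolding unital_star_subalgebra_def by blast
    then show ?thesis by (simp add: scl_minus_one)
  qed
  then show ?thesis by (auto simp: generated_subalgebra_def)
qed

text \<open>Translates the formal expansion into a genuine product of centred powers, to which
  freeness in the algebra applies.\<close>

lemma centred_joint_moment:
  "centred (joint_moment S x) u bs =
     st S (prod_list (map x u) *
       prod_list (map (\<lambda>(j, e). x j ^ e - scl S (joint_moment S x (replicate e j)) 1) bs))"
proof (induction bs arbitrary: u)
  case Nil
  then show ?case by (simp add: joint_moment_def)
next
  case (Cons b bs)
  obtain j e where b: "b = (j, e)" by (cases b)
  show ?case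
    by (simp add: b Cons.IH algebra_simps st_diff st_scl scl_mult_left scl_mult_right
        prod_list_replicate flip: mult.assoc)
qed

lemma free_elements_functional:
  assumes "free_elements S x I"
  shows "free_functional I (joint_moment S x)"
  unfolding free_functional_def
proof (intro allI impI, elim conjE)
  fix bs :: "('b \<times> nat) list"
  assume bs: "bs \<noteq> []" "distinct_adj (map fst bs)" "fst ` set bs \<subseteq> I"
  let ?ys = "map (\<lambda>(j, e). x j ^ e - scl S (joint_moment S x (replicate e j)) 1) bs"
  have "\<forall>l<length (map fst bs).
      ?ys ! l \<in> generated_subalgebra S {x (map fst bs ! l)} \<and> st S (?ys ! l) = 0"
    by (auto simp: split_beta generated_subalgebra_diff_power st_diff st_scl st_one
        joint_moment_def prod_list_replicate)
  then have "st S (prod_list ?ys) = 0"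
    using assms bs unfolding free_elements_def
    by (metis (no_types, lifting) length_map map_is_Nil_conv set_map)
  then show "centred (joint_moment S x) [] bs = 0"
    by (simp add: centred_joint_moment)
qed

end

text \<open>A letter acts on functions \<open>k\<close> of a state, where \<open>k\<close> stands
  for the rest of the word; the leftmost letter is the first to change the state \<open>t0\<close>.
  As letters act linearly, centring a block means subtracting a scalar from a power of its
  operator.\<close>

lemma centred_foldr:
  assumes lin: "\<And>i k k' c. op i (\<lambda>t. k t - c * k' t) = (\<lambda>t. op i k t - c * op i k' t)"
    and f: "f = (\<lambda>w. foldr op w k0 t0)"
  shows "centred f u bs =
    foldr op u (foldr (\<lambda>(j, e) k t. (op j ^^ e) k t - f (replicate e j) * k t) bs k0) t0"
proof (induction bs arbitrary: u)
  case Nil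
  then show ?case by (simp add: f)
next
  case (Cons b bs)
  obtain j e where b: "b = (j, e)" by (cases b)
  have lin': "foldr op u (\<lambda>t. k t - c * k' t) = (\<lambda>t. foldr op u k t - c * foldr op u k' t)"
    for k k' c
    by (induction u) (simp_all add: lin)
  show ?case
    by (simp add: b Cons.IH lin' foldr_replicate)
qed

text \<open>Sum over weighted Lukasiewicz paths of \<open>n\<close> steps from height
  \<open>h\<close> to 0, never below 0: a step up by \<open>s\<close> costs
  \<open>\<kappa> (Suc s)\<close> (a level step for \<open>s = 0\<close>), a step down by one costs
  1. For \<open>h = 0\<close> and \<open>n \<le> N\<close> this is the \<open>n\<close>-th moment of
  the law with free cumulants \<open>\<kappa>\<close>.\<close>

fun height_moment :: "nat \<Rightarrow> (nat \<Rightarrow> complex) \<Rightarrow> nat \<Rightarrow> nat \<Rightarrow> complex" where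
  "height_moment N \<kappa> 0 h = (if h = 0 then 1 else 0)"
| "height_moment N \<kappa> (Suc n) h =
     (\<Sum>s<N. \<kappa> (Suc s) * height_moment N \<kappa> n (h + s)) +
     (if h = 0 then 0 else height_moment N \<kappa> n (h - 1))"

text \<open>An annihilation operator plus a weighted sum of powers of the creation operator of
  \<open>i\<close>, written as an action on functions: from the stack \<open>t\<close> one either
  pushes \<open>s\<close> copies of \<open>i\<close> or pops one \<open>i\<close>.\<close>

definition fock_op ::
  "nat \<Rightarrow> ('i \<Rightarrow> nat \<Rightarrow> complex) \<Rightarrow> 'i \<Rightarrow> ('i list \<Rightarrow> complex) \<Rightarrow> 'i list \<Rightarrow> complex" where
  "fock_op N \<kappa> i k t =
     (\<Sum>s<N. \<kappa> i (Suc s) * k (replicate s i @ t)) +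
     (case t of [] \<Rightarrow> 0 | x # t' \<Rightarrow> if x = i then k t' else 0)"

definition vacuum :: "'i list \<Rightarrow> complex" where
  "vacuum t = (if t = [] then 1 else 0)"

definition fock_moment :: "nat \<Rightarrow> ('i \<Rightarrow> nat \<Rightarrow> complex) \<Rightarrow> 'i list \<Rightarrow> complex" where
  "fock_moment N \<kappa> w = foldr (fock_op N \<kappa>) w vacuum []"

lemma fock_op_diff:
  "fock_op N \<kappa> i (\<lambda>t. k t - c * k' t) = (\<lambda>t. fock_op N \<kappa> i k t - c * fock_op N \<kappa> i k' t)"
  by (auto simp: fock_op_def fun_eq_iff algebra_simps sum_subtractf sum_distrib_left
      split: list.splits)

text \<open>If \<open>t\<close> does not begin with \<open>i\<close>, the operator of
  \<open>i\<close> cannot pop into \<open>t\<close>, so the run of \<open>i\<close> above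
  \<open>t\<close> evolves as if it stood on the empty stack.\<close>

lemma fock_op_shift:
  assumes "t = [] \<or> hd t \<noteq> i" "\<And>h. k1 (replicate h i @ t) = a * k2 (replicate h i)"
  shows "(fock_op N \<kappa> i ^^ e) k1 (replicate h i @ t) = a * (fock_op N \<kappa> i ^^ e) k2 (replicate h i)"
proof (induction e arbitrary: h)
  case 0
  then show ?case using assms by simp
next
  case (Suc e)
  have pop: "(case replicate h i @ t of [] \<Rightarrow> 0 | x # t' \<Rightarrow> if x = i then K1 t' else 0)
      = a * (case replicate h i of [] \<Rightarrow> 0 | x # t' \<Rightarrow> if x = i then K2 t' else 0)"
    if "\<And>h. K1 (replicate h i @ t) = a * K2 (replicate h i)" for K1 K2
    using assms(1) that by (cases h) (auto split: list.splits)
  let ?K1 = "(fock_op N \<kappa> i ^^ e) k1" and ?K2 = "(fock_op N \<kappa> i ^^ e) k2"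
  have "?K1 (replicate s i @ replicate h i @ t) = a * ?K2 (replicate s i @ replicate h i)" for s
    using Suc.IH[of "s + h"] by (simp add: replicate_add)
  moreover note pop[of ?K1 ?K2, OF Suc.IH]
  ultimately show ?case
    by (simp add: fock_op_def[where k = ?K1] fock_op_def[where k = ?K2]
        distrib_left sum_distrib_left mult.left_commute)
qed

lemma fock_free: "free_functional I (fock_moment N \<kappa>)"
  unfolding free_functional_def
proof (intro allI impI, elim conjE)
  fix bs :: "('a \<times> nat) list"
  assume bs: "bs \<noteq> []" "distinct_adj (map fst bs)"
  let ?F = "fock_moment N \<kappa>"
  let ?K = "\<lambda>bs. foldr (\<lambda>(j, e) k t. (fock_op N \<kappa> j ^^ e) k t - ?F (replicate e j) * k t) bs vacuum"
  \<comment> \<open>The invariant is vanishing on every stack that the first block cannot pop. By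
    it, the remaining blocks annihilate all stacks on which the first block has left letters
    \<open>j\<close> of its own; that block therefore contributes its vacuum moment times
    \<open>?K bs t\<close>, which centring removes.\<close>
  have "?K bs t = 0" if "bs \<noteq> []" "distinct_adj (map fst bs)" "t = [] \<or> hd t \<noteq> fst (hd bs)" for bs t
    using that
  proof (induction bs arbitrary: t)
    case Nil
    then show ?case by simp
  next
    case (Cons b bs)
    obtain j e where b: "b = (j, e)" by (cases b)
    have 0: "?K bs (replicate (Suc h) j @ t) = 0" for h
    proof (cases "bs = []")
      case True
      then show ?thesis by (simp add: vacuum_def)
    next
      case False
      then show ?thesis
        using Cons.prems b by (intro Cons.IH) (auto simp: distinct_adj_Cons neq_Nil_conv)
    qed
    have "(fock_op N \<kappa> j ^^ e) (?K bs) (replicate 0 j @ t)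
        = ?K bs t * (fock_op N \<kappa> j ^^ e) vacuum (replicate 0 j)"
    proof (rule fock_op_shift)
      show "t = [] \<or> hd t \<noteq> j" using Cons.prems b by simp
      show "?K bs (replicate h j @ t) = ?K bs t * vacuum (replicate h j)" for h
        using 0[of "h - 1"] by (cases h) (auto simp: vacuum_def)
    qed
    then show ?case
      by (simp add: b fock_moment_def foldr_replicate)
  qed
  then have "?K bs [] = 0" using bs by blast
  moreover have "centred ?F [] bs = foldr (fock_op N \<kappa>) [] (?K bs) []"
    by (rule centred_foldr) (simp_all add: fock_op_diff fock_moment_def fun_eq_iff)
  ultimately show "centred ?F [] bs = 0" by simp
qed

text \<open>Additivity of free cumulants. Each letter on the stack owes the factor \<open>z\<close>
  of its later pop. With these debts collected in front, a push of \<open>s\<close> copies of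
  \<open>i\<close> has total weight \<open>\<kappa> i (Suc s) * z i ^ Suc s\<close>, and only the
  length of the stack matters.\<close>

lemma fock_op_mix_power:
  assumes "finite I" "set t \<subseteq> I"
  shows "((\<lambda>k t. \<Sum>i\<in>I. z i * fock_op N \<kappa> i k t) ^^ n) vacuum t =
    prod_list (map z t) * height_moment N (\<lambda>s. \<Sum>i\<in>I. \<kappa> i s * z i ^ s) n (length t)"
  using assms(2)
proof (induction n arbitrary: t)
  case 0
  then show ?case by (simp add: vacuum_def)
next
  case (Suc n)
  let ?mix = "\<lambda>k t. \<Sum>i\<in>I. z i * fock_op N \<kappa> i k t"
  let ?\<kappa> = "\<lambda>s. \<Sum>i\<in>I. \<kappa> i s * z i ^ s"
  let ?k = "(?mix ^^ n) vacuum"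
  have k: "?k (replicate s i @ t) = z i ^ s * prod_list (map z t) * height_moment N ?\<kappa> n (s + length t)"
    if "i \<in> I" for s i
    using Suc that by (subst Suc.IH) (auto simp: prod_list_replicate)
  have 1: "(\<Sum>i\<in>I. z i * (\<Sum>s<N. \<kappa> i (Suc s) * ?k (replicate s i @ t)))
    = prod_list (map z t) * (\<Sum>s<N. ?\<kappa> (Suc s) * height_moment N ?\<kappa> n (length t + s))"
    by (simp add: k sum_distrib_left sum_distrib_right sum.swap[of _ I] mult_ac add_ac cong: sum.cong)
  have 2: "(\<Sum>i\<in>I. z i * (case t of [] \<Rightarrow> 0 | x # t' \<Rightarrow> if x = i then ?k t' else 0))
    = prod_list (map z t) * (if length t = 0 then 0 else height_moment N ?\<kappa> n (length t - 1))"
  proof (cases t)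
    case (Cons x t')
    have "(\<Sum>i\<in>I. z i * (if x = i then ?k t' else 0)) = (\<Sum>i\<in>I. if x = i then z x * ?k t' else 0)"
      by (intro sum.cong) auto
    then show ?thesis
      using Suc.prems Cons assms(1) Suc.IH[of t'] by (simp add: mult_ac)
  qed simp
  have "(?mix ^^ Suc n) vacuum t = (\<Sum>i\<in>I. z i * (\<Sum>s<N. \<kappa> i (Suc s) * ?k (replicate s i @ t)))
     + (\<Sum>i\<in>I. z i * (case t of [] \<Rightarrow> 0 | x # t' \<Rightarrow> if x = i then ?k t' else 0))"
    by (simp add: fock_op_def[where k = ?k] distrib_left sum.distrib)
  then show ?case
    by (simp only: 1 2 height_moment.simps distrib_left)
qed

lemma fock_marginal: "fock_moment N \<kappa> (replicate e i) = height_moment N (\<kappa> i) e 0"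
proof -
  have "(fock_op N \<kappa> i ^^ e) vacuum [] = height_moment N (\<kappa> i) e 0"
    using fock_op_mix_power[where I = "{i}" and t = "[]" and z = "\<lambda>_. 1" and n = e] by simp
  then show ?thesis by (simp add: fock_moment_def foldr_replicate)
qed

section \<open>Moments of linear combinations of free elements\<close>

fun word_sum :: "'i set \<Rightarrow> ('i \<Rightarrow> complex) \<Rightarrow> ('i list \<Rightarrow> complex) \<Rightarrow> nat \<Rightarrow> 'i list \<Rightarrow> complex" where
  "word_sum I c f 0 u = f u"
| "word_sum I c f (Suc p) u = (\<Sum>i\<in>I. c i * word_sum I c f p (u @ [i]))"

lemma word_sum_cong:
  assumes "\<And>w. set w \<subseteq> I \<Longrightarrow> length w \<le> N \<Longrightarrow> f w = g w" "set u \<subseteq> I" "length u + p \<le> N"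
  shows "word_sum I c f p u = word_sum I c g p u"
  using assms(2,3)
  by (induction p arbitrary: u) (auto intro!: sum.cong assms(1))

lemma word_sum_joint_moment:
  assumes S: "tracial_ncps S"
  shows "word_sum I c (joint_moment S x) p u =
    st S (prod_list (map x u) * (\<Sum>i\<in>I. scl S (c i) (x i)) ^ p)"
proof (induction p arbitrary: u)
  case 0
  then show ?case by (simp add: joint_moment_def)
next
  case (Suc p)
  show ?case
    by (simp add: Suc.IH sum_distrib_left sum_distrib_right st_sum[OF S] st_scl[OF S]
        scl_mult_left[OF S] scl_mult_right[OF S] mult.assoc)
qed

lemma word_sum_fock:
  "word_sum I c (fock_moment N \<kappa>) p u =
    foldr (fock_op N \<kappa>) u (((\<lambda>k t. \<Sum>i\<in>I. c i * fock_op N \<kappa> i k t) ^^ p) vacuum) []"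
proof (induction p arbitrary: u)
  case 0
  then show ?case by (simp add: fock_moment_def)
next
  case (Suc p)
  have lin: "fock_op N \<kappa> j (\<lambda>t. \<Sum>i\<in>I. c i * K i t) = (\<lambda>t. \<Sum>i\<in>I. c i * fock_op N \<kappa> j (K i) t)"
    for j K
    by (auto simp: fock_op_def fun_eq_iff distrib_left sum_distrib_left sum.distrib
        sum.swap[of _ I] mult_ac split: list.splits)
  have "foldr (fock_op N \<kappa>) u (\<lambda>t. \<Sum>i\<in>I. c i * K i t)
      = (\<lambda>t. \<Sum>i\<in>I. c i * foldr (fock_op N \<kappa>) u (K i) t)" for K
    by (induction u) (simp_all add: lin)
  then show ?case
    by (simp add: Suc.IH)
qed

theorem free_sum_moment:
  assumes S: "tracial_ncps S" and "free_elements S x I" "finite I"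
    and "\<And>i e. i \<in> I \<Longrightarrow> e \<le> N \<Longrightarrow> st S (x i ^ e) = height_moment N (\<kappa> i) e 0"
    and "p \<le> N"
  shows "st S ((\<Sum>i\<in>I. scl S (c i) (x i)) ^ p) =
    height_moment N (\<lambda>s. \<Sum>i\<in>I. \<kappa> i s * c i ^ s) p 0"
proof -
  have "st S ((\<Sum>i\<in>I. scl S (c i) (x i)) ^ p) = word_sum I c (joint_moment S x) p []"
    by (simp add: word_sum_joint_moment[OF S])
  also have "\<dots> = word_sum I c (fock_moment N \<kappa>) p []"
  proof (rule word_sum_cong)
    show "joint_moment S x w = fock_moment N \<kappa> w" if "set w \<subseteq> I" "length w \<le> N" for w
    proof (rule free_functional_unique[OF free_elements_functional[OF S assms(2)] fock_free])
      show "joint_moment S x [] = fock_moment N \<kappa> []"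
        by (simp add: joint_moment_def fock_moment_def vacuum_def st_one[OF S])
      show "joint_moment S x (replicate e j) = fock_moment N \<kappa> (replicate e j)"
        if "j \<in> I" "e \<le> N" for j e
        using assms(4)[OF that] by (simp add: fock_marginal) (simp add: joint_moment_def prod_list_replicate)
    qed (use that in auto)
  qed (use assms in auto)
  also have "\<dots> = height_moment N (\<lambda>s. \<Sum>i\<in>I. \<kappa> i s * c i ^ s) p 0"
    using assms(3) by (simp add: word_sum_fock fock_op_mix_power)
  finally show ?thesis .
qed

section \<open>Products of free elements\<close>

lemma height_moment_cong:
  assumes "\<And>s. s < N \<Longrightarrow> \<kappa> (Suc s) = \<kappa>' (Suc s)"
  shows "height_moment N \<kappa> n h = height_moment N \<kappa>' n h"
  by (induction n arbitrary: h) (simp_all add: assms)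

text \<open>Reads a word in a and b from left to right and sums over noncrossing partitions of the
  letters a, with cumulants of a for their blocks and moments of b for the blocks of the
  complementary partition. The stack holds a counter of letters b for every open gap, innermost on
  top. An a either starts a block of \<open>s + 1\<close> elements, opening the \<open>s\<close>
  gaps between them, or closes the innermost gap and continues its block. The bottom counter belongs
  to the outer region, which no a can close.\<close>

definition count_a ::
  "nat \<Rightarrow> (nat \<Rightarrow> complex) \<Rightarrow> (nat \<Rightarrow> complex) \<Rightarrow> (nat list \<Rightarrow> complex) \<Rightarrow> nat list \<Rightarrow> complex" where
  "count_a N \<kappa> \<beta> k t =
     (\<Sum>s<N. \<kappa> (Suc s) * k (replicate s 0 @ t)) + (if 2 \<le> length t then \<beta> (hd t) * k (tl t) else 0)"

definition count_b :: "(nat list \<Rightarrow> complex) \<Rightarrow> nat list \<Rightarrow> complex" where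
  "count_b k t = k (Suc (hd t) # tl t)"

text \<open>A stack of length 1 means that all blocks are complete; the counter left is that of the
  outer region.\<close>

definition count_end :: "(nat \<Rightarrow> complex) \<Rightarrow> nat list \<Rightarrow> complex" where
  "count_end \<beta> t = (if length t = 1 then \<beta> (hd t) else 0)"

definition count_op ::
  "nat \<Rightarrow> (nat \<Rightarrow> complex) \<Rightarrow> (nat \<Rightarrow> complex) \<Rightarrow> bool \<Rightarrow> (nat list \<Rightarrow> complex) \<Rightarrow> nat list \<Rightarrow> complex" where
  "count_op N \<kappa> \<beta> i = (if i then count_a N \<kappa> \<beta> else count_b)"

definition count_moment ::
  "nat \<Rightarrow> (nat \<Rightarrow> complex) \<Rightarrow> (nat \<Rightarrow> complex) \<Rightarrow> bool list \<Rightarrow> complex" where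
  "count_moment N \<kappa> \<beta> w = foldr (count_op N \<kappa> \<beta>) w (count_end \<beta>) [0]"

lemma count_op_diff:
  "count_op N \<kappa> \<beta> i (\<lambda>t. k t - c * k' t) = (\<lambda>t. count_op N \<kappa> \<beta> i k t - c * count_op N \<kappa> \<beta> i k' t)"
  by (auto simp: count_op_def count_a_def count_b_def fun_eq_iff algebra_simps sum_subtractf
      sum_distrib_left)

lemma count_b_power: "(count_b ^^ e) k (c # t) = k ((c + e) # t)"
  by (induction e arbitrary: c) (simp_all add: count_b_def)

text \<open>A run of a's either returns to the counters \<open>c # t\<close> it began with, walking
  on the number of fresh empty gaps, or closes \<open>c\<close> at some moment and pays
  \<open>\<beta> c\<close>, after which \<open>c\<close> is forgotten. Paths of the first kind that
  end with fresh gaps still open are killed by the hypothesis on \<open>k\<close>.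
  \<open>R h []\<close> vanishes because the bottom counter is never closed.\<close>

lemma count_a_power:
  assumes "\<beta> 0 = 1" and k: "\<And>t. t \<noteq> [] \<Longrightarrow> k (0 # t) = 0"
  shows "\<exists>R. (\<forall>h. R h [] = 0) \<and> (\<forall>h c t. (count_a N \<kappa> \<beta> ^^ e) k (replicate h 0 @ c # t) =
    height_moment N \<kappa> e h * k (c # t) + \<beta> c * R h t)"
proof (induction e)
  case 0
  have "k (replicate h 0 @ c # t) = (if h = 0 then k (c # t) else 0)" for h c t
    by (cases h) (simp_all add: k)
  then show ?case
    by (intro exI[of _ "\<lambda>_ _. 0"]) simp
next
  case (Suc e)
  let ?k = "(count_a N \<kappa> \<beta> ^^ e) k"
  from Suc obtain R where R: "\<And>h. R h [] = 0"
    "\<And>h c t. ?k (replicate h 0 @ c # t) = height_moment N \<kappa> e h * k (c # t) + \<beta> c * R h t"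
    by blast
  define R' where "R' = (\<lambda>h t. (\<Sum>s<N. \<kappa> (Suc s) * R (h + s) t) +
    (if h = 0 then (if t = [] then 0 else ?k t) else R (h - 1) t))"
  have "count_a N \<kappa> \<beta> ?k (replicate h 0 @ c # t) =
      height_moment N \<kappa> (Suc e) h * k (c # t) + \<beta> c * R' h t" for h c t
  proof -
    have 1: "?k (replicate s 0 @ replicate h 0 @ c # t) =
        height_moment N \<kappa> e (h + s) * k (c # t) + \<beta> c * R (h + s) t" for s
      using R(2)[of "s + h" c t] by (simp add: replicate_add add.commute[of h])
    have 2: "(if 2 \<le> length (replicate h 0 @ c # t)
        then \<beta> (hd (replicate h 0 @ c # t)) * ?k (tl (replicate h 0 @ c # t)) else 0)
      = (if h = 0 then 0 else height_moment N \<kappa> e (h - 1)) * k (c # t)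
        + \<beta> c * (if h = 0 then (if t = [] then 0 else ?k t) else R (h - 1) t)"
      using R(2)[of "h - 1" c t] by (cases h) (auto simp: assms(1) neq_Nil_conv)
    show ?thesis
      unfolding count_a_def 1 2 R'_def
      by (simp add: sum_distrib_left sum_distrib_right sum.distrib distrib_left distrib_right mult_ac)
  qed
  moreover have "R' h [] = 0" for h by (simp add: R'_def R)
  ultimately show ?case by (intro exI[of _ R']) simp
qed

lemma count_marginal_a:
  assumes "\<beta> 0 = 1"
  shows "count_moment N \<kappa> \<beta> (replicate e True) = height_moment N \<kappa> e 0"
proof -
  have "\<exists>R. (\<forall>h. R h [] = 0) \<and>
      (\<forall>h c t. (count_a N \<kappa> \<beta> ^^ e) (count_end \<beta>) (replicate h 0 @ c # t) =
        height_moment N \<kappa> e h * count_end \<beta> (c # t) + \<beta> c * R h t)"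
    by (rule count_a_power) (auto simp: assms count_end_def)
  then obtain R where "\<And>h. R h [] = 0"
    "\<And>h c t. (count_a N \<kappa> \<beta> ^^ e) (count_end \<beta>) (replicate h 0 @ c # t) =
        height_moment N \<kappa> e h * count_end \<beta> (c # t) + \<beta> c * R h t" by blast
  from this(1) this(2)[of 0 0 "[]"] show ?thesis
    by (simp add: count_moment_def foldr_replicate count_op_def count_end_def assms)
qed

lemma count_marginal_b: "count_moment N \<kappa> \<beta> (replicate e False) = \<beta> e"
  by (simp add: count_moment_def foldr_replicate count_op_def count_b_power count_end_def)

lemma count_free:
  assumes \<beta>: "\<beta> 0 = 1"
  shows "free_functional UNIV (count_moment N \<kappa> \<beta>)"
  unfolding free_functional_def
proof (intro allI impI, elim conjE)
  fix bs :: "(bool \<times> nat) list"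
  assume bs: "bs \<noteq> []" "distinct_adj (map fst bs)"
  let ?F = "count_moment N \<kappa> \<beta>"
  let ?op = "count_op N \<kappa> \<beta>"
  let ?K = "\<lambda>bs. foldr (\<lambda>(j, e) k t. (?op j ^^ e) k t - ?F (replicate e j) * k t) bs (count_end \<beta>)"
  \<comment> \<open>Two invariants that feed each other. If a block of a's comes first, the value is
    \<open>\<beta> c\<close> times something independent of the top counter \<open>c\<close>; a
    preceding b^e started at \<open>c = 0\<close> turns \<open>\<beta> 0\<close> into
    \<open>\<beta> e\<close>, and centring cancels it. If a block of b's comes first, the value
    vanishes on an empty top counter, which is the hypothesis of \<open>count_a_power\<close>, whose
    \<open>height_moment\<close> term centring removes.\<close>
  have "(fst (hd bs) \<longrightarrow> (\<exists>R. R [] = 0 \<and> (\<forall>c t. ?K bs (c # t) = \<beta> c * R t))) \<and>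
        (\<not> fst (hd bs) \<longrightarrow> (\<forall>t. ?K bs (0 # t) = 0))"
    if "bs \<noteq> []" "distinct_adj (map fst bs)" for bs
    using that
  proof (induction bs)
    case Nil
    then show ?case by simp
  next
    case (Cons b bs)
    obtain j e where b: "b = (j, e)" by (cases b)
    have adj: "bs \<noteq> [] \<Longrightarrow> fst (hd bs) \<noteq> j" "distinct_adj (map fst bs)"
      using Cons.prems b by (auto simp: distinct_adj_Cons neq_Nil_conv)
    show ?case
    proof (cases j)
      case True
      have "?K bs (0 # t) = 0" if "t \<noteq> []" for t
      proof (cases "bs = []")
        case False
        then show ?thesis using Cons.IH adj True by auto
      qed (use that in \<open>simp add: count_end_def\<close>)
      then have "\<exists>R. (\<forall>h. R h [] = 0) \<and>
          (\<forall>h c t. (count_a N \<kappa> \<beta> ^^ e) (?K bs) (replicate h 0 @ c # t) =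
            height_moment N \<kappa> e h * ?K bs (c # t) + \<beta> c * R h t)"
        by (intro count_a_power \<beta>)
      then obtain R where R: "\<And>h. R h [] = 0"
          "\<And>h c t. (count_a N \<kappa> \<beta> ^^ e) (?K bs) (replicate h 0 @ c # t) =
            height_moment N \<kappa> e h * ?K bs (c # t) + \<beta> c * R h t" by blast
      have "?K (b # bs) (c # t) = \<beta> c * R 0 t" for c t
        using R(2)[of 0 c t] by (simp add: b True count_op_def count_marginal_a \<beta>)
      then show ?thesis using True b R(1) by auto
    next
      case False
      have "\<exists>R. \<forall>c t. ?K bs (c # t) = \<beta> c * R t"
      proof (cases "bs = []")
        case True
        then show ?thesis
          by (intro exI[of _ "\<lambda>t. if t = [] then 1 else 0"]) (simp add: count_end_def)
      next
        case ne: False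
        then show ?thesis using Cons.IH adj False by blast
      qed
      then obtain R where R: "\<And>c t. ?K bs (c # t) = \<beta> c * R t" by blast
      have "?K (b # bs) (0 # t) = 0" for t
      proof -
        have "?op j = count_b" using False by (simp add: count_op_def fun_eq_iff)
        then show ?thesis using False by (simp add: b count_marginal_b count_b_power R \<beta>)
      qed
      then show ?thesis using False b by simp
    qed
  qed
  from this[of bs] bs \<beta> have "?K bs [0] = 0"
    by (cases "fst (hd bs)") auto
  moreover have "centred ?F [] bs = foldr ?op [] (?K bs) [0]"
    by (rule centred_foldr) (simp_all add: count_op_diff count_moment_def fun_eq_iff)
  ultimately show "centred ?F [] bs = 0" by simp
qed

text \<open>
  \<open>free_mom \<kappa> \<beta> g q\<close> is the moment \<open>\<tau>(b\<^sup>g (a b)\<^sup>q)\<close> for free \<open>a, b\<close>, where \<open>a\<close> has free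
  cumulants \<open>\<kappa>\<close> and \<open>b\<close> has moments \<open>\<beta>\<close>; in \<open>block_mom \<kappa> \<beta> g l q\<close> the first \<open>a\<close> is replaced
  by the fusion of \<open>l\<close> elements of its block of a noncrossing partition.
\<close>

function free_mom :: "(nat \<Rightarrow> complex) \<Rightarrow> (nat \<Rightarrow> complex) \<Rightarrow> nat \<Rightarrow> nat \<Rightarrow> complex"
  and block_mom :: "(nat \<Rightarrow> complex) \<Rightarrow> (nat \<Rightarrow> complex) \<Rightarrow> nat \<Rightarrow> nat \<Rightarrow> nat \<Rightarrow> complex" where
  "free_mom \<kappa> \<beta> g 0 = \<beta> g"
| "free_mom \<kappa> \<beta> g (Suc q) = block_mom \<kappa> \<beta> g 1 q"
| "block_mom \<kappa> \<beta> g l q = \<kappa> l * free_mom \<kappa> \<beta> (Suc g) q +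
     (\<Sum>j<q. block_mom \<kappa> \<beta> 0 (Suc l) j * free_mom \<kappa> \<beta> (Suc g) (q - 1 - j))"
  by pat_completeness auto
termination
  by (relation "Wellfounded.measure (case_sum (\<lambda>(_, _, _, q). 2 * q) (\<lambda>(_, _, _, _, q). 2 * q + 1))") auto

declare block_mom.simps [simp del]

text \<open>A block with \<open>l\<close> elements already fused and at most \<open>q\<close> more
  to come uses no cumulant beyond order \<open>l + q\<close>.\<close>

lemma free_mom_cong:
  assumes "\<And>s. 1 \<le> s \<Longrightarrow> s \<le> N \<Longrightarrow> \<kappa> s = \<kappa>' s"
  shows "(q \<le> N \<longrightarrow> (\<forall>g. free_mom \<kappa> \<beta> g q = free_mom \<kappa>' \<beta> g q)) \<and>
    (\<forall>g l. 1 \<le> l \<and> l + q \<le> N \<longrightarrow> block_mom \<kappa> \<beta> g l q = block_mom \<kappa>' \<beta> g l q)"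
proof (induction q rule: less_induct)
  case (less q)
  have 1: "free_mom \<kappa> \<beta> g q = free_mom \<kappa>' \<beta> g q" if "q \<le> N" for g
    using less that by (cases q) auto
  have "block_mom \<kappa> \<beta> g l q = block_mom \<kappa>' \<beta> g l q" if "1 \<le> l" "l + q \<le> N" for g l
    unfolding block_mom.simps[of _ _ g l q] using less that 1 assms
    by (intro arg_cong2[of _ _ _ _ "(+)"] arg_cong2[of _ _ _ _ "(*)"] sum.cong) auto
  with 1 show ?case by blast
qed

primrec count_ab ::
  "nat \<Rightarrow> (nat \<Rightarrow> complex) \<Rightarrow> (nat \<Rightarrow> complex) \<Rightarrow> nat \<Rightarrow> nat list \<Rightarrow> complex" where
  "count_ab N \<kappa> \<beta> 0 = count_end \<beta>"
| "count_ab N \<kappa> \<beta> (Suc q) = count_a N \<kappa> \<beta> (count_b (count_ab N \<kappa> \<beta> q))"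

text \<open>All counters of \<open>t\<close> must be closed before \<open>g\<close> can change. If
  this is completed in round \<open>j + 1\<close>, one counter of \<open>t\<close> is left after
  \<open>j\<close> rounds, and its weight is the one that \<open>count_end\<close> supplies in
  \<open>count_ab N \<kappa> \<beta> j t\<close>. The a of that round closes it and the b turns
  \<open>g\<close> into \<open>Suc g\<close>.\<close>

lemma count_first_passage:
  assumes "t \<noteq> []"
  shows "count_ab N \<kappa> \<beta> q (t @ [g]) =
    (\<Sum>j<q. count_ab N \<kappa> \<beta> j t *
      count_ab N \<kappa> \<beta> (q - 1 - j) [Suc g])"
  using assms
proof (induction q arbitrary: t)
  case 0
  then show ?case by (simp add: count_end_def)
next
  case (Suc q)
  let ?G = "count_ab N \<kappa> \<beta>"
  have k: "count_b (?G q) (t @ [g]) = (\<Sum>j<q. count_b (?G j) t * ?G (q - 1 - j) [Suc g])"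
    if "t \<noteq> []" for t
    using Suc.IH[of "Suc (hd t) # tl t"] that by (simp add: count_b_def)
  have G: "?G (Suc j) t = count_a N \<kappa> \<beta> (count_b (?G j)) t" for j t by simp
  have push: "(\<Sum>s<N. \<kappa> (Suc s) * count_b (?G q) (replicate s 0 @ t @ [g])) =
    (\<Sum>j<q. (\<Sum>s<N. \<kappa> (Suc s) * count_b (?G j) (replicate s 0 @ t)) * ?G (q - 1 - j) [Suc g])"
    using Suc.prems k[of "replicate _ 0 @ t"]
    by (simp add: sum_distrib_left sum_distrib_right sum.swap[of _ "{..<N}"] mult.assoc)
  have pop: "(if 2 \<le> length (t @ [g]) then \<beta> (hd (t @ [g])) * count_b (?G q) (tl (t @ [g])) else 0)
    = ?G 0 t * ?G q [Suc g] + (\<Sum>j<q. (if 2 \<le> length t then \<beta> (hd t) * count_b (?G j) (tl t) else 0)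
        * ?G (q - 1 - j) [Suc g])"
  proof (cases "tl t = []")
    case True
    then obtain c where "t = [c]" using Suc.prems by (cases t) auto
    then show ?thesis by (simp add: count_end_def count_b_def)
  next
    case False
    then have "2 \<le> length t" "length t \<noteq> 1" by (cases t; auto simp: Suc_le_eq)+
    then show ?thesis
      using Suc.prems False k[of "tl t"] by (simp add: count_end_def sum_distrib_left mult.assoc)
  qed
  have "?G (Suc q) (t @ [g]) = ?G 0 t * ?G q [Suc g] + (\<Sum>j<q. ?G (Suc j) t * ?G (q - 1 - j) [Suc g])"
    unfolding G count_a_def[of _ _ _ _ "t @ [g]"] count_a_def[of _ _ _ _ t] push pop
    by (simp add: distrib_right sum.distrib)
  also have "\<dots> = (\<Sum>j<Suc q. ?G j t * ?G (Suc q - 1 - j) [Suc g])"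
    unfolding sum.lessThan_Suc_shift by (simp add: Suc_diff_Suc cong: sum.cong)
  finally show ?case .
qed

text \<open>In the second claim the first a belongs to a block with \<open>l\<close> elements fused
  and \<open>s\<close> still to come. For \<open>s = 0\<close> the block ends. Otherwise its last
  element is fused as well: the gap before that element becomes the outer region of a shorter word,
  and what follows it is a word of its own with b^(g+1) in front.\<close>

lemma count_free_mom:
  assumes \<kappa>: "\<And>s. s > N \<Longrightarrow> \<kappa> s = 0"
  shows "(\<forall>g. count_ab N \<kappa> \<beta> q [g] = free_mom \<kappa> \<beta> g q) \<and>
    (\<forall>g l. 1 \<le> l \<longrightarrow> (\<Sum>s<N. \<kappa> (s + l) *
       count_b (count_ab N \<kappa> \<beta> q) (replicate s 0 @ [g])) =
       block_mom \<kappa> \<beta> g l q)"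
proof (induction q rule: less_induct)
  case (less q)
  let ?G = "count_ab N \<kappa> \<beta>"
  have 1: "?G q [g] = free_mom \<kappa> \<beta> g q" for g
  proof (cases q)
    case 0
    then show ?thesis by (simp add: count_end_def)
  next
    case (Suc q')
    have "?G q [g] = (\<Sum>s<N. \<kappa> (s + 1) * count_b (?G q') (replicate s 0 @ [g]))"
      by (simp add: Suc count_a_def)
    also have "\<dots> = block_mom \<kappa> \<beta> g 1 q'"
      using less.IH[of q'] Suc by blast
    finally show ?thesis using Suc by simp
  qed
  have 2: "(\<Sum>s<N. \<kappa> (s + l) * count_b (?G q) (replicate s 0 @ [g])) = block_mom \<kappa> \<beta> g l q"
    if "1 \<le> l" for g l
  proof -
    let ?f = "\<lambda>s. \<kappa> (s + l) * count_b (?G q) (replicate s 0 @ [g])"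
    \<comment> \<open>The lowest of the \<open>s + 1\<close> gap counters takes over the role of the
      outer region.\<close>
    have rep: "1 # replicate s 0 = Suc (hd (replicate s 0 @ [0])) # tl (replicate s 0 @ [0])" for s
      by (cases s) (simp_all add: replicate_append_same)
    have step: "?f (Suc s) = (\<Sum>j<q. \<kappa> (s + Suc l) * count_b (?G j) (replicate s 0 @ [0]) *
        free_mom \<kappa> \<beta> (Suc g) (q - 1 - j))" for s
    proof -
      have "count_b (?G q) (replicate (Suc s) 0 @ [g]) = ?G q ((1 # replicate s 0) @ [g])"
        by (simp add: count_b_def)
      also have "\<dots> = (\<Sum>j<q. ?G j (1 # replicate s 0) * ?G (q - 1 - j) [Suc g])"
        by (rule count_first_passage) simp
      also have "\<dots> = (\<Sum>j<q. count_b (?G j) (replicate s 0 @ [0]) * free_mom \<kappa> \<beta> (Suc g) (q - 1 - j))"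
      proof (intro sum.cong refl arg_cong2[of _ _ _ _ "(*)"])
        show "?G j (1 # replicate s 0) = count_b (?G j) (replicate s 0 @ [0])" for j
          unfolding count_b_def rep ..
        show "?G (q - 1 - j) [Suc g] = free_mom \<kappa> \<beta> (Suc g) (q - 1 - j)" if "j \<in> {..<q}" for j
          using less.IH[of "q - 1 - j"] that by auto
      qed
      finally show ?thesis by (simp add: sum_distrib_left mult.assoc)
    qed
    \<comment> \<open>The added term carries \<open>\<kappa> (N + l)\<close>, which is 0 since
      \<open>l \<ge> 1\<close>; it makes room for the shift of \<open>s\<close>.\<close>
    have "(\<Sum>s<N. ?f s) = (\<Sum>s<Suc N. ?f s)"
      using \<kappa>[of "N + l"] that by simp
    also have "\<dots> = ?f 0 + (\<Sum>s<N. ?f (Suc s))"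
      by (rule sum.lessThan_Suc_shift)
    also have "(\<Sum>s<N. ?f (Suc s)) = (\<Sum>j<q. block_mom \<kappa> \<beta> 0 (Suc l) j * free_mom \<kappa> \<beta> (Suc g) (q - 1 - j))"
    proof -
      have "(\<Sum>s<N. \<kappa> (s + Suc l) * count_b (?G j) (replicate s 0 @ [0])) = block_mom \<kappa> \<beta> 0 (Suc l) j"
        if "j < q" for j
        using conjunct2[OF less.IH[OF that], rule_format, of "Suc l" 0] by simp
      then show ?thesis
        unfolding step by (subst sum.swap) (simp flip: sum_distrib_right)
    qed
    also have "?f 0 = \<kappa> l * free_mom \<kappa> \<beta> (Suc g) q"
      using 1 by (simp add: count_b_def)
    finally show ?thesis by (simp only: block_mom.simps[of \<kappa> \<beta> g l q])
  qed
  show ?case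
  proof (rule conjI; intro allI impI)
    fix g
    show "?G q [g] = free_mom \<kappa> \<beta> g q" by (rule 1)
  next
    fix g l :: nat
    assume "1 \<le> l"
    then show "(\<Sum>s<N. \<kappa> (s + l) * count_b (?G q) (replicate s 0 @ [g])) = block_mom \<kappa> \<beta> g l q"
      by (rule 2)
  qed
qed

theorem free_product_moment:
  fixes a b :: "'a::ring_1"
  assumes T: "tracial_ncps T" and free: "free_elements T (\<lambda>i. if i then a else b) (UNIV :: bool set)"
    and a: "\<And>e. e \<le> N \<Longrightarrow> st T (a ^ e) = height_moment N \<kappa> e 0"
    and b: "\<And>e. e \<le> N \<Longrightarrow> st T (b ^ e) = \<beta> e"
    and p: "2 * p \<le> N"
  shows "st T ((a * b) ^ p) = free_mom \<kappa> \<beta> 0 p"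
proof -
  \<comment> \<open>Cutting the cumulants at \<open>N\<close> changes no moment of order up to
    \<open>N\<close> and supplies the vanishing that \<open>count_free_mom\<close> requires.\<close>
  define \<kappa>' where "\<kappa>' s = (if s \<le> N then \<kappa> s else 0)" for s
  let ?x = "\<lambda>i. if i then a else b"
  let ?w = "concat (replicate p [True, False])"
  have \<beta>0: "\<beta> 0 = 1" using b[of 0] by (simp add: st_one[OF T])
  have len: "length ?w = 2 * p" by (simp add: length_concat map_replicate sum_list_replicate)
  have "prod_list (map ?x (concat (replicate q [True, False]))) = (a * b) ^ q" for q
    by (induction q) (simp_all add: mult.assoc)
  then have "st T ((a * b) ^ p) = joint_moment T ?x ?w"
    by (simp add: joint_moment_def)
  also have "\<dots> = count_moment N \<kappa>' \<beta> ?w"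
  proof (rule free_functional_unique[OF free_elements_functional[OF T free] count_free[where \<beta> = \<beta>]])
    show "joint_moment T ?x [] = count_moment N \<kappa>' \<beta> []"
      by (simp add: joint_moment_def count_moment_def st_one[OF T] count_end_def \<beta>0)
    show "joint_moment T ?x (replicate e j) = count_moment N \<kappa>' \<beta> (replicate e j)"
      if "e \<le> N" for j e
    proof (cases j)
      case True
      have "height_moment N \<kappa> e 0 = height_moment N \<kappa>' e 0"
        by (rule height_moment_cong) (simp add: \<kappa>'_def)
      then show ?thesis using a[OF that] True
        by (simp add: count_marginal_a \<beta>0 joint_moment_def prod_list_replicate)
    next
      case False
      then show ?thesis using b[OF that]
        by (simp add: count_marginal_b joint_moment_def prod_list_replicate)
    qed
  qed (use \<beta>0 p len in auto)
  also have "\<dots> = count_ab N \<kappa>' \<beta> p [0]"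
  proof -
    have "foldr (count_op N \<kappa>' \<beta>) ?w (count_end \<beta>) = count_ab N \<kappa>' \<beta> p"
      by (induction p) (simp_all add: count_op_def)
    then show ?thesis by (simp add: count_moment_def)
  qed
  also have "\<dots> = free_mom \<kappa>' \<beta> 0 p"
    using count_free_mom[of N \<kappa>' \<beta> p] by (simp add: \<kappa>'_def)
  also have "\<dots> = free_mom \<kappa> \<beta> 0 p"
    using free_mom_cong[of N \<kappa>' \<kappa> p \<beta>] p by (simp add: \<kappa>'_def)
  finally show ?thesis .
qed

section \<open>Moments of the free Poisson law\<close>

lemma height_moment_eq_0: "n < h \<Longrightarrow> height_moment N \<kappa> n h = 0"
  by (induction n arbitrary: h) auto

text \<open>The path first reaches 0 at step \<open>j + 1\<close>; until then it is a path of
  \<open>j\<close> steps from \<open>h\<close> to 0, lifted by one.\<close>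

lemma height_first_passage:
  "height_moment N \<kappa> q (Suc h) = (\<Sum>j<q. height_moment N \<kappa> j h * height_moment N \<kappa> (q - 1 - j) 0)"
proof (induction q arbitrary: h)
  case 0
  then show ?case by simp
next
  case (Suc q)
  let ?H = "height_moment N \<kappa>"
  have pop: "?H q h = ?H 0 h * ?H q 0 +
      (\<Sum>j<q. (if h = 0 then 0 else ?H j (h - 1)) * ?H (q - 1 - j) 0)"
    using Suc.IH[of "h - 1"] by (cases h) auto
  have push: "(\<Sum>s<N. \<kappa> (Suc s) * ?H q (Suc h + s)) =
      (\<Sum>j<q. (\<Sum>s<N. \<kappa> (Suc s) * ?H j (h + s)) * ?H (q - 1 - j) 0)"
    using Suc.IH[of "h + _"]
    by (simp add: sum_distrib_left sum_distrib_right sum.swap[of _ "{..<N}"] mult.assoc)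
  have "?H (Suc q) (Suc h) = ?H 0 h * ?H q 0 + (\<Sum>j<q. ?H (Suc j) h * ?H (q - 1 - j) 0)"
    using push pop by (simp add: distrib_right sum.distrib)
  also have "\<dots> = (\<Sum>j<Suc q. ?H j h * ?H (Suc q - 1 - j) 0)"
    unfolding sum.lessThan_Suc_shift by (simp add: Suc_diff_Suc cong: sum.cong)
  finally show ?case .
qed

text \<open>With constant weights, lowering the first rise by one unit does not change its weight.
  Up to its first passage, a path beginning with a rise thus becomes a path beginning with an
  arbitrary step up or level step from height 0.\<close>

lemma height_moment_const:
  assumes "q < N"
  shows "height_moment N (\<lambda>_. t) (Suc q) 0 = t * height_moment N (\<lambda>_. t) q 0 +
    (\<Sum>j<q. height_moment N (\<lambda>_. t) (Suc j) 0 * height_moment N (\<lambda>_. t) (q - 1 - j) 0)"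
proof -
  let ?H = "height_moment N (\<lambda>_. t)"
  obtain N' where N: "N = Suc N'" using assms by (cases N) auto
  \<comment> \<open>The step up by \<open>N'\<close> is dropped: from there 0 cannot be reached in
    \<open>j\<close> steps.\<close>
  have H: "?H (Suc j) 0 = (\<Sum>s<N'. t * ?H j s)" if "j < N'" for j
    using that height_moment_eq_0[of j N' N "\<lambda>_. t"] by (simp add: N)
  have "?H (Suc q) 0 = t * ?H q 0 + (\<Sum>s<N'. t * ?H q (Suc s))"
    by (simp add: N sum.lessThan_Suc_shift del: sum.lessThan_Suc)
  also have "(\<Sum>s<N'. t * ?H q (Suc s)) = (\<Sum>j<q. (\<Sum>s<N'. t * ?H j s) * ?H (q - 1 - j) 0)"
    by (simp add: height_first_passage sum_distrib_left sum_distrib_right sum.swap[of _ "{..<N'}"]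
        mult.assoc)
  also have "\<dots> = (\<Sum>j<q. ?H (Suc j) 0 * ?H (q - 1 - j) 0)"
    using H assms N by (intro sum.cong refl) (simp del: height_moment.simps)
  finally show ?thesis .
qed

text \<open>Since U_h(cos x) sin x = sin((h + 1) x), this integrates the Chebyshev polynomial of the
  second kind U_h times a power of c + 2 r cos x against a semicircle law. It is the entry (h, 0) of
  the \<open>p\<close>-th power of the Jacobi matrix with diagonal \<open>c\<close> and off-diagonal
  \<open>r\<close>, a weighted count of Motzkin paths from height \<open>h\<close> to 0.\<close>

definition chebyshev_moment :: "real \<Rightarrow> real \<Rightarrow> nat \<Rightarrow> nat \<Rightarrow> real" where
  "chebyshev_moment c r h p =
     2 / pi * integral {0..pi} (\<lambda>x. (c + 2 * r * cos x) ^ p * sin (real (Suc h) * x) * sin x)"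

lemma chebyshev_moment_0: "chebyshev_moment c r h 0 = (if h = 0 then 1 else 0)"
proof (cases "h = 0")
  case True
  have "((\<lambda>x. sin x * sin x) has_integral (pi / 2 - sin (2 * pi) / 4) - (0 / 2 - sin (2 * 0) / 4)) {0..pi}"
  proof (rule fundamental_theorem_of_calculus)
    fix x :: real
    have "((\<lambda>x. x / 2 - sin (2 * x) / 4) has_real_derivative 1 / 2 - cos (2 * x) / 2) (at x within {0..pi})"
      by (auto intro!: derivative_eq_intros)
    moreover have "1 / 2 - cos (2 * x) / 2 = sin x * sin x"
      unfolding cos_double_sin by (simp add: power2_eq_square diff_divide_distrib)
    ultimately show "((\<lambda>x. x / 2 - sin (2 * x) / 4) has_vector_derivative sin x * sin x) (at x within {0..pi})"
      by (simp add: has_real_derivative_iff_has_vector_derivative)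
  qed simp
  then show ?thesis
    using True by (simp add: chebyshev_moment_def integral_unique)
next
  case False
  let ?F = "\<lambda>x. sin (real h * x) / (2 * real h) - sin (real (h + 2) * x) / (2 * real (h + 2))"
  have "((\<lambda>x. sin (real (Suc h) * x) * sin x) has_integral ?F pi - ?F 0) {0..pi}"
  proof (rule fundamental_theorem_of_calculus)
    fix x :: real
    have D: "((\<lambda>x. sin (a * x) / (2 * a)) has_real_derivative cos (a * x) / 2) (at x within {0..pi})"
      if "a \<noteq> 0" for a :: real
      using that by (auto intro!: derivative_eq_intros)
    have "(?F has_real_derivative cos (real h * x) / 2 - cos (real (h + 2) * x) / 2) (at x within {0..pi})"
      using False by (intro DERIV_diff D) auto
    then have "(?F has_real_derivative (cos (real h * x) - cos (real (h + 2) * x)) / 2) (at x within {0..pi})"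
      by (simp only: diff_divide_distrib)
    moreover have "(cos (real h * x) - cos (real (h + 2) * x)) / 2 = sin (real (Suc h) * x) * sin x"
      using cos_add[of "real (Suc h) * x" x] cos_diff[of "real (Suc h) * x" x]
      by (simp add: algebra_simps)
    ultimately show "(?F has_vector_derivative sin (real (Suc h) * x) * sin x) (at x within {0..pi})"
      by (simp add: has_real_derivative_iff_has_vector_derivative)
  qed simp
  moreover have "?F pi - ?F 0 = 0"
    using sin_npi[of h] sin_npi[of "h + 2"] by (simp del: sin_npi)
  ultimately show ?thesis
    using False by (simp add: chebyshev_moment_def integral_unique)
qed

text \<open>Three-term recurrence, from 2 cos x sin((h + 1) x) = sin((h + 2) x) + sin(h x); the last
  term vanishes for \<open>h = 0\<close>.\<close>

lemma chebyshev_moment_Suc: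
  "chebyshev_moment c r h (Suc p) = c * chebyshev_moment c r h p +
     r * (chebyshev_moment c r (Suc h) p + (if h = 0 then 0 else chebyshev_moment c r (h - 1) p))"
proof -
  let ?f = "\<lambda>h x. (c + 2 * r * cos x) ^ p * sin (real h * x) * sin x"
  have int: "?f h integrable_on {0..pi}" for h
    by (intro integrable_continuous_interval continuous_intros)
  have trig: "2 * cos x * sin (real (Suc h) * x) = sin (real (Suc (Suc h)) * x) + sin (real h * x)" for x
    using sin_add[of "real (Suc h) * x" x] sin_diff[of "real (Suc h) * x" x]
    by (simp add: algebra_simps)
  have "(c + 2 * r * cos x) ^ Suc p * sin (real (Suc h) * x) * sin x =
      c * ?f (Suc h) x + r * (?f (Suc (Suc h)) x + ?f h x)" for x
  proof -
    have "(c + 2 * r * cos x) ^ Suc p * sin (real (Suc h) * x) * sin x =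
      c * ?f (Suc h) x + r * ((c + 2 * r * cos x) ^ p * (2 * cos x * sin (real (Suc h) * x)) * sin x)"
      by (simp add: algebra_simps)
    then show ?thesis unfolding trig by (simp add: algebra_simps)
  qed
  then have "integral {0..pi} (\<lambda>x. (c + 2 * r * cos x) ^ Suc p * sin (real (Suc h) * x) * sin x) =
      integral {0..pi} (\<lambda>x. c * ?f (Suc h) x + r * (?f (Suc (Suc h)) x + ?f h x))"
    by simp
  also have "\<dots> = c * integral {0..pi} (?f (Suc h)) +
      r * (integral {0..pi} (?f (Suc (Suc h))) + integral {0..pi} (?f h))"
    by (intro integral_unique has_integral_add has_integral_mult_right integrable_integral int)
  finally have "chebyshev_moment c r h (Suc p) = c * chebyshev_moment c r h p +
      r * (chebyshev_moment c r (Suc h) p + 2 / pi * integral {0..pi} (?f h))"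
    by (simp add: chebyshev_moment_def algebra_simps)
  moreover have "2 / pi * integral {0..pi} (?f h) = (if h = 0 then 0 else chebyshev_moment c r (h - 1) p)"
    by (simp add: chebyshev_moment_def)
  ultimately show ?thesis by simp
qed

lemma chebyshev_first_passage:
  "chebyshev_moment c r (Suc h) p =
    r * (\<Sum>j<p. chebyshev_moment c r h j * chebyshev_moment c r 0 (p - 1 - j))"
proof (induction p arbitrary: h)
  case 0
  then show ?case by (simp add: chebyshev_moment_0)
next
  case (Suc p)
  let ?I = "chebyshev_moment c r"
  have pop: "?I h p = ?I h 0 * ?I 0 p + r * (\<Sum>j<p. (if h = 0 then 0 else ?I (h - 1) j) * ?I 0 (p - 1 - j))"
    using Suc.IH[of "h - 1"] by (cases h) (simp_all add: chebyshev_moment_0)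
  have "?I (Suc h) (Suc p) = c * ?I (Suc h) p + r * (?I (Suc (Suc h)) p + ?I h p)"
    by (simp add: chebyshev_moment_Suc)
  also have "\<dots> = r * (?I h 0 * ?I 0 p + (\<Sum>j<p. ?I h (Suc j) * ?I 0 (p - 1 - j)))"
    unfolding chebyshev_moment_Suc[of c r h] Suc.IH pop
    by (simp add: algebra_simps sum.distrib sum_distrib_left)
  also have "?I h 0 * ?I 0 p + (\<Sum>j<p. ?I h (Suc j) * ?I 0 (p - 1 - j)) =
      (\<Sum>j<Suc p. ?I h j * ?I 0 (Suc p - 1 - j))"
    unfolding sum.lessThan_Suc_shift by (simp add: Suc_diff_Suc cong: sum.cong)
  finally show ?case .
qed

text \<open>After a shift of the index by one, the recursion for constant weights becomes the
  Motzkin recursion with level weight \<open>1 + t\<close> and weight \<open>t\<close> for a rise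
  and a fall together. Only \<open>r\<^sup>2\<close> enters, so either root of \<open>t\<close> may
  be taken.\<close>

lemma height_moment_chebyshev:
  assumes "r\<^sup>2 = t" "Suc p \<le> N"
  shows "height_moment N (\<lambda>_. complex_of_real t) (Suc p) 0 =
    complex_of_real (t * chebyshev_moment (1 + t) r 0 p)"
  using assms(2)
proof (induction p rule: less_induct)
  case (less p)
  let ?H = "height_moment N (\<lambda>_. complex_of_real t)"
  let ?q = "chebyshev_moment (1 + t) r 0"
  have IH: "?H (Suc j) 0 = complex_of_real (t * ?q j)" if "j < p" for j
    using less that by simp
  have rec: "?H (Suc p) 0 = t * ?H p 0 + (\<Sum>j<p. ?H (Suc j) 0 * ?H (p - 1 - j) 0)"
    using less.prems by (intro height_moment_const) simp
  show ?case
  proof (cases p)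
    case 0
    then show ?thesis using rec by (simp add: chebyshev_moment_0)
  next
    case (Suc p')
    have "(\<Sum>j<p'. ?H (Suc j) 0 * ?H (p - 1 - j) 0) =
        (\<Sum>j<p'. complex_of_real (t * ?q j) * complex_of_real (t * ?q (p' - 1 - j)))"
    proof (intro sum.cong refl)
      fix j assume "j \<in> {..<p'}"
      then have "p - 1 - j = Suc (p' - 1 - j)" "p' - 1 - j < p" "j < p" using Suc by auto
      then show "?H (Suc j) 0 * ?H (p - 1 - j) 0 =
          complex_of_real (t * ?q j) * complex_of_real (t * ?q (p' - 1 - j))"
        using IH by (simp only:)
    qed
    \<comment> \<open>The last summand has the moment of order 0 as second factor; it provides the 1
      in the level weight \<open>1 + t\<close>.\<close>
    moreover have "(\<Sum>j<p. ?H (Suc j) 0 * ?H (p - 1 - j) 0) =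
        (\<Sum>j<p'. ?H (Suc j) 0 * ?H (p - 1 - j) 0) + ?H (Suc p') 0"
      using Suc by simp
    moreover have "?q p = (1 + t) * ?q p' + t * (\<Sum>j<p'. ?q j * ?q (p' - 1 - j))"
      using chebyshev_moment_Suc[of "1 + t" r 0 p'] chebyshev_first_passage[of "1 + t" r 0 p'] assms(1)
      by (simp add: Suc power2_eq_square)
    ultimately have "?H (Suc p) 0 = complex_of_real (t * (t * ?q p') +
        ((\<Sum>j<p'. (t * ?q j) * (t * ?q (p' - 1 - j))) + t * ?q p'))"
      and "?q p = (1 + t) * ?q p' + t * (\<Sum>j<p'. ?q j * ?q (p' - 1 - j))"
      using rec IH[of p'] Suc by simp_all
    then show ?thesis
      by (simp add: algebra_simps sum_distrib_left flip: of_real_sum)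
  qed
qed

section \<open>Integration against the free Poisson measure\<close>

lemma free_poisson_density_measurable [measurable]: "free_poisson_density t \<in> borel_measurable borel"
  unfolding free_poisson_density_def by measurable

lemma free_poisson_density_nonneg:
  assumes "t > 0"
  shows "free_poisson_density t x \<ge> 0"
proof (cases "x \<in> {(sqrt t - 1)\<^sup>2..(sqrt t + 1)\<^sup>2}")
  case True
  then have "x \<ge> 0" by (auto intro: order_trans[OF zero_le_power2])
  have "\<bar>x - 1 - t\<bar> \<le> 2 * sqrt t"
    using True assms by (auto simp: power2_eq_square algebra_simps abs_if)
  then have "(x - 1 - t)\<^sup>2 \<le> (2 * sqrt t)\<^sup>2"
    by (metis abs_le_square_iff abs_of_nonneg assms less_eq_real_def mult_nonneg_nonneg real_sqrt_ge_0_iff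
        zero_le_numeral)
  then have "(x - 1 - t)\<^sup>2 \<le> 4 * t" using assms by (simp add: power_mult_distrib)
  then show ?thesis using \<open>x \<ge> 0\<close> by (simp add: free_poisson_density_def)
qed (simp add: free_poisson_density_def)

text \<open>\<open>measure_of\<close> returns the given set function only if it is countably
  additive. This holds because it is a multiple of the point mass at 0 plus a measure with a
  density.\<close>

lemma emeasure_free_poisson:
  assumes "A \<in> sets borel"
  shows "emeasure (free_poisson t) A = ennreal (max (1 - t) 0) * indicator A 0 +
    (\<integral>\<^sup>+ x \<in> A. ennreal (free_poisson_density t x) \<partial>lborel)" (is "_ = ?\<mu> A")
proof -
  have eq: "?\<mu> B = ennreal (max (1 - t) 0) * emeasure (return borel 0) B +
      emeasure (density lborel (\<lambda>x. ennreal (free_poisson_density t x))) B" if "B \<in> sets borel" for B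
    using that by (simp add: emeasure_density)
  have "countably_additive (sets borel) ?\<mu>"
  proof (rule countably_additiveI)
    fix B :: "nat \<Rightarrow> real set"
    assume B: "range B \<subseteq> sets borel" "disjoint_family B" "(\<Union>i. B i) \<in> sets borel"
    then have Bi: "B i \<in> sets borel" for i by auto
    show "(\<Sum>i. ?\<mu> (B i)) = ?\<mu> (\<Union>i. B i)"
      unfolding eq[OF Bi] eq[OF B(3)]
      by (subst suminf_add[symmetric], simp, simp, subst ennreal_suminf_cmult)
        (use B in \<open>simp add: suminf_emeasure del: emeasure_return\<close>)
  qed
  moreover have "positive (sets borel) ?\<mu>" by (simp add: positive_def)
  moreover have "sigma_algebra UNIV (sets (borel :: real measure))"
    using sets.sigma_algebra_axioms[of "borel :: real measure"] by simp
  ultimately show ?thesis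
    unfolding free_poisson_def
    using assms by (intro emeasure_measure_of_sigma)
qed

lemma sets_free_poisson [simp, measurable_cong]: "sets (free_poisson t) = sets borel"
  unfolding free_poisson_def using sets.sigma_sets_eq[of "borel :: real measure"] by (simp add: sets_measure_of_conv)

text \<open>For \<open>p \<ge> 1\<close> the integrand vanishes at 0, so both measures may be
  restricted to the complement of 0, where they coincide.\<close>

lemma free_poisson_integral_density:
  assumes "p \<ge> 1" "t > 0"
  shows "(LINT x|free_poisson t. x ^ p) = (LINT x|lborel. free_poisson_density t x * x ^ p)"
proof -
  let ?K = "density lborel (\<lambda>x. ennreal (free_poisson_density t x))"
  let ?A = "- {0} :: real set"
  have pw: "x ^ p = indicator ?A x *\<^sub>R x ^ p" for x :: real
    using assms by (cases "x = 0") auto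
  have eq: "restrict_space (free_poisson t) ?A = restrict_space ?K ?A"
  proof (rule measure_eqI)
    show "sets (restrict_space (free_poisson t) ?A) = sets (restrict_space ?K ?A)"
      by (simp add: sets_restrict_space)
    fix B assume "B \<in> sets (restrict_space (free_poisson t) ?A)"
    then have B: "B \<subseteq> ?A" "B \<in> sets borel" by (auto simp: sets_restrict_space)
    then have "0 \<notin> B" by auto
    with B show "emeasure (restrict_space (free_poisson t) ?A) B = emeasure (restrict_space ?K ?A) B"
      by (simp add: emeasure_restrict_space emeasure_free_poisson emeasure_density)
  qed
  have "(LINT x|free_poisson t. x ^ p) = (LINT x|free_poisson t. indicator ?A x *\<^sub>R x ^ p)"
    by (subst pw) simp
  also have "\<dots> = (LINT x|restrict_space (free_poisson t) ?A. x ^ p)"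
    by (subst integral_restrict_space) auto
  also have "\<dots> = (LINT x|?K. indicator ?A x *\<^sub>R x ^ p)"
    unfolding eq by (subst integral_restrict_space) auto
  also have "\<dots> = (LINT x|?K. x ^ p)"
    by (intro Bochner_Integration.integral_cong refl pw[symmetric])
  also have "\<dots> = (LINT x|lborel. free_poisson_density t x * x ^ p)"
    by (subst integral_density) (auto simp: free_poisson_density_nonneg assms)
  finally show ?thesis .
qed

text \<open>The substitution 1 + t - 2 sqrt(t) cos x runs through the support increasingly for x
  from 0 to pi, whence the root \<open>- sqrt t\<close>.\<close>

lemma free_poisson_moment:
  assumes "t > 0"
  shows "(LINT x|free_poisson t. x ^ Suc p) = t * chebyshev_moment (1 + t) (- sqrt t) 0 p"
proof -
  let ?g = "\<lambda>x. 1 + t - 2 * sqrt t * cos x"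
  let ?f = "\<lambda>x. x ^ p * (sqrt (4 * t - (x - 1 - t)\<^sup>2) / (2 * pi))"
  have g0: "?g 0 = (sqrt t - 1)\<^sup>2" and gpi: "?g pi = (sqrt t + 1)\<^sup>2"
    using assms by (simp_all add: power2_eq_square algebra_simps)
  \<comment> \<open>Cancelling \<open>x\<close> against the denominator is correct at
    \<open>x = 0\<close> too: the origin lies in the support only for \<open>t = 1\<close>, and
    there the square root vanishes at 0.\<close>
  have 1: "free_poisson_density t x * x ^ Suc p = ?f x * indicator {?g 0..?g pi} x" for x
  proof (cases "x = 0")
    case True
    have "4 * t - (1 + t)\<^sup>2 = - (1 - t)\<^sup>2" by (simp add: power2_eq_square algebra_simps)
    moreover have "t = 1" if "(sqrt t - 1)\<^sup>2 \<le> 0" using that by simp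
    ultimately show ?thesis
      unfolding g0 gpi using True by (auto simp: free_poisson_density_def indicator_def power2_eq_square)
  next
    case False
    then show ?thesis unfolding g0 gpi by (simp add: free_poisson_density_def)
  qed
  have "(LINT x|lborel. free_poisson_density t x * x ^ Suc p) =
      (LBINT x. ?f x * indicator {?g 0..?g pi} x)"
    by (simp only: 1)
  also have "\<dots> = (LBINT x. ?f (?g x) * (2 * sqrt t * sin x) * indicator {0..pi} x)"
  proof (rule integral_substitution)
    show "set_integrable lborel {?g 0..?g pi} ?f"
      by (intro borel_integrable_atLeastAtMost' continuous_intros) simp
    show "(?g has_real_derivative 2 * sqrt t * sin x) (at x)" for x
      by (auto intro!: derivative_eq_intros)
    show "continuous_on {0..pi} (\<lambda>x. 2 * sqrt t * sin x)"
      by (intro continuous_intros)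
    show "0 \<le> 2 * sqrt t * sin x" if "x \<in> {0..pi}" for x
      using that assms by (simp add: sin_ge_zero)
  qed simp
  also have "\<dots> = (LINT x:{0..pi}|lborel. t * (2 / pi) * ((1 + t + 2 * (- sqrt t) * cos x) ^ p * sin (real (Suc 0) * x) * sin x))"
    unfolding set_lebesgue_integral_def
  proof (intro Bochner_Integration.integral_cong refl)
    fix x :: real
    have "sqrt (4 * t - (?g x - 1 - t)\<^sup>2) = 2 * sqrt t * \<bar>sin x\<bar>"
    proof -
      have "4 * t - (?g x - 1 - t)\<^sup>2 = (2 * sqrt t * sin x)\<^sup>2"
        using assms by (simp add: power_mult_distrib sin_squared_eq algebra_simps)
      then show ?thesis using assms by (simp add: abs_mult)
    qed
    moreover have "\<bar>sin x\<bar> = sin x" if "x \<in> {0..pi}" using that sin_ge_zero by simp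
    moreover have "sqrt t * sqrt t = t" using assms by simp
    ultimately show "?f (?g x) * (2 * sqrt t * sin x) * indicator {0..pi} x =
        indicator {0..pi} x *\<^sub>R (t * (2 / pi) * ((1 + t + 2 * (- sqrt t) * cos x) ^ p * sin (real (Suc 0) * x) * sin x))"
      by (auto simp: indicator_def field_simps)
  qed
  also have "\<dots> = integral {0..pi} (\<lambda>x. t * (2 / pi) * ((1 + t + 2 * (- sqrt t) * cos x) ^ p * sin (real (Suc 0) * x) * sin x))"
    by (intro set_borel_integral_eq_integral borel_integrable_atLeastAtMost' continuous_intros)
  also have "\<dots> = t * chebyshev_moment (1 + t) (- sqrt t) 0 p"
    by (simp add: chebyshev_moment_def)
  finally show ?thesis
    using free_poisson_integral_density[of "Suc p" t] assms by simp
qed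

theorem moments_free_poisson:
  assumes "t > 0" "1 \<le> e" "e \<le> N"
  shows "moments (free_poisson t) e = height_moment N (\<lambda>_. complex_of_real t) e 0"
proof -
  obtain p where e: "e = Suc p" using assms(2) by (cases e) auto
  have "height_moment N (\<lambda>_. complex_of_real t) (Suc p) 0 =
      complex_of_real (t * chebyshev_moment (1 + t) (- sqrt t) 0 p)"
    using assms e by (intro height_moment_chebyshev) auto
  then show ?thesis
    unfolding moments_def e free_poisson_moment[OF assms(1)] by simp
qed

section \<open>Gaussian integration by parts\<close>

text \<open>Moments of the centred normal law of variance 1/2, that of the real and imaginary parts;
  for \<open>a = 2 * k\<close> the value is (2k - 1)!! / 2^k.\<close>

definition half_gaussian_moment :: "nat \<Rightarrow> real" where
  "half_gaussian_moment a = (if even a then fact a / (4 ^ (a div 2) * fact (a div 2)) else 0)"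

lemma half_gaussian_moment_Suc:
  "half_gaussian_moment (Suc a) = real a / 2 * half_gaussian_moment (a - 1)"
proof (cases "even a")
  case True
  then show ?thesis by (cases a) (auto simp: half_gaussian_moment_def)
next
  case False
  then obtain b where a: "a = Suc (2 * b)" by (auto elim!: oddE)
  have F: "fact (Suc (Suc (2 * b))) = 2 * real (Suc b) * (2 * real b + 1) * fact (2 * b)"
    by (simp add: algebra_simps)
  have "half_gaussian_moment (Suc a) = fact (Suc (Suc (2 * b))) / (4 * 4 ^ b * fact (Suc b))"
    by (simp add: a half_gaussian_moment_def del: fact_Suc of_nat_Suc)
  also have "\<dots> = 2 * real (Suc b) * (2 * real b + 1) * fact (2 * b) / (4 * 4 ^ b * (real (Suc b) * fact b))"
    by (simp only: F fact_Suc[of b])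
  also have "\<dots> = (2 * real b + 1) / 2 * (fact (2 * b) / (4 ^ b * fact b))"
  proof -
    have "2 * x * y * u / (4 * p * (x * v)) = y / 2 * (u / (p * v))" if "x \<noteq> 0" for x y u p v :: real
      using that by (simp add: field_simps)
    then show ?thesis using of_nat_neq_0[of b] by blast
  qed
  also have "\<dots> = real a / 2 * half_gaussian_moment (a - 1)"
    by (simp add: a half_gaussian_moment_def)
  finally show ?thesis .
qed

lemma normal_density_half_moment:
  "has_bochner_integral lborel (\<lambda>x. normal_density 0 (sqrt (1 / 2)) x * x ^ a) (half_gaussian_moment a)"
proof (cases "even a")
  case True
  then obtain k where k: "a = 2 * k" by (auto elim: evenE)
  show ?thesis
    using normal_moment_even[of "sqrt (1 / 2)" 0 k] by (simp add: k half_gaussian_moment_def)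
next
  case False
  then obtain k where k: "a = 2 * k + 1" by (auto elim: oddE)
  show ?thesis
    using normal_moment_odd[of "sqrt (1 / 2)" 0 k] by (simp add: k half_gaussian_moment_def)
qed

context prob_space
begin

context
  fixes Z :: "'a \<Rightarrow> complex"
  assumes Z: "std_complex_gaussian M Z"
begin

lemma gaussian_power_moments:
  shows "integrable M (\<lambda>\<omega>. Re (Z \<omega>) ^ a)" "integrable M (\<lambda>\<omega>. Im (Z \<omega>) ^ a)"
    and "expectation (\<lambda>\<omega>. Re (Z \<omega>) ^ a) = half_gaussian_moment a"
    and "expectation (\<lambda>\<omega>. Im (Z \<omega>) ^ a) = half_gaussian_moment a"
proof -
  have D: "distributed M lborel (\<lambda>\<omega>. Re (Z \<omega>)) (normal_density 0 (sqrt (1 / 2)))"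
    "distributed M lborel (\<lambda>\<omega>. Im (Z \<omega>)) (normal_density 0 (sqrt (1 / 2)))"
    using Z by (auto simp: std_complex_gaussian_def)
  note m = normal_density_half_moment[of a]
  show "integrable M (\<lambda>\<omega>. Re (Z \<omega>) ^ a)"
    using distributed_integrable[OF D(1), of "\<lambda>x. x ^ a"] m by (auto simp: has_bochner_integral_iff)
  show "integrable M (\<lambda>\<omega>. Im (Z \<omega>) ^ a)"
    using distributed_integrable[OF D(2), of "\<lambda>x. x ^ a"] m by (auto simp: has_bochner_integral_iff)
  show "expectation (\<lambda>\<omega>. Re (Z \<omega>) ^ a) = half_gaussian_moment a"
    using distributed_integral[OF D(1), of "\<lambda>x. x ^ a"] m by (auto simp: has_bochner_integral_iff)
  show "expectation (\<lambda>\<omega>. Im (Z \<omega>) ^ a) = half_gaussian_moment a"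
    using distributed_integral[OF D(2), of "\<lambda>x. x ^ a"] m by (auto simp: has_bochner_integral_iff)
qed

text \<open>Independence is available for the real and imaginary parts, so their powers are carried
  along and the factors \<open>Z\<close> and \<open>cnj Z\<close> are traded for them one at a
  time.\<close>

definition gaussian_mixed :: "nat \<Rightarrow> nat \<Rightarrow> nat \<Rightarrow> nat \<Rightarrow> 'a \<Rightarrow> complex" where
  "gaussian_mixed a b r s \<omega> =
     of_real (Re (Z \<omega>) ^ a) * of_real (Im (Z \<omega>) ^ b) * Z \<omega> ^ r * cnj (Z \<omega>) ^ s"

lemma gaussian_mixed_Suc:
  "gaussian_mixed a b (Suc r) s = (\<lambda>\<omega>. gaussian_mixed (Suc a) b r s \<omega> + \<i> * gaussian_mixed a (Suc b) r s \<omega>)"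
  "gaussian_mixed a b r (Suc s) = (\<lambda>\<omega>. gaussian_mixed (Suc a) b r s \<omega> - \<i> * gaussian_mixed a (Suc b) r s \<omega>)"
proof -
  have Z: "Z \<omega> = of_real (Re (Z \<omega>)) + \<i> * of_real (Im (Z \<omega>))"
    "cnj (Z \<omega>) = of_real (Re (Z \<omega>)) - \<i> * of_real (Im (Z \<omega>))" for \<omega>
    by (simp_all add: complex_eq_iff)
  show "gaussian_mixed a b (Suc r) s = (\<lambda>\<omega>. gaussian_mixed (Suc a) b r s \<omega> + \<i> * gaussian_mixed a (Suc b) r s \<omega>)"
  proof
    fix \<omega>
    have "gaussian_mixed a b (Suc r) s \<omega> = gaussian_mixed a b r s \<omega> * Z \<omega>"
      by (simp add: gaussian_mixed_def)
    also have "\<dots> = gaussian_mixed a b r s \<omega> * (of_real (Re (Z \<omega>)) + \<i> * of_real (Im (Z \<omega>)))"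
      by (rule arg_cong[OF Z(1)])
    finally show "gaussian_mixed a b (Suc r) s \<omega> = gaussian_mixed (Suc a) b r s \<omega> + \<i> * gaussian_mixed a (Suc b) r s \<omega>"
      by (simp add: gaussian_mixed_def algebra_simps)
  qed
  show "gaussian_mixed a b r (Suc s) = (\<lambda>\<omega>. gaussian_mixed (Suc a) b r s \<omega> - \<i> * gaussian_mixed a (Suc b) r s \<omega>)"
  proof
    fix \<omega>
    have "gaussian_mixed a b r (Suc s) \<omega> = gaussian_mixed a b r s \<omega> * cnj (Z \<omega>)"
      by (simp add: gaussian_mixed_def)
    also have "\<dots> = gaussian_mixed a b r s \<omega> * (of_real (Re (Z \<omega>)) - \<i> * of_real (Im (Z \<omega>)))"
      by (rule arg_cong[OF Z(2)])
    finally show "gaussian_mixed a b r (Suc s) \<omega> = gaussian_mixed (Suc a) b r s \<omega> - \<i> * gaussian_mixed a (Suc b) r s \<omega>"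
      by (simp add: gaussian_mixed_def algebra_simps)
  qed
qed

lemma gaussian_mixed_integrable: "integrable M (gaussian_mixed a b r s)"
proof (induction r arbitrary: a b)
  case 0
  show ?case
  proof (induction s arbitrary: a b)
    case 0
    have "indep_var borel ((\<lambda>x. x ^ a) \<circ> (\<lambda>\<omega>. Re (Z \<omega>))) borel ((\<lambda>x. x ^ b) \<circ> (\<lambda>\<omega>. Im (Z \<omega>)))"
      using Z by (intro indep_var_compose) (auto simp: std_complex_gaussian_def)
    then have "integrable M (\<lambda>\<omega>. Re (Z \<omega>) ^ a * Im (Z \<omega>) ^ b)"
      by (intro indep_var_integrable gaussian_power_moments) (simp add: comp_def)
    then have "integrable M (\<lambda>\<omega>. complex_of_real (Re (Z \<omega>) ^ a * Im (Z \<omega>) ^ b))"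
      by (rule integrable_of_real)
    then show ?case unfolding gaussian_mixed_def by simp
  qed (simp add: gaussian_mixed_Suc)
qed (simp add: gaussian_mixed_Suc)

lemma gaussian_mixed_expectation_0:
  "expectation (gaussian_mixed a b 0 0) = of_real (half_gaussian_moment a * half_gaussian_moment b)"
proof -
  have "indep_var borel ((\<lambda>x. x ^ a) \<circ> (\<lambda>\<omega>. Re (Z \<omega>))) borel ((\<lambda>x. x ^ b) \<circ> (\<lambda>\<omega>. Im (Z \<omega>)))"
    using Z by (intro indep_var_compose) (auto simp: std_complex_gaussian_def)
  then have "expectation (\<lambda>\<omega>. Re (Z \<omega>) ^ a * Im (Z \<omega>) ^ b) =
      expectation (\<lambda>\<omega>. Re (Z \<omega>) ^ a) * expectation (\<lambda>\<omega>. Im (Z \<omega>) ^ b)"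
    by (intro indep_var_lebesgue_integral gaussian_power_moments) (simp add: comp_def)
  moreover have "gaussian_mixed a b 0 0 = (\<lambda>\<omega>. of_real (Re (Z \<omega>) ^ a * Im (Z \<omega>) ^ b))"
    by (simp add: gaussian_mixed_def fun_eq_iff)
  ultimately show ?thesis by (simp only: integral_complex_of_real gaussian_power_moments)
qed

lemma gaussian_mixed_expectation_Suc:
  "expectation (gaussian_mixed a b (Suc r) s) =
     expectation (gaussian_mixed (Suc a) b r s) + \<i> * expectation (gaussian_mixed a (Suc b) r s)"
  "expectation (gaussian_mixed a b r (Suc s)) =
     expectation (gaussian_mixed (Suc a) b r s) - \<i> * expectation (gaussian_mixed a (Suc b) r s)"
  unfolding gaussian_mixed_Suc by (simp_all add: gaussian_mixed_integrable)

text \<open>Stein's identity in each real coordinate: the variance 1/2 times the expected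
  derivative, where \<open>Z\<close> and \<open>cnj Z\<close> have derivatives 1 and 1 in the real
  direction, \<i> and -\<i> in the imaginary one. A truncated difference always comes with a factor
  that is 0 when it truncates.\<close>

lemma gaussian_mixed_by_parts:
  fixes a b r s
  defines "N \<equiv> \<lambda>a b r s. expectation (gaussian_mixed a b r s)"
  shows "N (Suc a) b r s =
      (of_nat a * N (a - 1) b r s + of_nat r * N a b (r - 1) s + of_nat s * N a b r (s - 1)) / 2"
    and "N a (Suc b) r s =
      (of_nat b * N a (b - 1) r s + \<i> * of_nat r * N a b (r - 1) s - \<i> * of_nat s * N a b r (s - 1)) / 2"
proof -
  have Nr: "N a b (Suc r) s = N (Suc a) b r s + \<i> * N a (Suc b) r s"
    and Ns: "N a b r (Suc s) = N (Suc a) b r s - \<i> * N a (Suc b) r s" for a b r s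
    by (simp_all add: N_def gaussian_mixed_expectation_Suc)
  have N0: "N a b 0 0 = of_real (half_gaussian_moment a * half_gaussian_moment b)" for a b
    by (simp add: N_def gaussian_mixed_expectation_0)
  have Nr': "of_nat r * N a b r s = of_nat r * (N (Suc a) b (r - 1) s + \<i> * N a (Suc b) (r - 1) s)" for a b r s
    using Nr[of a b "r - 1"] by (cases r) auto
  have Ns': "of_nat s * N a b r s = of_nat s * (N (Suc a) b r (s - 1) - \<i> * N a (Suc b) r (s - 1))" for a b r s
    using Ns[of a b _ "s - 1"] by (cases s) auto
  have A: "of_nat a * N a b r s = of_nat a * N (Suc (a - 1)) b r s"
    "of_nat b * N a b r s = of_nat b * N a (Suc (b - 1)) r s" for a b r s
    by (cases a; simp) (cases b; simp)
  have "(\<forall>a b. N (Suc a) b r s =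
      (of_nat a * N (a - 1) b r s + of_nat r * N a b (r - 1) s + of_nat s * N a b r (s - 1)) / 2) \<and>
     (\<forall>a b. N a (Suc b) r s =
      (of_nat b * N a (b - 1) r s + \<i> * of_nat r * N a b (r - 1) s - \<i> * of_nat s * N a b r (s - 1)) / 2)"
  proof (induction r)
    case 0
    show ?case
    proof (induction s)
      case 0
      show ?case by (simp add: N0 half_gaussian_moment_Suc)
    next
      case (Suc s)
      have IH1: "N (Suc a) b 0 s = (of_nat a * N (a - 1) b 0 s + of_nat s * N a b 0 (s - 1)) / 2"
        and IH2: "N a (Suc b) 0 s = (of_nat b * N a (b - 1) 0 s - \<i> * of_nat s * N a b 0 (s - 1)) / 2" for a b
        using Suc.IH by auto
      show ?case
      proof (intro conjI allI)
        fix a b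
        have "N (Suc a) b 0 (Suc s) = (of_nat (Suc a) * N a b 0 s + of_nat s * N (Suc a) b 0 (s - 1)) / 2
            - \<i> * ((of_nat a * N (a - 1) (Suc b) 0 s + of_nat s * N a (Suc b) 0 (s - 1)) / 2)"
          unfolding Ns IH1 by simp
        also have "\<dots> = (N a b 0 s + of_nat a * (N (Suc (a - 1)) b 0 s - \<i> * N (a - 1) (Suc b) 0 s)
            + of_nat s * (N (Suc a) b 0 (s - 1) - \<i> * N a (Suc b) 0 (s - 1))) / 2"
          using A(1)[of a b 0 s] by (auto simp: field_simps)
        also have "\<dots> = (N a b 0 s + of_nat a * N (a - 1) b 0 (Suc s) + of_nat s * N a b 0 s) / 2"
          by (simp only: Ns'[of s a b 0] Ns[of "a - 1" b 0 s])
        finally show "N (Suc a) b 0 (Suc s) = (of_nat a * N (a - 1) b 0 (Suc s) +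
            of_nat 0 * N a b (0 - 1) (Suc s) + of_nat (Suc s) * N a b 0 (Suc s - 1)) / 2"
          by (simp add: field_simps)
        have "N a (Suc b) 0 (Suc s) = (of_nat b * N (Suc a) (b - 1) 0 s - \<i> * of_nat s * N (Suc a) b 0 (s - 1)) / 2
            - \<i> * ((of_nat (Suc b) * N a b 0 s - \<i> * of_nat s * N a (Suc b) 0 (s - 1)) / 2)"
          unfolding Ns IH2 by simp
        also have "\<dots> = (of_nat b * (N (Suc a) (b - 1) 0 s - \<i> * N a (Suc (b - 1)) 0 s) - \<i> * N a b 0 s
            - \<i> * (of_nat s * (N (Suc a) b 0 (s - 1) - \<i> * N a (Suc b) 0 (s - 1)))) / 2"
          using A(2)[of b a 0 s] by (auto simp: field_simps)
        also have "\<dots> = (of_nat b * N a (b - 1) 0 (Suc s) - \<i> * N a b 0 s - \<i> * (of_nat s * N a b 0 s)) / 2"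
          by (simp only: Ns'[of s a b 0] Ns[of a "b - 1" 0 s])
        finally show "N a (Suc b) 0 (Suc s) = (of_nat b * N a (b - 1) 0 (Suc s) +
            \<i> * of_nat 0 * N a b (0 - 1) (Suc s) - \<i> * of_nat (Suc s) * N a b 0 (Suc s - 1)) / 2"
          by (simp add: field_simps)
      qed
    qed
  next
    case (Suc r)
    have IH1: "N (Suc a) b r s =
      (of_nat a * N (a - 1) b r s + of_nat r * N a b (r - 1) s + of_nat s * N a b r (s - 1)) / 2"
      and IH2: "N a (Suc b) r s =
      (of_nat b * N a (b - 1) r s + \<i> * of_nat r * N a b (r - 1) s - \<i> * of_nat s * N a b r (s - 1)) / 2" for a b
      using Suc.IH by auto
    show ?case
    proof (intro conjI allI)
      fix a b
      have "N (Suc a) b (Suc r) s =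
          (of_nat (Suc a) * N a b r s + of_nat r * N (Suc a) b (r - 1) s + of_nat s * N (Suc a) b r (s - 1)) / 2
          + \<i> * ((of_nat a * N (a - 1) (Suc b) r s + of_nat r * N a (Suc b) (r - 1) s + of_nat s * N a (Suc b) r (s - 1)) / 2)"
        unfolding Nr IH1 by simp
      also have "\<dots> = (N a b r s + of_nat a * (N (Suc (a - 1)) b r s + \<i> * N (a - 1) (Suc b) r s)
          + of_nat r * (N (Suc a) b (r - 1) s + \<i> * N a (Suc b) (r - 1) s)
          + of_nat s * (N (Suc a) b r (s - 1) + \<i> * N a (Suc b) r (s - 1))) / 2"
        using A(1)[of a b r s] by (auto simp: field_simps)
      also have "\<dots> = (N a b r s + of_nat a * N (a - 1) b (Suc r) s + of_nat r * N a b r s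
          + of_nat s * N a b (Suc r) (s - 1)) / 2"
        by (simp only: Nr'[of r a b s] Nr[of "a - 1" b r s] Nr[of a b r "s - 1"])
      finally show "N (Suc a) b (Suc r) s = (of_nat a * N (a - 1) b (Suc r) s +
          of_nat (Suc r) * N a b (Suc r - 1) s + of_nat s * N a b (Suc r) (s - 1)) / 2"
        by (simp add: field_simps)
      have "N a (Suc b) (Suc r) s =
          (of_nat b * N (Suc a) (b - 1) r s + \<i> * of_nat r * N (Suc a) b (r - 1) s - \<i> * of_nat s * N (Suc a) b r (s - 1)) / 2
          + \<i> * ((of_nat (Suc b) * N a b r s + \<i> * of_nat r * N a (Suc b) (r - 1) s - \<i> * of_nat s * N a (Suc b) r (s - 1)) / 2)"
        unfolding Nr IH2 by simp
      also have "\<dots> = (of_nat b * (N (Suc a) (b - 1) r s + \<i> * N a (Suc (b - 1)) r s) + \<i> * N a b r s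
          + \<i> * (of_nat r * (N (Suc a) b (r - 1) s + \<i> * N a (Suc b) (r - 1) s))
          - \<i> * (of_nat s * (N (Suc a) b r (s - 1) + \<i> * N a (Suc b) r (s - 1)))) / 2"
        using A(2)[of b a r s] by (auto simp: field_simps)
      also have "\<dots> = (of_nat b * N a (b - 1) (Suc r) s + \<i> * N a b r s + \<i> * (of_nat r * N a b r s)
          - \<i> * (of_nat s * N a b (Suc r) (s - 1))) / 2"
        by (simp only: Nr'[of r a b s] Nr[of a "b - 1" r s] Nr[of a b r "s - 1"])
      finally show "N a (Suc b) (Suc r) s = (of_nat b * N a (b - 1) (Suc r) s +
          \<i> * of_nat (Suc r) * N a b (Suc r - 1) s - \<i> * of_nat s * N a b (Suc r) (s - 1)) / 2"
        by (simp add: field_simps)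
    qed
  qed
  then show "N (Suc a) b r s =
      (of_nat a * N (a - 1) b r s + of_nat r * N a b (r - 1) s + of_nat s * N a b r (s - 1)) / 2"
    and "N a (Suc b) r s =
      (of_nat b * N a (b - 1) r s + \<i> * of_nat r * N a b (r - 1) s - \<i> * of_nat s * N a b r (s - 1)) / 2"
    by blast+
qed

lemma complex_gaussian_integrable: "integrable M (\<lambda>\<omega>. Z \<omega> ^ r * cnj (Z \<omega>) ^ s)"
  using gaussian_mixed_integrable[of 0 0 r s] by (simp add: gaussian_mixed_def[abs_def])

text \<open>A further factor \<open>cnj Z\<close> acts as the derivative in \<open>Z\<close> and
  conversely: the two by-parts formulas reinforce each other for one of the variables and cancel for
  the other.\<close>

lemma complex_gaussian_moment:
  "expectation (\<lambda>\<omega>. Z \<omega> ^ r * cnj (Z \<omega>) ^ s) = (if r = s then fact r else 0)"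
proof -
  let ?N = "\<lambda>r s. expectation (gaussian_mixed 0 0 r s)"
  have N0: "?N 0 0 = 1"
    by (simp add: gaussian_mixed_expectation_0 half_gaussian_moment_def)
  have Ns: "?N r (Suc s) = of_nat r * ?N (r - 1) s" for r s
    unfolding gaussian_mixed_expectation_Suc gaussian_mixed_by_parts by (simp add: field_simps)
  have Nr: "?N (Suc r) s = of_nat s * ?N r (s - 1)" for r s
    unfolding gaussian_mixed_expectation_Suc gaussian_mixed_by_parts by (simp add: field_simps)
  have "?N r s = (if r = s then fact r else 0)"
  proof (induction r arbitrary: s)
    case 0
    then show ?case by (cases s) (simp_all add: N0 Ns)
  next
    case (Suc r)
    then show ?case by (cases s) (simp_all add: Nr)
  qed
  then show ?thesis by (simp add: gaussian_mixed_def[abs_def])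
qed

end

end

section \<open>Wick calculus for finitely many independent complex Gaussians\<close>

definition remove_nth :: "nat \<Rightarrow> 'b list \<Rightarrow> 'b list" where
  "remove_nth j xs = take j xs @ drop (Suc j) xs"

lemma set_remove_nth: "set (remove_nth j xs) \<subseteq> set xs"
  unfolding remove_nth_def using set_take_subset set_drop_subset by fastforce

lemma count_list_remove_nth:
  assumes "j < length xs"
  shows "count_list (remove_nth j xs) x = count_list xs x - (if xs ! j = x then 1 else 0)"
proof -
  have "count_list xs x = count_list (take j xs @ xs ! j # drop (Suc j) xs) x"
    using id_take_nth_drop[OF assms] by simp
  then show ?thesis by (simp add: remove_nth_def)
qed

lemma card_nth_eq_count_list: "card {j. j < length xs \<and> xs ! j = x} = count_list xs x"
  by (simp add: count_list_eq_length_filter length_filter_conv_card eq_commute)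

lemma prod_list_map_count_list:
  fixes f :: "'b \<Rightarrow> complex"
  assumes "finite A" "set xs \<subseteq> A"
  shows "prod_list (map f xs) = (\<Prod>a\<in>A. f a ^ count_list xs a)"
  using assms(2)
proof (induction xs)
  case (Cons x xs)
  have "(\<Prod>a\<in>A. f a ^ count_list (x # xs) a) = (\<Prod>a\<in>A. (if a = x then f x else 1) * f a ^ count_list xs a)"
    by (intro prod.cong) auto
  also have "\<dots> = f x * (\<Prod>a\<in>A. f a ^ count_list xs a)"
    using assms(1) Cons.prems by (simp add: prod.distrib)
  finally show ?case using Cons by simp
qed simp

lemma sum_lessThan_add:
  fixes f :: "nat \<Rightarrow> complex"
  shows "(\<Sum>j<m + k. f j) = (\<Sum>j<m. f j) + (\<Sum>j<k. f (m + j))"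
  by (induction k) (simp_all add: add.assoc)

locale gaussian_array = prob_space M for M :: "'w measure" +
  fixes I :: "'e set" and Z :: "'e \<Rightarrow> 'w \<Rightarrow> complex"
  assumes finite_I: "finite I"
    and gaussian: "\<And>e. e \<in> I \<Longrightarrow> std_complex_gaussian M (Z e)"
    and indep: "indep_vars (\<lambda>_. borel) Z I"
begin

definition monomial :: "'e list \<Rightarrow> 'e list \<Rightarrow> 'w \<Rightarrow> complex" where
  "monomial us vs \<omega> = prod_list (map (\<lambda>u. Z u \<omega>) us) * prod_list (map (\<lambda>v. cnj (Z v \<omega>)) vs)"

lemma monomial_moment:
  assumes "set us \<subseteq> I" "set vs \<subseteq> I"
  shows "integrable M (monomial us vs)"
    and "expectation (monomial us vs) =
      (\<Prod>e\<in>I. if count_list us e = count_list vs e then fact (count_list us e) else 0)"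
proof -
  let ?X = "\<lambda>e \<omega>. Z e \<omega> ^ count_list us e * cnj (Z e \<omega>) ^ count_list vs e"
  have m: "monomial us vs = (\<lambda>\<omega>. \<Prod>e\<in>I. ?X e \<omega>)"
    using assms by (simp add: fun_eq_iff monomial_def prod_list_map_count_list[OF finite_I] prod.distrib)
  have ind: "indep_vars (\<lambda>_. borel) ?X I"
    by (rule indep_vars_compose2[OF indep, of "\<lambda>e z. z ^ count_list us e * cnj z ^ count_list vs e"])
      (intro borel_measurable_continuous_onI continuous_intros)
  have int: "integrable M (?X e)" if "e \<in> I" for e
    using complex_gaussian_integrable[OF gaussian[OF that]] .
  show "integrable M (monomial us vs)"
    unfolding m by (rule indep_vars_integrable[OF finite_I ind int])
  have "expectation (monomial us vs) = (\<Prod>e\<in>I. expectation (?X e))"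
    unfolding m by (rule indep_vars_lebesgue_integral[OF finite_I ind int])
  also have "\<dots> = (\<Prod>e\<in>I. if count_list us e = count_list vs e then fact (count_list us e) else 0)"
    by (intro prod.cong refl complex_gaussian_moment gaussian)
  finally show "expectation (monomial us vs) = \<dots>" .
qed

text \<open>By independence both sides are products over \<open>I\<close>, and the factors differ
  only at \<open>e\<close>. There the identity is (c + 1)! = (c + 1) c!, the factor in front being
  the number of positions of \<open>e\<close> in \<open>vs\<close>; if the multiplicities do not
  match, both sides are 0.\<close>

lemma wick_recursion:
  assumes e: "e \<in> I" and us: "set us \<subseteq> I" and vs: "set vs \<subseteq> I"
  shows "expectation (monomial (e # us) vs) =
    (\<Sum>j<length vs. if vs ! j = e then expectation (monomial us (remove_nth j vs)) else 0)"
proof -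
  let ?w = "\<lambda>c d. if c = d then fact c else (0 :: complex)"
  let ?R = "\<Prod>x\<in>I - {e}. ?w (count_list us x) (count_list vs x)"
  let ?c = "count_list us e" and ?d = "count_list vs e"
  have "expectation (monomial us (remove_nth j vs)) = ?w ?c (?d - 1) * ?R"
    if j: "j < length vs" "vs ! j = e" for j
  proof -
    have "expectation (monomial us (remove_nth j vs)) =
        (\<Prod>x\<in>I. ?w (count_list us x) (count_list (remove_nth j vs) x))"
      using us vs set_remove_nth[of j vs] by (intro monomial_moment(2)) auto
    also have "\<dots> = ?w ?c (count_list (remove_nth j vs) e) *
        (\<Prod>x\<in>I - {e}. ?w (count_list us x) (count_list (remove_nth j vs) x))"
      by (rule prod.remove[OF finite_I e])
    also have "(\<Prod>x\<in>I - {e}. ?w (count_list us x) (count_list (remove_nth j vs) x)) = ?R"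
      using j by (intro prod.cong) (auto simp: count_list_remove_nth)
    finally show ?thesis using j by (simp add: count_list_remove_nth)
  qed
  then have "(\<Sum>j<length vs. if vs ! j = e then expectation (monomial us (remove_nth j vs)) else 0)
      = (\<Sum>j<length vs. if vs ! j = e then ?w ?c (?d - 1) * ?R else 0)"
    by (intro sum.cong) auto
  also have "\<dots> = (\<Sum>j | j < length vs \<and> vs ! j = e. ?w ?c (?d - 1) * ?R)"
    by (rule sum.mono_neutral_cong_right) auto
  also have "\<dots> = of_nat ?d * (?w ?c (?d - 1) * ?R)"
    by (simp only: sum_constant card_nth_eq_count_list)
  also have "\<dots> = ?w (Suc ?c) ?d * ?R"
    by (cases ?d) auto
  also have "\<dots> = (\<Prod>x\<in>I. ?w (count_list (e # us) x) (count_list vs x))"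
    unfolding prod.remove[OF finite_I e] by (intro arg_cong2[of _ _ _ _ "(*)"] prod.cong) auto
  also have "\<dots> = expectation (monomial (e # us) vs)"
    using assms by (intro monomial_moment(2)[symmetric]) auto
  finally show ?thesis ..
qed

text \<open>
  \<open>wirtinger e F F'\<close>: \<open>F\<close> is a polynomial in the variables \<open>Z\<close> and their conjugates, and \<open>F'\<close> is
  its formal derivative with respect to the conjugate of \<open>Z e\<close>.
\<close>

inductive wirtinger :: "'e \<Rightarrow> ('w \<Rightarrow> complex) \<Rightarrow> ('w \<Rightarrow> complex) \<Rightarrow> bool" for e where
  wirtinger_monomial: "set us \<subseteq> I \<Longrightarrow> set vs \<subseteq> I \<Longrightarrow> wirtinger e (\<lambda>\<omega>. c * monomial us vs \<omega>)
     (\<lambda>\<omega>. c * (\<Sum>j<length vs. if vs ! j = e then monomial us (remove_nth j vs) \<omega> else 0))"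
| wirtinger_add: "wirtinger e F F' \<Longrightarrow> wirtinger e G G' \<Longrightarrow>
     wirtinger e (\<lambda>\<omega>. F \<omega> + G \<omega>) (\<lambda>\<omega>. F' \<omega> + G' \<omega>)"

text \<open>The Wick recursion extended by linearity. Integrability is carried along for the later
  exchanges of sums and expectations.\<close>

lemma wirtinger_by_parts:
  assumes "wirtinger e F F'" "e \<in> I"
  shows "integrable M F \<and> integrable M F' \<and> integrable M (\<lambda>\<omega>. Z e \<omega> * F \<omega>) \<and>
    expectation (\<lambda>\<omega>. Z e \<omega> * F \<omega>) = expectation F'"
  using assms(1)
proof induction
  case (wirtinger_monomial us vs c)
  have eq: "(\<lambda>\<omega>. Z e \<omega> * (c * monomial us vs \<omega>)) = (\<lambda>\<omega>. c * monomial (e # us) vs \<omega>)"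
    by (simp add: monomial_def fun_eq_iff)
  have i1: "integrable M (monomial (e # us) vs)"
    using wirtinger_monomial assms(2) by (intro monomial_moment) auto
  have i2: "integrable M (\<lambda>\<omega>. if vs ! j = e then monomial us (remove_nth j vs) \<omega> else 0)" for j
    using wirtinger_monomial set_remove_nth[of j vs] monomial_moment(1)[of us "remove_nth j vs"]
    by (cases "vs ! j = e") auto
  have "expectation (\<lambda>\<omega>. if vs ! j = e then monomial us (remove_nth j vs) \<omega> else 0) =
      (if vs ! j = e then expectation (monomial us (remove_nth j vs)) else 0)" for j
    by simp
  then have "expectation (\<lambda>\<omega>. c * (\<Sum>j<length vs. if vs ! j = e then monomial us (remove_nth j vs) \<omega> else 0))
      = c * expectation (monomial (e # us) vs)"
    using i2 wick_recursion[OF assms(2) wirtinger_monomial] by simp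
  then show ?case
    unfolding eq using i1 i2 wirtinger_monomial monomial_moment(1)[of us vs] by auto
next
  case (wirtinger_add F F' G G')
  then show ?case by (simp add: distrib_left)
qed

lemma wirtinger_cong: "wirtinger e F F' \<Longrightarrow> F = G \<Longrightarrow> F' = G' \<Longrightarrow> wirtinger e G G'"
  by simp

lemma wirtinger_const: "wirtinger e (\<lambda>_. c) (\<lambda>_. 0)"
  by (rule wirtinger_cong[OF wirtinger_monomial[of "[]" "[]" e c]]) (simp_all add: monomial_def)

lemma wirtinger_var: "u \<in> I \<Longrightarrow> wirtinger e (Z u) (\<lambda>_. 0)"
  by (rule wirtinger_cong[OF wirtinger_monomial[of "[u]" "[]" e 1]]) (simp_all add: monomial_def)

lemma wirtinger_cnj: "v \<in> I \<Longrightarrow> wirtinger e (\<lambda>\<omega>. cnj (Z v \<omega>)) (\<lambda>_. if v = e then 1 else 0)"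
  by (rule wirtinger_cong[OF wirtinger_monomial[of "[]" "[v]" e 1]])
    (simp_all add: monomial_def remove_nth_def)

lemma wirtinger_mult:
  assumes "wirtinger e F F'" "wirtinger e G G'"
  shows "wirtinger e (\<lambda>\<omega>. F \<omega> * G \<omega>) (\<lambda>\<omega>. F' \<omega> * G \<omega> + F \<omega> * G' \<omega>)"
  using assms(1)
proof induction
  case (wirtinger_monomial us vs c)
  from assms(2) show ?case
  proof induction
    case (wirtinger_monomial us' vs' d)
    let ?D = "\<lambda>us vs \<omega> j. if vs ! j = e then monomial us (remove_nth j vs) \<omega> else 0"
    have mult: "monomial us vs \<omega> * monomial us' vs' \<omega> = monomial (us @ us') (vs @ vs') \<omega>" for us vs us' vs' \<omega>
      by (simp add: monomial_def)
    have 1: "?D (us @ us') (vs @ vs') \<omega> j = ?D us vs \<omega> j * monomial us' vs' \<omega>" if "j < length vs" for j \<omega>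
      using that by (simp add: remove_nth_def nth_append mult)
    have 2: "?D (us @ us') (vs @ vs') \<omega> (length vs + j) = monomial us vs \<omega> * ?D us' vs' \<omega> j" for j \<omega>
      by (simp add: remove_nth_def nth_append mult)
    have "wirtinger e (\<lambda>\<omega>. (c * d) * monomial (us @ us') (vs @ vs') \<omega>)
        (\<lambda>\<omega>. (c * d) * (\<Sum>j<length (vs @ vs'). ?D (us @ us') (vs @ vs') \<omega> j))"
      using wirtinger_monomial \<open>set us \<subseteq> I\<close> \<open>set vs \<subseteq> I\<close> by (intro wirtinger.wirtinger_monomial) auto
    moreover have "(\<Sum>j<length (vs @ vs'). ?D (us @ us') (vs @ vs') \<omega> j) =
        (\<Sum>j<length vs. ?D us vs \<omega> j) * monomial us' vs' \<omega> + monomial us vs \<omega> * (\<Sum>j<length vs'. ?D us' vs' \<omega> j)" for \<omega>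
      unfolding length_append sum_lessThan_add sum_distrib_left sum_distrib_right
      by (intro arg_cong2[of _ _ _ _ "(+)"] sum.cong refl 1 2) auto
    ultimately show ?case
      by (elim wirtinger_cong) (simp_all add: fun_eq_iff mult[symmetric] algebra_simps)
  next
    case (wirtinger_add G G' H H')
    from wirtinger.wirtinger_add[OF wirtinger_add.IH] show ?case
      by (rule wirtinger_cong) (simp_all add: fun_eq_iff algebra_simps)
  qed
next
  case (wirtinger_add F F' H H')
  from wirtinger.wirtinger_add[OF wirtinger_add.IH] show ?case
    by (rule wirtinger_cong) (simp_all add: fun_eq_iff algebra_simps)
qed

lemma wirtinger_cmult: "wirtinger e F F' \<Longrightarrow> wirtinger e (\<lambda>\<omega>. c * F \<omega>) (\<lambda>\<omega>. c * F' \<omega>)"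
  by (rule wirtinger_cong[OF wirtinger_mult[OF wirtinger_const[of e c]]]) simp_all

lemma wirtinger_sum:
  "(\<And>i. i \<in> A \<Longrightarrow> wirtinger e (F i) (F' i)) \<Longrightarrow>
    wirtinger e (\<lambda>\<omega>. \<Sum>i\<in>A. F i \<omega>) (\<lambda>\<omega>. \<Sum>i\<in>A. F' i \<omega>)"
proof (induction A rule: infinite_finite_induct)
  case (insert x A)
  then have "wirtinger e (\<lambda>\<omega>. F x \<omega> + (\<Sum>i\<in>A. F i \<omega>)) (\<lambda>\<omega>. F' x \<omega> + (\<Sum>i\<in>A. F' i \<omega>))"
    by (intro wirtinger_add) auto
  then show ?case using insert by simp
qed (auto intro: wirtinger_const)

lemma wirtinger_prod_list:
  "(\<And>i. i < length xs \<Longrightarrow> wirtinger e (F (xs ! i)) (F' (xs ! i))) \<Longrightarrow>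
    wirtinger e (\<lambda>\<omega>. \<Prod>x\<leftarrow>xs. F x \<omega>)
      (\<lambda>\<omega>. \<Sum>i<length xs. F' (xs ! i) \<omega> * (\<Prod>x\<leftarrow>remove_nth i xs. F x \<omega>))"
proof (induction xs)
  case Nil
  then show ?case by (simp add: wirtinger_const)
next
  case (Cons y xs)
  have y: "wirtinger e (F y) (F' y)" using Cons.prems[of 0] by simp
  have "wirtinger e (\<lambda>\<omega>. \<Prod>x\<leftarrow>xs. F x \<omega>)
      (\<lambda>\<omega>. \<Sum>i<length xs. F' (xs ! i) \<omega> * (\<Prod>x\<leftarrow>remove_nth i xs. F x \<omega>))"
    using Cons.prems[of "Suc _"] by (intro Cons.IH) simp
  from wirtinger_mult[OF y this] show ?case
    by (rule wirtinger_cong)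
      (simp_all add: fun_eq_iff sum.lessThan_Suc_shift remove_nth_def sum_distrib_left mult_ac
        del: sum.lessThan_Suc)
qed

end

section \<open>Traces of words in the blocks of a Wishart matrix\<close>

text \<open>Entry (x, z) of the \<open>d\<close> by \<open>d\<close> matrix that remains of the
  Wishart matrix when the indices \<open>a\<close> and \<open>c\<close> of the second tensor factor
  are fixed. The words below are words in these matrices.\<close>

definition gram :: "nat \<Rightarrow> (nat \<Rightarrow> nat \<Rightarrow> nat \<Rightarrow> complex) \<Rightarrow> nat \<Rightarrow> nat \<Rightarrow> nat \<Rightarrow> nat \<Rightarrow> complex" where
  "gram K g a c x z = (\<Sum>k<K. g x a k * cnj (g z c k)) / of_nat K"

fun gram_word ::
  "nat \<Rightarrow> nat \<Rightarrow> (nat \<Rightarrow> nat \<Rightarrow> nat \<Rightarrow> complex) \<Rightarrow> (nat \<times> nat) list \<Rightarrow> nat \<Rightarrow> nat \<Rightarrow> complex" where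
  "gram_word d K g [] x y = (if x = y then 1 else 0)"
| "gram_word d K g ((a, c) # w) x y = (\<Sum>z<d. gram K g a c x z * gram_word d K g w z y)"

definition word_trace ::
  "nat \<Rightarrow> nat \<Rightarrow> (nat \<Rightarrow> nat \<Rightarrow> nat \<Rightarrow> complex) \<Rightarrow> (nat \<times> nat) list \<Rightarrow> complex" where
  "word_trace d K g w = (\<Sum>x<d. gram_word d K g w x x) / of_nat d"

lemma gram_word_append:
  "x < d \<Longrightarrow> gram_word d K g (u @ v) x y = (\<Sum>z<d. gram_word d K g u x z * gram_word d K g v z y)"
proof (induction u arbitrary: x)
  case Nil
  have "(\<Sum>z<d. gram_word d K g [] x z * gram_word d K g v z y) =
      (\<Sum>z<d. if x = z then gram_word d K g v z y else 0)"
    by (intro sum.cong) auto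
  then show ?case using Nil by simp
next
  case (Cons l u)
  obtain a c where l: "l = (a, c)" by (cases l)
  show ?case
    by (simp add: l Cons.IH sum_distrib_left sum_distrib_right mult.assoc) (rule sum.swap)
qed

lemma word_trace_Nil: "d \<ge> 1 \<Longrightarrow> word_trace d K g [] = 1"
  by (simp add: word_trace_def)

lemma sum_reverse3:
  "(\<Sum>a\<in>A. \<Sum>b\<in>B. \<Sum>c\<in>C. f a b c) = (\<Sum>c\<in>C. \<Sum>b\<in>B. \<Sum>a\<in>A. f a b c)"
proof -
  have "(\<Sum>a\<in>A. \<Sum>b\<in>B. \<Sum>c\<in>C. f a b c) = (\<Sum>a\<in>A. \<Sum>c\<in>C. \<Sum>b\<in>B. f a b c)"
    by (intro sum.cong refl sum.swap)
  also have "\<dots> = (\<Sum>c\<in>C. \<Sum>a\<in>A. \<Sum>b\<in>B. f a b c)" by (rule sum.swap)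
  also have "\<dots> = (\<Sum>c\<in>C. \<Sum>b\<in>B. \<Sum>a\<in>A. f a b c)" by (intro sum.cong refl sum.swap)
  finally show ?thesis .
qed

lemma sum_reverse4:
  "(\<Sum>a\<in>A. \<Sum>b\<in>B. \<Sum>c\<in>C. \<Sum>e\<in>E. f a b c e) = (\<Sum>e\<in>E. \<Sum>c\<in>C. \<Sum>b\<in>B. \<Sum>a\<in>A. f a b c e)"
proof -
  have "(\<Sum>a\<in>A. \<Sum>b\<in>B. \<Sum>c\<in>C. \<Sum>e\<in>E. f a b c e) = (\<Sum>a\<in>A. \<Sum>e\<in>E. \<Sum>c\<in>C. \<Sum>b\<in>B. f a b c e)"
    by (intro sum.cong refl sum_reverse3)
  also have "\<dots> = (\<Sum>e\<in>E. \<Sum>a\<in>A. \<Sum>c\<in>C. \<Sum>b\<in>B. f a b c e)" by (rule sum.swap)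
  also have "\<dots> = (\<Sum>e\<in>E. \<Sum>c\<in>C. \<Sum>a\<in>A. \<Sum>b\<in>B. f a b c e)" by (intro sum.cong refl sum.swap)
  also have "\<dots> = (\<Sum>e\<in>E. \<Sum>c\<in>C. \<Sum>b\<in>B. \<Sum>a\<in>A. f a b c e)" by (intro sum.cong refl sum.swap)
  finally show ?thesis .
qed

locale gaussian_blocks = gaussian_array M I Z
  for M :: "'w measure" and I and Z :: "nat \<times> nat \<Rightarrow> 'w \<Rightarrow> complex" +
  fixes d n m :: nat
  assumes I: "I = {..<d * n} \<times> {..<d * m}"
    and dims: "d \<ge> 1" "m \<ge> 1"
begin

abbreviation "K \<equiv> d * m"

abbreviation g :: "'w \<Rightarrow> nat \<Rightarrow> nat \<Rightarrow> nat \<Rightarrow> complex" where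
  "g \<omega> x a k \<equiv> Z (x * n + a, k) \<omega>"

abbreviation "P \<omega> \<equiv> gram_word d K (g \<omega>)"

abbreviation "W \<omega> \<equiv> gram K (g \<omega>)"

abbreviation "t \<omega> \<equiv> word_trace d K (g \<omega>)"

lemma index_in: "x < d \<Longrightarrow> a < n \<Longrightarrow> k < K \<Longrightarrow> (x * n + a, k) \<in> I"
proof -
  assume "x < d" "a < n" "k < K"
  then have "x * n + a < Suc x * n" "Suc x * n \<le> d * n" by (simp_all del: mult_Suc, simp)
  then have "x * n + a < d * n" by (rule less_le_trans)
  with \<open>k < K\<close> show ?thesis by (simp add: I)
qed

context
  fixes x0 a0 k0 :: nat
  assumes e0: "x0 < d" "a0 < n" "k0 < K"
begin

lemma wirtinger_entry:
  "x < d \<Longrightarrow> a < n \<Longrightarrow> k < K \<Longrightarrow> wirtinger (x0 * n + a0, k0) (\<lambda>\<omega>. g \<omega> x a k) (\<lambda>_. 0)"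
  by (intro wirtinger_var index_in)

lemma wirtinger_cnj_entry:
  assumes "z < d" "c < n" "k < K"
  shows "wirtinger (x0 * n + a0, k0) (\<lambda>\<omega>. cnj (g \<omega> z c k)) (\<lambda>_. if z = x0 \<and> c = a0 \<and> k = k0 then 1 else 0)"
proof -
  have "z * n + c = x0 * n + a0 \<longleftrightarrow> z = x0 \<and> c = a0"
  proof
    assume eq: "z * n + c = x0 * n + a0"
    then have "(z * n + c) div n = (x0 * n + a0) div n" "(z * n + c) mod n = (x0 * n + a0) mod n" by simp_all
    then show "z = x0 \<and> c = a0" using assms e0 by simp
  qed simp
  then show ?thesis
    by (intro wirtinger_cong[OF wirtinger_cnj[OF index_in[OF assms]]]) (auto simp: fun_eq_iff)
qed

lemma wirtinger_gram:
  assumes "x < d" "z < d" "a < n" "c < n"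
  shows "wirtinger (x0 * n + a0, k0) (\<lambda>\<omega>. W \<omega> a c x z)
    (\<lambda>\<omega>. if z = x0 then (if c = a0 then g \<omega> x a k0 / of_nat K else 0) else 0)"
proof -
  have "wirtinger (x0 * n + a0, k0) (\<lambda>\<omega>. 1 / of_nat K * (\<Sum>k<K. g \<omega> x a k * cnj (g \<omega> z c k)))
    (\<lambda>\<omega>. 1 / of_nat K * (\<Sum>k<K. 0 * cnj (g \<omega> z c k) + g \<omega> x a k * (if z = x0 \<and> c = a0 \<and> k = k0 then 1 else 0)))"
    using assms by (intro wirtinger_cmult wirtinger_sum wirtinger_mult wirtinger_entry wirtinger_cnj_entry) auto
  moreover have "(\<Sum>k<K. 0 * cnj (g \<omega> z c k) + g \<omega> x a k * (if z = x0 \<and> c = a0 \<and> k = k0 then 1 else 0)) =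
     (if z = x0 \<and> c = a0 then g \<omega> x a k0 else 0)" for \<omega>
  proof -
    have "(\<Sum>k<K. 0 * cnj (g \<omega> z c k) + g \<omega> x a k * (if z = x0 \<and> c = a0 \<and> k = k0 then 1 else 0)) =
      (\<Sum>k<K. if k = k0 then (if z = x0 \<and> c = a0 then g \<omega> x a k0 else 0) else 0)"
      by (intro sum.cong) auto
    then show ?thesis using e0 by simp
  qed
  ultimately show ?thesis
    by (elim wirtinger_cong) (auto simp: gram_def fun_eq_iff)
qed

text \<open>Product rule: the letter (a, c) contains the conjugate of the entry (x0, a0, k0) only
  for \<open>c = a0\<close>. Differentiating it breaks the word into the part before, a bare
  Gaussian entry, and the part after, which now starts in row \<open>x0\<close>.\<close>

definition word_deriv :: "(nat \<times> nat) list \<Rightarrow> nat \<Rightarrow> nat \<Rightarrow> 'w \<Rightarrow> complex" where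
  "word_deriv w x y \<omega> = (\<Sum>j<length w. if snd (w ! j) = a0 then
     (\<Sum>z<d. P \<omega> (take j w) x z * g \<omega> z (fst (w ! j)) k0) / of_nat K * P \<omega> (drop (Suc j) w) x0 y else 0)"

lemma wirtinger_word:
  assumes "set w \<subseteq> {..<n} \<times> {..<n}" "x < d" "y < d"
  shows "wirtinger (x0 * n + a0, k0) (\<lambda>\<omega>. P \<omega> w x y) (word_deriv w x y)"
  using assms
proof (induction w arbitrary: x)
  case Nil
  then show ?case by (simp add: wirtinger_const word_deriv_def[abs_def])
next
  case (Cons l w)
  obtain a c where l: "l = (a, c)" by (cases l)
  have ac: "a < n" "c < n" using Cons.prems l by auto
  have "wirtinger (x0 * n + a0, k0) (\<lambda>\<omega>. \<Sum>z<d. W \<omega> a c x z * P \<omega> w z y)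
    (\<lambda>\<omega>. \<Sum>z<d. (if z = x0 then (if c = a0 then g \<omega> x a k0 / of_nat K else 0) else 0) * P \<omega> w z y
      + W \<omega> a c x z * word_deriv w z y \<omega>)"
    using Cons.prems ac by (intro wirtinger_sum wirtinger_mult wirtinger_gram Cons.IH) auto
  moreover have "(\<Sum>z<d. (if z = x0 then (if c = a0 then g \<omega> x a k0 / of_nat K else 0) else 0) * P \<omega> w z y
      + W \<omega> a c x z * word_deriv w z y \<omega>) = word_deriv (l # w) x y \<omega>" for \<omega>
  proof -
    have delta: "(\<Sum>z<d. P \<omega> [] x z * g \<omega> z a k0) = g \<omega> x a k0"
    proof -
      have "(\<Sum>z<d. P \<omega> [] x z * g \<omega> z a k0) = (\<Sum>z<d. if x = z then g \<omega> x a k0 else 0)"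
        by (intro sum.cong) auto
      then show ?thesis using Cons.prems by simp
    qed
    have "(\<Sum>z<d. (if z = x0 then (if c = a0 then g \<omega> x a k0 / of_nat K else 0) else 0) * P \<omega> w z y)
        = (\<Sum>z<d. if z = x0 then (if c = a0 then g \<omega> x a k0 / of_nat K * P \<omega> w x0 y else 0) else 0)"
      by (intro sum.cong) auto
    also have "\<dots> = (if c = a0 then g \<omega> x a k0 / of_nat K * P \<omega> w x0 y else 0)"
      using e0 by simp
    finally have 1: "(\<Sum>z<d. (if z = x0 then (if c = a0 then g \<omega> x a k0 / of_nat K else 0) else 0) * P \<omega> w z y)
      = (if c = a0 then (\<Sum>z<d. P \<omega> [] x z * g \<omega> z a k0) / of_nat K * P \<omega> w x0 y else 0)"
      unfolding delta .
    have 2: "(\<Sum>z<d. W \<omega> a c x z * word_deriv w z y \<omega>) = (\<Sum>j<length w. if snd (w ! j) = a0 then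
       (\<Sum>z<d. P \<omega> (l # take j w) x z * g \<omega> z (fst (w ! j)) k0) / of_nat K * P \<omega> (drop (Suc j) w) x0 y else 0)"
    proof -
      have "(\<Sum>z<d. W \<omega> a c x z * word_deriv w z y \<omega>) = (\<Sum>j<length w. \<Sum>z<d. W \<omega> a c x z *
         (if snd (w ! j) = a0 then (\<Sum>z'<d. P \<omega> (take j w) z z' * g \<omega> z' (fst (w ! j)) k0) / of_nat K
            * P \<omega> (drop (Suc j) w) x0 y else 0))"
        unfolding word_deriv_def sum_distrib_left by (rule sum.swap)
      also have "\<dots> = (\<Sum>j<length w. if snd (w ! j) = a0 then
         (\<Sum>z<d. P \<omega> (l # take j w) x z * g \<omega> z (fst (w ! j)) k0) / of_nat K * P \<omega> (drop (Suc j) w) x0 y else 0)"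
      proof (intro sum.cong refl)
        fix j
        have "(\<Sum>z<d. W \<omega> a c x z * (\<Sum>z'<d. P \<omega> (take j w) z z' * g \<omega> z' (fst (w ! j)) k0)) =
          (\<Sum>z'<d. P \<omega> (l # take j w) x z' * g \<omega> z' (fst (w ! j)) k0)"
          by (simp add: l sum_distrib_left sum_distrib_right mult.assoc) (rule sum.swap)
        then show "(\<Sum>z<d. W \<omega> a c x z * (if snd (w ! j) = a0 then (\<Sum>z'<d. P \<omega> (take j w) z z' *
              g \<omega> z' (fst (w ! j)) k0) / of_nat K * P \<omega> (drop (Suc j) w) x0 y else 0)) =
            (if snd (w ! j) = a0 then (\<Sum>z<d. P \<omega> (l # take j w) x z * g \<omega> z (fst (w ! j)) k0) / of_nat K *
              P \<omega> (drop (Suc j) w) x0 y else 0)"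
          by (cases "snd (w ! j) = a0") (simp_all flip: sum_distrib_right sum_divide_distrib mult.assoc)
      qed
      finally show ?thesis .
    qed
    show ?thesis
      unfolding sum.distrib 1 2 word_deriv_def[of "l # w"] length_Cons sum.lessThan_Suc_shift
      by (simp add: l cong: if_cong)
  qed
  ultimately show ?case
    by (elim wirtinger_cong) (simp_all add: l fun_eq_iff)
qed

text \<open>As in \<open>word_deriv\<close>, with the two parts joined cyclically by the
  trace.\<close>

definition trace_deriv :: "(nat \<times> nat) list \<Rightarrow> 'w \<Rightarrow> complex" where
  "trace_deriv w \<omega> = (\<Sum>j<length w. if snd (w ! j) = a0 then
     (\<Sum>z<d. P \<omega> (drop (Suc j) w @ take j w) x0 z * g \<omega> z (fst (w ! j)) k0) / of_nat (d * K) else 0)"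

lemma wirtinger_trace:
  assumes "set w \<subseteq> {..<n} \<times> {..<n}"
  shows "wirtinger (x0 * n + a0, k0) (\<lambda>\<omega>. t \<omega> w) (trace_deriv w)"
proof -
  have "wirtinger (x0 * n + a0, k0) (\<lambda>\<omega>. 1 / of_nat d * (\<Sum>x<d. P \<omega> w x x))
      (\<lambda>\<omega>. 1 / of_nat d * (\<Sum>x<d. word_deriv w x x \<omega>))"
    using assms by (intro wirtinger_cmult wirtinger_sum wirtinger_word) auto
  moreover have "1 / of_nat d * (\<Sum>x<d. word_deriv w x x \<omega>) = trace_deriv w \<omega>" for \<omega>
  proof -
    have "(\<Sum>x<d. word_deriv w x x \<omega>) = (\<Sum>j<length w. \<Sum>x<d. if snd (w ! j) = a0 then
     (\<Sum>z<d. P \<omega> (take j w) x z * g \<omega> z (fst (w ! j)) k0) / of_nat K * P \<omega> (drop (Suc j) w) x0 x else 0)"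
      unfolding word_deriv_def by (rule sum.swap)
    also have "\<dots> = (\<Sum>j<length w. of_nat d * (if snd (w ! j) = a0 then
     (\<Sum>z<d. P \<omega> (drop (Suc j) w @ take j w) x0 z * g \<omega> z (fst (w ! j)) k0) / of_nat (d * K) else 0))"
    proof (intro sum.cong refl)
      fix j
      have "(\<Sum>x<d. (\<Sum>z<d. P \<omega> (take j w) x z * g \<omega> z (fst (w ! j)) k0) * P \<omega> (drop (Suc j) w) x0 x)
        = (\<Sum>z<d. P \<omega> (drop (Suc j) w @ take j w) x0 z * g \<omega> z (fst (w ! j)) k0)"
        unfolding gram_word_append[OF e0(1)] sum_distrib_right
        by (subst sum.swap) (simp add: mult_ac)
      then show "(\<Sum>x<d. if snd (w ! j) = a0 then (\<Sum>z<d. P \<omega> (take j w) x z * g \<omega> z (fst (w ! j)) k0) /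
            of_nat K * P \<omega> (drop (Suc j) w) x0 x else 0) =
          of_nat d * (if snd (w ! j) = a0 then
            (\<Sum>z<d. P \<omega> (drop (Suc j) w @ take j w) x0 z * g \<omega> z (fst (w ! j)) k0) / of_nat (d * K) else 0)"
        using dims by (cases "snd (w ! j) = a0") (simp_all flip: sum_divide_distrib)
    qed
    finally show ?thesis
      using dims by (simp add: trace_deriv_def flip: sum_distrib_left)
  qed
  ultimately show ?thesis
    by (elim wirtinger_cong) (simp_all add: word_trace_def fun_eq_iff)
qed

end

lemma traces_integrable:
  assumes "\<Union> (set ` set ws) \<subseteq> {..<n} \<times> {..<n}" "n \<ge> 1"
  shows "integrable M (\<lambda>\<omega>. \<Prod>w\<leftarrow>ws. t \<omega> w)"
proof -
  have e: "0 < d" "0 < n" "0 < K" using dims assms(2) by auto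
  have "wirtinger (0 * n + 0, 0) (\<lambda>\<omega>. \<Prod>w\<leftarrow>ws. t \<omega> w)
     (\<lambda>\<omega>. \<Sum>i<length ws. trace_deriv 0 0 0 (ws ! i) \<omega> * (\<Prod>w\<leftarrow>remove_nth i ws. t \<omega> w))"
    using e assms(1) nth_mem by (intro wirtinger_prod_list wirtinger_trace) blast+
  from wirtinger_by_parts[OF this index_in[OF e]] show ?thesis by blast
qed

text \<open>Summing over the position of the entry used for integration by parts fuses the two bare
  Gaussian factors into one letter; in the loop equation this merges two traces.\<close>

lemma sum_gram_word_rotate:
  "(\<Sum>x<d. \<Sum>k<K. \<Sum>z<d. cnj (g \<omega> z c k) * (P \<omega> u z x * (\<Sum>z'<d. P \<omega> v x z' * g \<omega> z' a k))) =
    of_nat (d * K) * t \<omega> ((a, c) # u @ v)"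
proof -
  have "of_nat (d * K) * t \<omega> ((a, c) # u @ v) = of_nat K * (\<Sum>z'<d. \<Sum>z<d. W \<omega> a c z' z * P \<omega> (u @ v) z z')"
    using dims by (simp add: word_trace_def)
  also have "\<dots> = (\<Sum>z'<d. \<Sum>z<d. (\<Sum>k<K. g \<omega> z' a k * cnj (g \<omega> z c k)) * P \<omega> (u @ v) z z')"
    using dims by (simp add: gram_def sum_distrib_left)
  also have "\<dots> = (\<Sum>z'<d. \<Sum>z<d. (\<Sum>k<K. g \<omega> z' a k * cnj (g \<omega> z c k)) * (\<Sum>x<d. P \<omega> u z x * P \<omega> v x z'))"
    by (intro sum.cong refl) (simp add: gram_word_append)
  also have "\<dots> = (\<Sum>z'<d. \<Sum>z<d. \<Sum>k<K. \<Sum>x<d. cnj (g \<omega> z c k) * (P \<omega> u z x * (P \<omega> v x z' * g \<omega> z' a k)))"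
    by (simp add: sum_product mult_ac)
  also have "\<dots> = (\<Sum>x<d. \<Sum>k<K. \<Sum>z<d. \<Sum>z'<d. cnj (g \<omega> z c k) * (P \<omega> u z x * (P \<omega> v x z' * g \<omega> z' a k)))"
    by (rule sum_reverse4)
  finally show ?thesis by (simp add: sum_distrib_left)
qed

text \<open>The counterpart for a derivative inside the same word: the letters between the two
  Gaussian factors close up to a trace of their own. It is the preceding resummation with an empty
  second word.\<close>

lemma sum_gram_word_cut:
  "(\<Sum>k<K. \<Sum>z<d. cnj (g \<omega> z c k) * (\<Sum>z'<d. P \<omega> u z z' * g \<omega> z' a k)) =
    of_nat (d * K) * t \<omega> ((a, c) # u)"
proof -
  have delta: "x < d \<Longrightarrow> (\<Sum>z'<d. P \<omega> [] x z' * f z') = f x" for x f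
  proof -
    assume "x < d"
    moreover have "(\<Sum>z'<d. P \<omega> [] x z' * f z') = (\<Sum>z'<d. if x = z' then f x else 0)"
      by (intro sum.cong) auto
    ultimately show ?thesis by simp
  qed
  have "(\<Sum>k<K. \<Sum>z<d. cnj (g \<omega> z c k) * (\<Sum>z'<d. P \<omega> u z z' * g \<omega> z' a k)) =
      (\<Sum>k<K. \<Sum>z<d. \<Sum>x<d. cnj (g \<omega> z c k) * (P \<omega> u z x * g \<omega> x a k))"
    by (simp add: sum_distrib_left)
  also have "\<dots> = (\<Sum>k<K. \<Sum>x<d. \<Sum>z<d. cnj (g \<omega> z c k) * (P \<omega> u z x * g \<omega> x a k))"
    by (intro sum.cong refl sum.swap)
  also have "\<dots> = (\<Sum>x<d. \<Sum>k<K. \<Sum>z<d. cnj (g \<omega> z c k) * (P \<omega> u z x * g \<omega> x a k))"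
    by (rule sum.swap)
  also have "\<dots> = (\<Sum>x<d. \<Sum>k<K. \<Sum>z<d. cnj (g \<omega> z c k) * (P \<omega> u z x * (\<Sum>z'<d. P \<omega> [] x z' * g \<omega> z' a k)))"
    by (intro sum.cong refl) (simp add: delta del: gram_word.simps)
  also have "\<dots> = of_nat (d * K) * t \<omega> ((a, c) # u)"
    unfolding sum_gram_word_rotate by simp
  finally show ?thesis .
qed

end

context gaussian_blocks
begin

definition trace_moment :: "(nat \<times> nat) list list \<Rightarrow> complex" where
  "trace_moment ws = expectation (\<lambda>\<omega>. \<Prod>w\<leftarrow>ws. t \<omega> w)"

lemma expectation_double_sum:
  fixes f :: "'i \<Rightarrow> 'j \<Rightarrow> 'w \<Rightarrow> complex"
  assumes "\<And>x k. x \<in> A \<Longrightarrow> k \<in> B x \<Longrightarrow> integrable M (f x k)"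
  shows "expectation (\<lambda>\<omega>. \<Sum>x\<in>A. \<Sum>k\<in>B x. f x k \<omega>) = (\<Sum>x\<in>A. \<Sum>k\<in>B x. expectation (f x k))"
proof -
  have "expectation (\<lambda>\<omega>. \<Sum>x\<in>A. \<Sum>k\<in>B x. f x k \<omega>) = (\<Sum>x\<in>A. expectation (\<lambda>\<omega>. \<Sum>k\<in>B x. f x k \<omega>))"
    using assms by (intro Bochner_Integration.integral_sum Bochner_Integration.integrable_sum)
  also have "\<dots> = (\<Sum>x\<in>A. \<Sum>k\<in>B x. expectation (f x k))"
    using assms by (intro sum.cong refl Bochner_Integration.integral_sum)
  finally show ?thesis .
qed

text \<open>One Gaussian factor of the first letter is taken out and integrated by parts. The
  derivative hits the conjugate factor of that letter, which needs \<open>a = c\<close>; or a letter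
  of \<open>r\<close>, cutting the trace in two; or a letter of another trace, merging the two. The
  weights 1, 1/m and 1/(d^2 m) count the free sums of size \<open>d\<close> and \<open>d * m\<close>
  that each case leaves.\<close>

theorem loop_equation:
  assumes r: "set r \<subseteq> {..<n} \<times> {..<n}" and ac: "a < n" "c < n"
    and ws: "\<Union> (set ` set ws) \<subseteq> {..<n} \<times> {..<n}"
  shows "trace_moment (((a, c) # r) # ws) =
    (if a = c then trace_moment (r # ws) else 0) +
    (\<Sum>j<length r. if snd (r ! j) = a then
       trace_moment (((fst (r ! j), c) # take j r) # drop (Suc j) r # ws) else 0) / of_nat m +
    (\<Sum>i<length ws. \<Sum>j<length (ws ! i). if snd (ws ! i ! j) = a then
       trace_moment (((fst (ws ! i ! j), c) # r @ drop (Suc j) (ws ! i) @ take j (ws ! i)) # remove_nth i ws)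
       else 0) / of_nat (d * d * m)"
proof -
  let ?Q = "\<lambda>\<omega>. \<Prod>w\<leftarrow>ws. t \<omega> w"
  let ?Qi = "\<lambda>i \<omega>. \<Prod>w\<leftarrow>remove_nth i ws. t \<omega> w"
  let ?F = "\<lambda>x k \<omega>. \<Sum>z<d. cnj (g \<omega> z c k) * (P \<omega> r z x * ?Q \<omega>)"
  let ?DQ = "\<lambda>x k \<omega>. \<Sum>i<length ws. trace_deriv x a k (ws ! i) \<omega> * ?Qi i \<omega>"
  \<comment> \<open>Derivative of \<open>?F\<close> in the conjugate of the entry taken out; the
    conjunct \<open>k = k\<close> is the instance of the condition \<open>k = k0\<close> in
    \<open>wirtinger_cnj_entry\<close>.\<close>
  let ?F' = "\<lambda>x k \<omega>. \<Sum>z<d. (if z = x \<and> c = a \<and> k = k then 1 else 0) * (P \<omega> r z x * ?Q \<omega>) +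
      cnj (g \<omega> z c k) * (word_deriv x a k r z x \<omega> * ?Q \<omega> + P \<omega> r z x * ?DQ x k \<omega>)"
  have n: "n \<ge> 1" using ac by simp
  have ws': "i < length ws \<Longrightarrow> set (ws ! i) \<subseteq> {..<n} \<times> {..<n}" for i
    using ws nth_mem by blast
  have wF: "wirtinger (x * n + a, k) (?F x k) (?F' x k)" if "x < d" "k < K" for x k
    using that ac r ws'
    by (intro wirtinger_sum wirtinger_mult wirtinger_cnj_entry wirtinger_word wirtinger_prod_list
        wirtinger_trace) auto
  let ?T1 = "\<lambda>\<omega>. if a = c then (\<Prod>w\<leftarrow>r # ws. t \<omega> w) else 0"
  let ?T2 = "\<lambda>\<omega>. \<Sum>j<length r. if snd (r ! j) = a then
       (\<Prod>w\<leftarrow>((fst (r ! j), c) # take j r) # drop (Suc j) r # ws. t \<omega> w) else 0"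
  let ?T3 = "\<lambda>\<omega>. \<Sum>i<length ws. \<Sum>j<length (ws ! i). if snd (ws ! i ! j) = a then
       (\<Prod>w\<leftarrow>((fst (ws ! i ! j), c) # r @ drop (Suc j) (ws ! i) @ take j (ws ! i)) # remove_nth i ws. t \<omega> w)
       else 0"
  have ifE: "expectation (\<lambda>\<omega>. if b then f \<omega> else 0) = (if b then expectation f else 0)" for b and f :: "'w \<Rightarrow> complex"
    by simp
  have ifI: "(b \<Longrightarrow> integrable M f) \<Longrightarrow> integrable M (\<lambda>\<omega>. if b then f \<omega> else 0)" for b and f :: "'w \<Rightarrow> complex"
    by (cases b) auto
  have I1: "integrable M ?T1"
    using r ws n by (intro ifI traces_integrable) auto
  have I2: "integrable M (\<lambda>\<omega>. if snd (r ! j) = a then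
     (\<Prod>w\<leftarrow>((fst (r ! j), c) # take j r) # drop (Suc j) r # ws. t \<omega> w) else 0)" if "j < length r" for j
  proof (intro ifI traces_integrable n)
    have "r ! j \<in> set r" using that by simp
    then show "\<Union> (set ` set (((fst (r ! j), c) # take j r) # drop (Suc j) r # ws)) \<subseteq> {..<n} \<times> {..<n}"
      using r ws ac set_take_subset[of j r] set_drop_subset[of "Suc j" r]
      by (auto simp: mem_Times_iff)
  qed
  have I3: "integrable M (\<lambda>\<omega>. if snd (ws ! i ! j) = a then
     (\<Prod>w\<leftarrow>((fst (ws ! i ! j), c) # r @ drop (Suc j) (ws ! i) @ take j (ws ! i)) # remove_nth i ws. t \<omega> w)
     else 0)" if "i < length ws" "j < length (ws ! i)" for i j
  proof (intro ifI traces_integrable n)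
    have "ws ! i ! j \<in> set (ws ! i)" using that by simp
    then have "set ((fst (ws ! i ! j), c) # r @ drop (Suc j) (ws ! i) @ take j (ws ! i)) \<subseteq> {..<n} \<times> {..<n}"
      using r ac ws'[OF that(1)] set_take_subset[of j "ws ! i"] set_drop_subset[of "Suc j" "ws ! i"]
      by (auto simp: mem_Times_iff)
    moreover have "\<Union> (set ` set (remove_nth i ws)) \<subseteq> {..<n} \<times> {..<n}"
      using ws set_remove_nth[of i ws] by blast
    ultimately show "\<Union> (set ` set (((fst (ws ! i ! j), c) # r @ drop (Suc j) (ws ! i) @ take j (ws ! i)) # remove_nth i ws)) \<subseteq> {..<n} \<times> {..<n}"
      unfolding list.set(2)[of _ "remove_nth i ws"] image_insert Union_insert by (rule Un_least)
  qed
  have I2': "integrable M ?T2" and I3': "integrable M ?T3"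
    by (intro Bochner_Integration.integrable_sum I2 I3; simp)+
  have t1: "expectation ?T1 = (if a = c then trace_moment (r # ws) else 0)" unfolding ifE trace_moment_def ..
  have t2: "expectation ?T2 = (\<Sum>j<length r. if snd (r ! j) = a then
     trace_moment (((fst (r ! j), c) # take j r) # drop (Suc j) r # ws) else 0)"
    using I2 by (subst Bochner_Integration.integral_sum) (simp_all only: ifE trace_moment_def lessThan_iff)
  have t3: "expectation ?T3 = (\<Sum>i<length ws. \<Sum>j<length (ws ! i). if snd (ws ! i ! j) = a then
     trace_moment (((fst (ws ! i ! j), c) # r @ drop (Suc j) (ws ! i) @ take j (ws ! i)) # remove_nth i ws)
     else 0)"
    
    by (subst expectation_double_sum) (use I3 in \<open>simp_all only: ifE trace_moment_def lessThan_iff\<close>)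
  have parts4: "integrable M (?F x k) \<and> integrable M (?F' x k) \<and>
      integrable M (\<lambda>\<omega>. g \<omega> x a k * ?F x k \<omega>) \<and>
      expectation (\<lambda>\<omega>. g \<omega> x a k * ?F x k \<omega>) = expectation (?F' x k)"
    if "x \<in> {..<d}" "k \<in> {..<K}" for x k
    by (rule wirtinger_by_parts[OF wF index_in]) (use that ac in simp_all)
  note int1 = parts4[THEN conjunct2, THEN conjunct2, THEN conjunct1]
    and int2 = parts4[THEN conjunct2, THEN conjunct1]
    and parts = parts4[THEN conjunct2, THEN conjunct2, THEN conjunct2]
  have "trace_moment (((a, c) # r) # ws) = expectation (\<lambda>\<omega>. (\<Sum>x<d. \<Sum>k<K. g \<omega> x a k * ?F x k \<omega>) / of_nat (d * K))"
    unfolding trace_moment_def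
  proof (intro Bochner_Integration.integral_cong refl)
    fix \<omega>
    have "(\<Sum>x<d. \<Sum>k<K. g \<omega> x a k * ?F x k \<omega>) = (\<Sum>x<d. \<Sum>k<K. \<Sum>z<d. g \<omega> x a k * (cnj (g \<omega> z c k) * (P \<omega> r z x * ?Q \<omega>)))"
      by (simp add: sum_distrib_left)
    also have "\<dots> = (\<Sum>x<d. \<Sum>z<d. \<Sum>k<K. g \<omega> x a k * (cnj (g \<omega> z c k) * (P \<omega> r z x * ?Q \<omega>)))"
      by (intro sum.cong refl sum.swap)
    also have "\<dots> = (\<Sum>x<d. \<Sum>z<d. (\<Sum>k<K. g \<omega> x a k * cnj (g \<omega> z c k)) * P \<omega> r z x) * ?Q \<omega>"
      by (simp add: sum_distrib_right mult.assoc)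
    also have "\<dots> = of_nat (d * K) * (\<Prod>w\<leftarrow>((a, c) # r) # ws. t \<omega> w)"
      using dims by (simp add: word_trace_def gram_def sum_divide_distrib[symmetric] times_divide_eq_left)
    finally show "(\<Prod>w\<leftarrow>((a, c) # r) # ws. t \<omega> w) = (\<Sum>x<d. \<Sum>k<K. g \<omega> x a k * ?F x k \<omega>) / of_nat (d * K)"
      using dims by simp
  qed
  also have "\<dots> = (\<Sum>x<d. \<Sum>k<K. expectation (\<lambda>\<omega>. g \<omega> x a k * ?F x k \<omega>)) / of_nat (d * K)"
    by (subst integral_divide_zero, subst expectation_double_sum[OF int1]) auto
  also have "\<dots> = (\<Sum>x<d. \<Sum>k<K. expectation (?F' x k)) / of_nat (d * K)"
    by (intro arg_cong2[of _ _ _ _ "(/)"] sum.cong refl parts)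
  also have "\<dots> = expectation (\<lambda>\<omega>. (\<Sum>x<d. \<Sum>k<K. ?F' x k \<omega>) / of_nat (d * K))"
    by (subst integral_divide_zero, subst expectation_double_sum[OF int2]) auto
  also have "(\<lambda>\<omega>. (\<Sum>x<d. \<Sum>k<K. ?F' x k \<omega>) / of_nat (d * K)) =
    (\<lambda>\<omega>. ?T1 \<omega> + ?T2 \<omega> / of_nat m + ?T3 \<omega> / of_nat (d * d * m))"
  proof
    fix \<omega>
    have T1: "(\<Sum>x<d. \<Sum>k<K. \<Sum>z<d. (if z = x \<and> c = a \<and> k = k then 1 else 0) * (P \<omega> r z x * ?Q \<omega>)) = of_nat (d * K) * ?T1 \<omega>"
    proof -
      have "(\<Sum>z<d. (if z = x \<and> c = a \<and> k = k then 1 else 0) * (P \<omega> r z x * ?Q \<omega>)) =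
          (if a = c then P \<omega> r x x * ?Q \<omega> else 0)" if "x < d" for x k
      proof -
        have "(\<Sum>z<d. (if z = x \<and> c = a \<and> k = k then 1 else 0) * (P \<omega> r z x * ?Q \<omega>)) =
          (\<Sum>z<d. if z = x then (if a = c then P \<omega> r x x * ?Q \<omega> else 0) else 0)"
          by (intro sum.cong) auto
        then show ?thesis using that by simp
      qed
      then have "(\<Sum>x<d. \<Sum>k<K. \<Sum>z<d. (if z = x \<and> c = a \<and> k = k then 1 else 0) * (P \<omega> r z x * ?Q \<omega>)) =
        (\<Sum>x<d. of_nat K * (if a = c then P \<omega> r x x * ?Q \<omega> else 0))"
        by simp
      also have "\<dots> = of_nat K * (if a = c then (\<Sum>x<d. P \<omega> r x x) * ?Q \<omega> else 0)"
        by (simp add: sum_distrib_left sum_distrib_right)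
      also have "(\<Sum>x<d. P \<omega> r x x) = of_nat d * t \<omega> r"
        using dims by (simp add: word_trace_def)
      finally show ?thesis by simp
    qed
    have T2: "(\<Sum>x<d. \<Sum>k<K. \<Sum>z<d. cnj (g \<omega> z c k) * (word_deriv x a k r z x \<omega> * ?Q \<omega>)) = of_nat (d * d) * ?T2 \<omega>"
    proof -
      let ?B = "\<lambda>j x k z. cnj (g \<omega> z c k) * ((\<Sum>z'<d. P \<omega> (take j r) z z' * g \<omega> z' (fst (r ! j)) k)
           / of_nat K * P \<omega> (drop (Suc j) r) x x * ?Q \<omega>)"
      have "(\<Sum>x<d. \<Sum>k<K. \<Sum>z<d. cnj (g \<omega> z c k) * (word_deriv x a k r z x \<omega> * ?Q \<omega>)) =
        (\<Sum>x<d. \<Sum>k<K. \<Sum>z<d. \<Sum>j<length r. if snd (r ! j) = a then ?B j x k z else 0)"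
      proof (intro sum.cong refl)
        fix x k z assume "x \<in> {..<d}" "k \<in> {..<K}"
        then have "cnj (g \<omega> z c k) * (word_deriv x a k r z x \<omega> * ?Q \<omega>) = (\<Sum>j<length r. cnj (g \<omega> z c k) *
            ((if snd (r ! j) = a then (\<Sum>z'<d. P \<omega> (take j r) z z' * g \<omega> z' (fst (r ! j)) k)
             / of_nat K * P \<omega> (drop (Suc j) r) x x else 0) * ?Q \<omega>))"
          using ac by (simp only: word_deriv_def lessThan_iff sum_distrib_left[of "cnj _"]
              sum_distrib_right[of _ _ "?Q \<omega>"])
        also have "\<dots> = (\<Sum>j<length r. if snd (r ! j) = a then ?B j x k z else 0)"
          by (intro sum.cong refl) auto
        finally show "cnj (g \<omega> z c k) * (word_deriv x a k r z x \<omega> * ?Q \<omega>) =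
            (\<Sum>j<length r. if snd (r ! j) = a then ?B j x k z else 0)" .
      qed
      also have "\<dots> = (\<Sum>j<length r. \<Sum>z<d. \<Sum>k<K. \<Sum>x<d. if snd (r ! j) = a then ?B j x k z else 0)"
        by (rule sum_reverse4)
      also have "\<dots> = (\<Sum>j<length r. of_nat (d * d) * (if snd (r ! j) = a then
          t \<omega> ((fst (r ! j), c) # take j r) * t \<omega> (drop (Suc j) r) * ?Q \<omega> else 0))"
      proof (intro sum.cong refl)
        fix j
        have "(\<Sum>z<d. \<Sum>k<K. \<Sum>x<d. ?B j x k z) = (\<Sum>k<K. \<Sum>z<d. \<Sum>x<d. ?B j x k z)"
          by (rule sum.swap)
        also have "\<dots> = (\<Sum>k<K. \<Sum>z<d. cnj (g \<omega> z c k) * (\<Sum>z'<d. P \<omega> (take j r) z z' * g \<omega> z' (fst (r ! j)) k))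
            * ((\<Sum>x<d. P \<omega> (drop (Suc j) r) x x) * ?Q \<omega> / of_nat K)"
          by (simp add: sum_distrib_left[symmetric] sum_distrib_right[symmetric] sum_divide_distrib[symmetric]
              flip: mult.assoc times_divide_eq_right)
        also have "\<dots> = of_nat (d * d) * (t \<omega> ((fst (r ! j), c) # take j r) * t \<omega> (drop (Suc j) r) * ?Q \<omega>)"
          unfolding sum_gram_word_cut using dims by (simp add: word_trace_def)
        finally show "(\<Sum>z<d. \<Sum>k<K. \<Sum>x<d. if snd (r ! j) = a then ?B j x k z else 0) =
          of_nat (d * d) * (if snd (r ! j) = a then
          t \<omega> ((fst (r ! j), c) # take j r) * t \<omega> (drop (Suc j) r) * ?Q \<omega> else 0)"
          by (cases "snd (r ! j) = a") simp_all
      qed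
      finally show ?thesis
        by (simp add: mult.assoc cong: if_cong flip: sum_distrib_left)
    qed
    have T3: "(\<Sum>x<d. \<Sum>k<K. \<Sum>z<d. cnj (g \<omega> z c k) * (P \<omega> r z x * ?DQ x k \<omega>)) = ?T3 \<omega>"
    proof -
      let ?v = "\<lambda>i j. drop (Suc j) (ws ! i) @ take j (ws ! i)"
      let ?S = "\<lambda>i j x k. (\<Sum>z'<d. P \<omega> (?v i j) x z' * g \<omega> z' (fst (ws ! i ! j)) k)"
      let ?B = "\<lambda>i j x k z. cnj (g \<omega> z c k) * (P \<omega> r z x * ?S i j x k) * (?Qi i \<omega> / of_nat (d * K))"
      have "(\<Sum>x<d. \<Sum>k<K. \<Sum>z<d. cnj (g \<omega> z c k) * (P \<omega> r z x * ?DQ x k \<omega>)) =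
        (\<Sum>x<d. \<Sum>k<K. \<Sum>z<d. \<Sum>i<length ws. \<Sum>j<length (ws ! i). if snd (ws ! i ! j) = a then ?B i j x k z else 0)"
      proof (intro sum.cong refl)
        fix x k z assume "x \<in> {..<d}" "k \<in> {..<K}"
        then have "?DQ x k \<omega> = (\<Sum>i<length ws. \<Sum>j<length (ws ! i).
            (if snd (ws ! i ! j) = a then ?S i j x k / of_nat (d * K) else 0) * ?Qi i \<omega>)"
          using ac by (simp only: trace_deriv_def lessThan_iff sum_distrib_right[of _ _ "?Qi _ \<omega>"])
        then have "cnj (g \<omega> z c k) * (P \<omega> r z x * ?DQ x k \<omega>) = (\<Sum>i<length ws. \<Sum>j<length (ws ! i).
            cnj (g \<omega> z c k) * (P \<omega> r z x * ((if snd (ws ! i ! j) = a then ?S i j x k / of_nat (d * K) else 0) * ?Qi i \<omega>)))"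
          by (simp only: sum_distrib_left[of "cnj _"] sum_distrib_left[of "P \<omega> r z x"])
        also have "\<dots> = (\<Sum>i<length ws. \<Sum>j<length (ws ! i). if snd (ws ! i ! j) = a then ?B i j x k z else 0)"
          by (intro sum.cong refl) auto
        finally show "cnj (g \<omega> z c k) * (P \<omega> r z x * ?DQ x k \<omega>) =
            (\<Sum>i<length ws. \<Sum>j<length (ws ! i). if snd (ws ! i ! j) = a then ?B i j x k z else 0)" .
      qed
      also have "\<dots> = (\<Sum>i<length ws. \<Sum>z<d. \<Sum>k<K. \<Sum>x<d. \<Sum>j<length (ws ! i). if snd (ws ! i ! j) = a then ?B i j x k z else 0)"
        by (rule sum_reverse4)
      also have "\<dots> = (\<Sum>i<length ws. \<Sum>j<length (ws ! i). \<Sum>x<d. \<Sum>k<K. \<Sum>z<d. if snd (ws ! i ! j) = a then ?B i j x k z else 0)"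
        by (intro sum.cong refl sum_reverse4)
      also have "\<dots> = (\<Sum>i<length ws. \<Sum>j<length (ws ! i). if snd (ws ! i ! j) = a then
          t \<omega> ((fst (ws ! i ! j), c) # r @ ?v i j) * ?Qi i \<omega> else 0)"
      proof (intro sum.cong refl)
        fix i j
        have "(\<Sum>x<d. \<Sum>k<K. \<Sum>z<d. ?B i j x k z) = (\<Sum>x<d. \<Sum>k<K. \<Sum>z<d. cnj (g \<omega> z c k) * (P \<omega> r z x * ?S i j x k))
            * (?Qi i \<omega> / of_nat (d * K))"
          by (simp only: sum_distrib_right)
        also have "\<dots> = t \<omega> ((fst (ws ! i ! j), c) # r @ ?v i j) * ?Qi i \<omega>"
          unfolding sum_gram_word_rotate using dims by simp
        finally show "(\<Sum>x<d. \<Sum>k<K. \<Sum>z<d. if snd (ws ! i ! j) = a then ?B i j x k z else 0) =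
          (if snd (ws ! i ! j) = a then t \<omega> ((fst (ws ! i ! j), c) # r @ ?v i j) * ?Qi i \<omega> else 0)"
          by (cases "snd (ws ! i ! j) = a") simp_all
      qed
      finally show ?thesis by (simp cong: if_cong)
    qed
    have "(\<Sum>x<d. \<Sum>k<K. ?F' x k \<omega>) =
      (\<Sum>x<d. \<Sum>k<K. \<Sum>z<d. (if z = x \<and> c = a \<and> k = k then 1 else 0) * (P \<omega> r z x * ?Q \<omega>)) +
      ((\<Sum>x<d. \<Sum>k<K. \<Sum>z<d. cnj (g \<omega> z c k) * (word_deriv x a k r z x \<omega> * ?Q \<omega>)) +
      (\<Sum>x<d. \<Sum>k<K. \<Sum>z<d. cnj (g \<omega> z c k) * (P \<omega> r z x * ?DQ x k \<omega>)))"
      by (simp only: distrib_left sum.distrib)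
    also have "\<dots> = of_nat (d * K) * ?T1 \<omega> + (of_nat (d * d) * ?T2 \<omega> + ?T3 \<omega>)"
      by (simp only: T1 T2 T3)
    finally have S: "(\<Sum>x<d. \<Sum>k<K. ?F' x k \<omega>) =
      of_nat (d * K) * ?T1 \<omega> + (of_nat (d * d) * ?T2 \<omega> + ?T3 \<omega>)" .
    have div: "(of_nat (d * K) * u + (of_nat (d * d) * v + w)) / of_nat (d * K) =
        u + v / of_nat m + w / of_nat (d * d * m)" for u v w :: complex
      using dims by (simp add: add_divide_distrib)
    show "(\<Sum>x<d. \<Sum>k<K. ?F' x k \<omega>) / of_nat (d * K) =
        ?T1 \<omega> + ?T2 \<omega> / of_nat m + ?T3 \<omega> / of_nat (d * d * m)"
      unfolding S by (rule div)
  qed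
  also have "expectation (\<lambda>\<omega>. ?T1 \<omega> + ?T2 \<omega> / of_nat m + ?T3 \<omega> / of_nat (d * d * m)) =
    expectation ?T1 + expectation ?T2 / of_nat m + expectation ?T3 / of_nat (d * d * m)"
    using I1 I2' I3' by simp
  finally show ?thesis unfolding t1 t2 t3 .
qed

end

section \<open>The limit of the loop equations\<close>

text \<open>The loop equation for one trace, with the merging term dropped and the expectation of
  two traces replaced by a product.\<close>

function limit_word :: "nat \<Rightarrow> (nat \<times> nat) list \<Rightarrow> complex" where
  "limit_word m [] = 1"
| "limit_word m ((a, c) # r) = (if a = c then limit_word m r else 0) +
     (\<Sum>j<length r. if snd (r ! j) = a then
        limit_word m ((fst (r ! j), c) # take j r) * limit_word m (drop (Suc j) r) else 0) / of_nat m"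
  by pat_completeness auto
termination
  by (relation "Wellfounded.measure (\<lambda>(_, w). length w)") auto

declare limit_word.simps(2) [simp del]

lemma tendsto_divide_square:
  assumes "f \<longlonglongrightarrow> (l :: complex)"
  shows "(\<lambda>d. f d / of_nat (d * d * m)) \<longlonglongrightarrow> 0"
proof -
  have "(\<lambda>d. f d * inverse (of_nat d) * inverse (of_nat d) * inverse (of_nat m)) \<longlonglongrightarrow> l * 0 * 0 * inverse (of_nat m)"
    by (intro tendsto_mult assms lim_inverse_n tendsto_const)
  then show ?thesis by (simp add: divide_inverse mult.assoc)
qed

text \<open>Products of any number of traces are treated at once, because the cut produces them. The
  merging terms converge by induction, so their prefactor 1/(d^2 m) sends them to 0; this is the
  asymptotic factorisation of traces.\<close>

lemma loop_equation_limit: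
  fixes E :: "nat \<Rightarrow> (nat \<times> nat) list list \<Rightarrow> complex"
  assumes nil: "\<And>d. d \<ge> 1 \<Longrightarrow> E d [] = 1"
    and nil_word: "\<And>d ws. d \<ge> 1 \<Longrightarrow> E d ([] # ws) = E d ws"
    and loop: "\<And>d a c r ws. d \<ge> 1 \<Longrightarrow> set r \<subseteq> {..<n} \<times> {..<n} \<Longrightarrow> a < n \<Longrightarrow> c < n \<Longrightarrow>
      \<Union> (set ` set ws) \<subseteq> {..<n} \<times> {..<n} \<Longrightarrow>
      E d (((a, c) # r) # ws) = (if a = c then E d (r # ws) else 0) +
        (\<Sum>j<length r. if snd (r ! j) = a then
          E d (((fst (r ! j), c) # take j r) # drop (Suc j) r # ws) else 0) / of_nat m +
        (\<Sum>i<length ws. \<Sum>j<length (ws ! i). if snd (ws ! i ! j) = a then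
          E d (((fst (ws ! i ! j), c) # r @ drop (Suc j) (ws ! i) @ take j (ws ! i)) # remove_nth i ws)
          else 0) / of_nat (d * d * m)"
    and "\<Union> (set ` set ws) \<subseteq> {..<n} \<times> {..<n}"
  shows "(\<lambda>d. E d ws) \<longlonglongrightarrow> (\<Prod>w\<leftarrow>ws. limit_word m w)"
  using assms(4)
\<comment> \<open>Letters count twice: every term of the loop equation loses a letter, but cutting a
  trace adds a word. Counting words as well lets the removal of an empty word decrease the
  measure.\<close>
proof (induction "2 * sum_list (map length ws) + length ws" arbitrary: ws rule: less_induct)
  case less
  show ?case
  proof (cases ws)
    case Nil
    have "\<forall>\<^sub>F d in sequentially. 1 = E d ws"
      using eventually_ge_at_top[of 1] by eventually_elim (simp add: Nil nil)
    then show ?thesis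
      using Nil by (intro tendsto_eventually) (auto elim: eventually_mono)
  next
    case (Cons w ws')
    show ?thesis
    proof (cases w)
      case w: Nil
      have "(\<lambda>d. E d ws') \<longlonglongrightarrow> (\<Prod>w\<leftarrow>ws'. limit_word m w)"
        using less.prems Cons by (intro less.hyps) auto
      moreover have "\<forall>\<^sub>F d in sequentially. E d ws' = E d ws"
        using eventually_ge_at_top[of 1] by eventually_elim (simp add: Cons w nil_word)
      ultimately show ?thesis
        by (simp add: Cons w Lim_transform_eventually)
    next
      case w: (Cons l r)
      obtain a c where l: "l = (a, c)" by (cases l)
      have sub: "set r \<subseteq> {..<n} \<times> {..<n}" "a < n" "c < n" "\<Union> (set ` set ws') \<subseteq> {..<n} \<times> {..<n}"
        using less.prems by (auto simp: Cons w l)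
      let ?R = "\<lambda>d. (if a = c then E d (r # ws') else 0) +
        (\<Sum>j<length r. if snd (r ! j) = a then
          E d (((fst (r ! j), c) # take j r) # drop (Suc j) r # ws') else 0) / of_nat m +
        (\<Sum>i<length ws'. \<Sum>j<length (ws' ! i). if snd (ws' ! i ! j) = a then
          E d (((fst (ws' ! i ! j), c) # r @ drop (Suc j) (ws' ! i) @ take j (ws' ! i)) # remove_nth i ws')
          else 0) / of_nat (d * d * m)"
      let ?P = "\<Prod>w\<leftarrow>ws'. limit_word m w"
      have t1: "(\<lambda>d. if a = c then E d (r # ws') else 0) \<longlonglongrightarrow> (if a = c then limit_word m r * ?P else 0)"
        using less.hyps[of "r # ws'"] sub by (auto simp: Cons w)
      have t2: "(\<lambda>d. if snd (r ! j) = a then E d (((fst (r ! j), c) # take j r) # drop (Suc j) r # ws') else 0)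
        \<longlonglongrightarrow> (if snd (r ! j) = a then limit_word m ((fst (r ! j), c) # take j r) * limit_word m (drop (Suc j) r) * ?P else 0)"
        if j: "j < length r" for j
      proof -
        have "r ! j \<in> set r" using j by simp
        then have "\<Union> (set ` set (((fst (r ! j), c) # take j r) # drop (Suc j) r # ws')) \<subseteq> {..<n} \<times> {..<n}"
          using sub set_take_subset[of j r] set_drop_subset[of "Suc j" r] by (auto simp: mem_Times_iff)
        then have "(\<lambda>d. E d (((fst (r ! j), c) # take j r) # drop (Suc j) r # ws')) \<longlonglongrightarrow>
            (\<Prod>w\<leftarrow>((fst (r ! j), c) # take j r) # drop (Suc j) r # ws'. limit_word m w)"
          using j by (intro less.hyps) (auto simp: Cons w)
        then show ?thesis by (auto simp: mult.assoc)
      qed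
      have t3: "(\<lambda>d. if snd (ws' ! i ! j) = a then
          E d (((fst (ws' ! i ! j), c) # r @ drop (Suc j) (ws' ! i) @ take j (ws' ! i)) # remove_nth i ws') else 0)
        \<longlonglongrightarrow> (if snd (ws' ! i ! j) = a then
          (\<Prod>w\<leftarrow>((fst (ws' ! i ! j), c) # r @ drop (Suc j) (ws' ! i) @ take j (ws' ! i)) # remove_nth i ws'. limit_word m w) else 0)"
        if i: "i < length ws'" and j: "j < length (ws' ! i)" for i j
      proof -
        let ?v = "(fst (ws' ! i ! j), c) # r @ drop (Suc j) (ws' ! i) @ take j (ws' ! i)"
        have wi: "set (ws' ! i) \<subseteq> {..<n} \<times> {..<n}" using sub i nth_mem by blast
        have "ws' ! i ! j \<in> set (ws' ! i)" using j by simp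
        then have "set ?v \<subseteq> {..<n} \<times> {..<n}"
          using sub wi set_take_subset[of j "ws' ! i"] set_drop_subset[of "Suc j" "ws' ! i"]
          by (auto simp: mem_Times_iff)
        moreover have "\<Union> (set ` set (remove_nth i ws')) \<subseteq> {..<n} \<times> {..<n}"
          using sub set_remove_nth[of i ws'] by blast
        ultimately have "\<Union> (set ` set (?v # remove_nth i ws')) \<subseteq> {..<n} \<times> {..<n}"
          unfolding list.set(2)[of _ "remove_nth i ws'"] image_insert Union_insert by (rule Un_least)
        moreover have "sum_list (map length ws') = sum_list (map length (remove_nth i ws')) + length (ws' ! i)"
        proof -
          have "map length ws' = map length (take i ws' @ ws' ! i # drop (Suc i) ws')"
            using id_take_nth_drop[OF i] by simp
          then show ?thesis by (simp add: remove_nth_def)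
        qed
        ultimately have "(\<lambda>d. E d (?v # remove_nth i ws')) \<longlonglongrightarrow> (\<Prod>w\<leftarrow>?v # remove_nth i ws'. limit_word m w)"
          using i j by (intro less.hyps) (simp_all add: Cons w remove_nth_def)
        then show ?thesis by auto
      qed
      have "?R \<longlonglongrightarrow> (if a = c then limit_word m r * ?P else 0) +
        (\<Sum>j<length r. if snd (r ! j) = a then
          limit_word m ((fst (r ! j), c) # take j r) * limit_word m (drop (Suc j) r) * ?P else 0) / of_nat m + 0"
      proof (intro tendsto_add t1)
        show "(\<lambda>d. (\<Sum>j<length r. if snd (r ! j) = a then
            E d (((fst (r ! j), c) # take j r) # drop (Suc j) r # ws') else 0) / of_nat m) \<longlonglongrightarrow>
          (\<Sum>j<length r. if snd (r ! j) = a then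
            limit_word m ((fst (r ! j), c) # take j r) * limit_word m (drop (Suc j) r) * ?P else 0) / of_nat m"
          unfolding divide_inverse by (rule tendsto_mult_right[OF tendsto_sum[OF t2]]) simp
        show "(\<lambda>d. (\<Sum>i<length ws'. \<Sum>j<length (ws' ! i). if snd (ws' ! i ! j) = a then
          E d (((fst (ws' ! i ! j), c) # r @ drop (Suc j) (ws' ! i) @ take j (ws' ! i)) # remove_nth i ws')
          else 0) / of_nat (d * d * m)) \<longlonglongrightarrow> 0"
          by (rule tendsto_divide_square[OF tendsto_sum[OF tendsto_sum[OF t3]]]) simp_all
      qed
      also have "(if a = c then limit_word m r * ?P else 0) +
        (\<Sum>j<length r. if snd (r ! j) = a then
          limit_word m ((fst (r ! j), c) # take j r) * limit_word m (drop (Suc j) r) * ?P else 0) / of_nat m + 0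
        = (\<Prod>w\<leftarrow>ws. limit_word m w)"
      proof -
        have "(\<Sum>j<length r. if snd (r ! j) = a then
          limit_word m ((fst (r ! j), c) # take j r) * limit_word m (drop (Suc j) r) * ?P else 0) =
          (\<Sum>j<length r. if snd (r ! j) = a then
          limit_word m ((fst (r ! j), c) # take j r) * limit_word m (drop (Suc j) r) else 0) * ?P"
          unfolding sum_distrib_right by (intro sum.cong) auto
        then show ?thesis
          by (simp add: Cons w l limit_word.simps(2)[of m a c r] distrib_right)
      qed
      finally have "?R \<longlonglongrightarrow> (\<Prod>w\<leftarrow>ws. limit_word m w)" .
      moreover have "\<forall>\<^sub>F d in sequentially. ?R d = E d ws"
        using eventually_ge_at_top[of 1]
      proof eventually_elim
        case (elim d)
        show ?case unfolding Cons w l using loop[OF elim sub] by (rule sym)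
      qed
      ultimately show ?thesis by (rule Lim_transform_eventually)
    qed
  qed
qed

section \<open>Sums over all words of a given length\<close>

fun word_total :: "nat \<Rightarrow> nat \<Rightarrow> ((nat \<times> nat) list \<Rightarrow> complex) \<Rightarrow> complex" where
  "word_total n 0 f = f []"
| "word_total n (Suc p) f = (\<Sum>a<n. \<Sum>c<n. word_total n p (\<lambda>w. f ((a, c) # w)))"

lemma word_total_cong:
  assumes "\<And>w. set w \<subseteq> {..<n} \<times> {..<n} \<Longrightarrow> length w = p \<Longrightarrow> f w = g w"
  shows "word_total n p f = word_total n p g"
  using assms
proof (induction p arbitrary: f g)
  case (Suc p)
  have eq: "word_total n p (\<lambda>w. f ((a, c) # w)) = word_total n p (\<lambda>w. g ((a, c) # w))"
    if "a < n" "c < n" for a c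
    using that by (intro Suc.IH Suc.prems) auto
  show ?case unfolding word_total.simps by (intro sum.cong refl eq) auto
qed simp

lemma word_total_add: "word_total n p (\<lambda>w. f w + g w) = word_total n p f + word_total n p g"
  by (induction p arbitrary: f g) (simp_all add: sum.distrib)

lemma word_total_cmult: "word_total n p (\<lambda>w. c * f w) = c * word_total n p f"
  by (induction p arbitrary: f) (simp_all add: sum_distrib_left)

lemma word_total_cmult_right: "word_total n p (\<lambda>w. f w * c) = word_total n p f * c"
  using word_total_cmult[of n p c f] by (simp add: mult.commute)

lemma word_total_sum: "word_total n p (\<lambda>w. \<Sum>i\<in>A. f i w) = (\<Sum>i\<in>A. word_total n p (f i))"
proof (induction p arbitrary: f)
  case (Suc p)
  have "(\<Sum>a<n. \<Sum>c<n. \<Sum>i\<in>A. g a c i) = (\<Sum>i\<in>A. \<Sum>a<n. \<Sum>c<n. g a c i)" for g :: "nat \<Rightarrow> nat \<Rightarrow> 'a \<Rightarrow> complex"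
    by (subst sum.swap[of _ A]) (intro sum.cong refl sum.swap)
  then show ?case by (simp add: Suc.IH)
qed simp

lemma word_total_tendsto:
  assumes "\<And>w. set w \<subseteq> {..<n} \<times> {..<n} \<Longrightarrow> (\<lambda>d. f d w) \<longlonglongrightarrow> g w"
  shows "(\<lambda>d. word_total n p (f d)) \<longlonglongrightarrow> word_total n p g"
  using assms
proof (induction p arbitrary: f g)
  case (Suc p)
  have lim: "(\<lambda>d. word_total n p (\<lambda>w. f d ((a, c) # w))) \<longlonglongrightarrow> word_total n p (\<lambda>w. g ((a, c) # w))"
    if "a < n" "c < n" for a c
    using that by (intro Suc.IH Suc.prems) auto
  show ?case unfolding word_total.simps by (intro tendsto_sum lim) auto
qed simp

lemma sum_swap_pairs:
  "(\<Sum>a\<in>A. \<Sum>b\<in>B. \<Sum>c\<in>C. \<Sum>e\<in>E. f a b c e) = (\<Sum>c\<in>C. \<Sum>e\<in>E. \<Sum>a\<in>A. \<Sum>b\<in>B. f a b c e)"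
proof -
  have "(\<Sum>a\<in>A. \<Sum>b\<in>B. \<Sum>c\<in>C. \<Sum>e\<in>E. f a b c e) = (\<Sum>a\<in>A. \<Sum>c\<in>C. \<Sum>b\<in>B. \<Sum>e\<in>E. f a b c e)"
    by (intro sum.cong refl sum.swap)
  also have "\<dots> = (\<Sum>c\<in>C. \<Sum>a\<in>A. \<Sum>b\<in>B. \<Sum>e\<in>E. f a b c e)" by (rule sum.swap)
  also have "\<dots> = (\<Sum>c\<in>C. \<Sum>a\<in>A. \<Sum>e\<in>E. \<Sum>b\<in>B. f a b c e)" by (intro sum.cong refl sum.swap)
  also have "\<dots> = (\<Sum>c\<in>C. \<Sum>e\<in>E. \<Sum>a\<in>A. \<Sum>b\<in>B. f a b c e)" by (intro sum.cong refl sum.swap)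
  finally show ?thesis .
qed

lemma word_total_split:
  assumes "j < q"
  shows "word_total n q (\<lambda>w. F (take j w) (w ! j) (drop (Suc j) w)) =
    (\<Sum>a<n. \<Sum>c<n. word_total n j (\<lambda>u. word_total n (q - 1 - j) (\<lambda>v. F u (a, c) v)))"
  using assms
proof (induction j arbitrary: q F)
  case 0
  then show ?case by (cases q) auto
next
  case (Suc j)
  then obtain q' where q: "q = Suc q'" "j < q'" by (cases q) auto
  have "word_total n q (\<lambda>w. F (take (Suc j) w) (w ! Suc j) (drop (Suc (Suc j)) w)) =
      (\<Sum>a<n. \<Sum>c<n. word_total n q' (\<lambda>w. F ((a, c) # take j w) (w ! j) (drop (Suc j) w)))"
    by (simp add: q)
  also have "\<dots> = (\<Sum>a<n. \<Sum>c<n. \<Sum>a'<n. \<Sum>c'<n. word_total n j (\<lambda>u.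
      word_total n (q' - 1 - j) (\<lambda>v. F ((a, c) # u) (a', c') v)))"
    using Suc.IH[OF q(2), of "\<lambda>u. F (_ # u)"] by (intro sum.cong refl)
  also have "\<dots> = (\<Sum>a'<n. \<Sum>c'<n. \<Sum>a<n. \<Sum>c<n. word_total n j (\<lambda>u.
      word_total n (q' - 1 - j) (\<lambda>v. F ((a, c) # u) (a', c') v)))"
    by (rule sum_swap_pairs)
  finally show ?case by (simp add: q)
qed

section \<open>Contraction with the associated matrix\<close>

type_synonym 'i fmat = "'i \<Rightarrow> 'i \<Rightarrow> complex"

definition mm :: "'i set \<Rightarrow> 'i fmat \<Rightarrow> 'i fmat \<Rightarrow> 'i fmat" where
  "mm J A B x y = (\<Sum>z\<in>J. A x z * B z y)"

definition one_fmat :: "'i fmat" where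
  "one_fmat x y = (if x = y then 1 else 0)"

primrec fpow :: "'i set \<Rightarrow> 'i fmat \<Rightarrow> nat \<Rightarrow> 'i fmat" where
  "fpow J A 0 = one_fmat"
| "fpow J A (Suc g) = mm J A (fpow J A g)"

definition ftr :: "'i set \<Rightarrow> 'i fmat \<Rightarrow> complex" where
  "ftr J A = (\<Sum>z\<in>J. A z z)"

definition pairs :: "nat \<Rightarrow> (nat \<times> nat) set" where
  "pairs n = {..<n} \<times> {..<n}"

definition tens :: "nat fmat \<Rightarrow> (nat \<times> nat) fmat" where
  "tens X p q = (if fst p = fst q then X (snd p) (snd q) else 0)"

definition ptr :: "nat \<Rightarrow> (nat \<times> nat) fmat \<Rightarrow> nat fmat" where
  "ptr n A b b' = (\<Sum>a<n. A (a, b) (a, b'))"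

lemma mm_assoc: "mm J (mm J A B) C = mm J A (mm J B C)"
proof (intro ext)
  fix x y
  have "mm J (mm J A B) C x y = (\<Sum>z\<in>J. \<Sum>w\<in>J. A x w * B w z * C z y)"
    by (simp add: mm_def sum_distrib_right)
  also have "\<dots> = (\<Sum>w\<in>J. \<Sum>z\<in>J. A x w * B w z * C z y)" by (rule sum.swap)
  also have "\<dots> = mm J A (mm J B C) x y"
    by (simp add: mm_def sum_distrib_left mult.assoc)
  finally show "mm J (mm J A B) C x y = mm J A (mm J B C) x y" .
qed

lemma mm_one_left: "finite J \<Longrightarrow> x \<in> J \<Longrightarrow> mm J one_fmat A x y = A x y"
proof -
  assume "finite J" "x \<in> J"
  moreover have "mm J one_fmat A x y = (\<Sum>z\<in>J. if x = z then A x y else 0)"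
    unfolding mm_def one_fmat_def by (intro sum.cong) auto
  ultimately show ?thesis by simp
qed

lemma mm_one_right: "finite J \<Longrightarrow> y \<in> J \<Longrightarrow> mm J A one_fmat x y = A x y"
proof -
  assume "finite J" "y \<in> J"
  moreover have "mm J A one_fmat x y = (\<Sum>z\<in>J. if z = y then A x y else 0)"
    unfolding mm_def one_fmat_def by (intro sum.cong) auto
  ultimately show ?thesis by simp
qed

lemma fpow_commute:
  assumes "finite J" "x \<in> J" "y \<in> J"
  shows "mm J (fpow J A g) A x y = mm J A (fpow J A g) x y"
  using assms(2)
proof (induction g arbitrary: x)
  case 0
  then show ?case using assms by (simp add: mm_one_left mm_one_right)
next
  case (Suc g)
  have "mm J (fpow J A (Suc g)) A x y = (\<Sum>z\<in>J. A x z * mm J (fpow J A g) A z y)"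
    by (simp add: mm_assoc) (simp add: mm_def)
  also have "\<dots> = (\<Sum>z\<in>J. A x z * mm J A (fpow J A g) z y)"
    using Suc.IH by (intro sum.cong) auto
  finally show ?case by (simp add: mm_def)
qed

text \<open>Matrix product along the word of the \<open>n\<close> by \<open>n\<close> matrices that
  arise from \<Lambda> by fixing the indices \<open>a\<close> and \<open>c\<close> of its first
  tensor factor.\<close>

fun word_chain :: "nat \<Rightarrow> (nat \<times> nat) fmat \<Rightarrow> (nat \<times> nat) list \<Rightarrow> nat fmat" where
  "word_chain n \<Lambda> [] b b' = one_fmat b b'"
| "word_chain n \<Lambda> ((a, c) # w) b b' = (\<Sum>b2<n. \<Lambda> (a, b) (c, b2) * word_chain n \<Lambda> w b2 b')"

lemma word_chain_append:
  "b < n \<Longrightarrow> word_chain n \<Lambda> (u @ v) b b' = (\<Sum>z<n. word_chain n \<Lambda> u b z * word_chain n \<Lambda> v z b')"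
proof (induction u arbitrary: b)
  case Nil
  then show ?case
    using mm_one_left[of "{..<n}" b "word_chain n \<Lambda> v" b'] by (simp add: mm_def)
next
  case (Cons l u)
  obtain a c where l: "l = (a, c)" by (cases l)
  show ?case
    by (simp add: l Cons.IH sum_distrib_left sum_distrib_right mult.assoc) (rule sum.swap)
qed

text \<open>The limit of the expected partial trace of the \<open>p\<close>-th power of (id
  \<otimes> \<phi>) W over the factor of size \<open>d\<close>, normalised by \<open>d\<close>: a
  matrix of size \<open>n\<close>, not yet a scalar.\<close>

definition open_limit :: "nat \<Rightarrow> nat \<Rightarrow> (nat \<times> nat) fmat \<Rightarrow> nat \<Rightarrow> nat fmat" where
  "open_limit n m \<Lambda> p b b' = word_total n p (\<lambda>w. word_chain n \<Lambda> w b b' * limit_word m w)"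

text \<open>One more letter stands in front of the word, but its factor \<Lambda> is taken off,
  which leaves a slot with four open indices. The order of \<open>fst y\<close> and
  \<open>fst x\<close> is such that putting \<Lambda> back is a matrix product followed by a partial
  trace.\<close>

definition slot_limit :: "nat \<Rightarrow> nat \<Rightarrow> (nat \<times> nat) fmat \<Rightarrow> nat \<Rightarrow> (nat \<times> nat) fmat" where
  "slot_limit n m \<Lambda> q x y =
     word_total n q (\<lambda>w. word_chain n \<Lambda> w (snd x) (snd y) * limit_word m ((fst y, fst x) # w))"

lemma sum_pairs: "(\<Sum>z\<in>pairs n. f z) = (\<Sum>a<n. \<Sum>b<n. f (a, b))"
  by (simp add: pairs_def sum.cartesian_product)

lemma open_limit_Suc:
  "open_limit n m \<Lambda> (Suc p) b b' = ptr n (mm (pairs n) \<Lambda> (slot_limit n m \<Lambda> p)) b b'"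
proof -
  have "word_total n p (\<lambda>w. (\<Sum>b2<n. \<Lambda> (a, b) (c, b2) * word_chain n \<Lambda> w b2 b') * limit_word m ((a, c) # w)) =
    (\<Sum>b2<n. \<Lambda> (a, b) (c, b2) * slot_limit n m \<Lambda> p (c, b2) (a, b'))" for a c
    unfolding slot_limit_def sum_distrib_right word_total_sum
    by (simp add: mult.assoc word_total_cmult)
  then show ?thesis
    by (simp add: open_limit_def ptr_def mm_def sum_pairs)
qed

text \<open>The recursion of \<open>limit_word\<close> in matrix form. Either the first letter
  closes on itself, or it is joined to the letter at position \<open>j\<close>, whose \<Lambda>
  stands between the slot of the enclosed word and the partial trace of the word that
  follows.\<close>

lemma slot_limit_rec:
  assumes x: "x \<in> pairs n" and y: "y \<in> pairs n"
  shows "slot_limit n m \<Lambda> q x y = tens (open_limit n m \<Lambda> q) x y +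
    (\<Sum>j<q. mm (pairs n) (mm (pairs n) (slot_limit n m \<Lambda> j) \<Lambda>)
       (tens (open_limit n m \<Lambda> (q - 1 - j))) x y) / of_nat m"
proof -
  obtain c b a b' where xy: "x = (c, b)" "y = (a, b')" by (cases x, cases y) auto
  have lt: "c < n" "b < n" "a < n" "b' < n" using x y by (auto simp: xy pairs_def)
  let ?C = "word_chain n \<Lambda>" and ?L = "limit_word m"
  let ?F = "\<lambda>u l v. (\<Sum>z1<n. ?C u b z1 * (\<Sum>z2<n. \<Lambda> (fst l, z1) (snd l, z2) * ?C v z2 b')) *
      (if snd l = a then ?L ((fst l, c) # u) * ?L v else 0)"
  have "slot_limit n m \<Lambda> q x y = word_total n q (\<lambda>w. (if a = c then ?C w b b' * ?L w else 0) +
      (\<Sum>j<q. ?F (take j w) (w ! j) (drop (Suc j) w)) * (1 / of_nat m))"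
    unfolding slot_limit_def
  proof (rule word_total_cong)
    fix w :: "(nat \<times> nat) list" assume len: "length w = q"
    have chain: "?C w b b' = (\<Sum>z1<n. ?C (take j w) b z1 *
        (\<Sum>z2<n. \<Lambda> (fst (w ! j), z1) (snd (w ! j), z2) * ?C (drop (Suc j) w) z2 b'))" if "j < q" for j
    proof -
      have "w = take j w @ w ! j # drop (Suc j) w" using that len id_take_nth_drop by metis
      then have "?C w b b' = ?C (take j w @ w ! j # drop (Suc j) w) b b'" by simp
      also have "\<dots> = (\<Sum>z1<n. ?C (take j w) b z1 * ?C (w ! j # drop (Suc j) w) z1 b')"
        by (rule word_chain_append[OF lt(2)])
      finally show ?thesis by (cases "w ! j") simp
    qed
    have "?C w b b' * (\<Sum>j<length w. if snd (w ! j) = a then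
        ?L ((fst (w ! j), c) # take j w) * ?L (drop (Suc j) w) else 0) =
      (\<Sum>j<q. ?F (take j w) (w ! j) (drop (Suc j) w))"
      unfolding sum_distrib_left[of "?C w b b'"] len
    proof (intro sum.cong refl)
      fix j assume "j \<in> {..<q}"
      then have "j < q" by simp
      from chain[OF this]
      show "?C w b b' * (if snd (w ! j) = a then ?L ((fst (w ! j), c) # take j w) * ?L (drop (Suc j) w) else 0) =
          ?F (take j w) (w ! j) (drop (Suc j) w)"
        by (rule arg_cong2[of _ _ _ _ "(*)", OF _ refl])
    qed
    then show "?C w (snd x) (snd y) * ?L ((fst y, fst x) # w) = (if a = c then ?C w b b' * ?L w else 0) +
      (\<Sum>j<q. ?F (take j w) (w ! j) (drop (Suc j) w)) * (1 / of_nat m)"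
      by (simp add: xy limit_word.simps(2)[of m a c w] distrib_left)
  qed
  also have "\<dots> = word_total n q (\<lambda>w. if a = c then ?C w b b' * ?L w else 0) +
      (\<Sum>j<q. word_total n q (\<lambda>w. ?F (take j w) (w ! j) (drop (Suc j) w))) * (1 / of_nat m)"
    unfolding word_total_add word_total_cmult_right word_total_sum ..
  also have "word_total n q (\<lambda>w. if a = c then ?C w b b' * ?L w else 0) = tens (open_limit n m \<Lambda> q) x y"
  proof (cases "a = c")
    case True
    then show ?thesis by (simp add: xy tens_def open_limit_def)
  next
    case False
    then show ?thesis using word_total_cmult[of n q 0 "\<lambda>_. 0"] by (simp add: xy tens_def)
  qed
  also have "(\<Sum>j<q. word_total n q (\<lambda>w. ?F (take j w) (w ! j) (drop (Suc j) w))) =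
    (\<Sum>j<q. mm (pairs n) (mm (pairs n) (slot_limit n m \<Lambda> j) \<Lambda>) (tens (open_limit n m \<Lambda> (q - 1 - j))) x y)"
  proof (intro sum.cong refl)
    fix j assume "j \<in> {..<q}"
    then have j: "j < q" by simp
    let ?k = "q - 1 - j"
    let ?U = "slot_limit n m \<Lambda> j" and ?X = "open_limit n m \<Lambda> ?k"
    have F: "word_total n j (\<lambda>u. word_total n ?k (\<lambda>v. ?F u (a', c') v)) =
      (if c' = a then \<Sum>z1<n. \<Sum>z2<n. ?U x (a', z1) * \<Lambda> (a', z1) (a, z2) * ?X z2 b' else 0)" for a' c'
    proof (cases "c' = a")
      case True
      have "?F u (a', c') v = (\<Sum>z1<n. \<Sum>z2<n. ((?C u b z1 * ?L ((a', c) # u)) * \<Lambda> (a', z1) (a, z2)) * (?C v z2 b' * ?L v))" for u v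
        using True by (simp add: sum_distrib_left sum_distrib_right mult_ac)
      then show ?thesis
        using True
        by (simp add: word_total_sum word_total_cmult word_total_cmult_right slot_limit_def open_limit_def xy
            del: fst_conv snd_conv) (simp add: slot_limit_def xy)
    next
      case False
      then show ?thesis
        using word_total_cmult[of n j 0 "\<lambda>_. 0"] word_total_cmult[of n ?k 0 "\<lambda>_. 0"] by simp
    qed
    have "word_total n q (\<lambda>w. ?F (take j w) (w ! j) (drop (Suc j) w)) =
        (\<Sum>a'<n. \<Sum>c'<n. word_total n j (\<lambda>u. word_total n ?k (\<lambda>v. ?F u (a', c') v)))"
      by (rule word_total_split[OF j])
    also have "\<dots> = (\<Sum>a'<n. \<Sum>z1<n. \<Sum>z2<n. ?U x (a', z1) * \<Lambda> (a', z1) (a, z2) * ?X z2 b')"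
      unfolding F using lt by simp
    also have "\<dots> = (\<Sum>z2<n. \<Sum>z1<n. \<Sum>a'<n. ?U x (a', z1) * \<Lambda> (a', z1) (a, z2) * ?X z2 b')"
      by (rule sum_reverse3)
    also have "\<dots> = (\<Sum>z2<n. \<Sum>a'<n. \<Sum>z1<n. ?U x (a', z1) * \<Lambda> (a', z1) (a, z2) * ?X z2 b')"
      by (intro sum.cong refl sum.swap)
    also have "\<dots> = (\<Sum>c'<n. \<Sum>z2<n. mm (pairs n) ?U \<Lambda> x (c', z2) * tens ?X (c', z2) y)"
    proof -
      have "(\<Sum>z2<n. \<Sum>a'<n. \<Sum>z1<n. ?U x (a', z1) * \<Lambda> (a', z1) (a, z2) * ?X z2 b') =
        (\<Sum>c'<n. if c' = a then (\<Sum>z2<n. mm (pairs n) ?U \<Lambda> x (a, z2) * ?X z2 b') else 0)"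
        using lt by (simp add: mm_def sum_pairs sum_distrib_right)
      also have "\<dots> = (\<Sum>c'<n. \<Sum>z2<n. mm (pairs n) ?U \<Lambda> x (c', z2) * tens ?X (c', z2) y)"
        by (intro sum.cong refl) (simp add: tens_def xy)
      finally show ?thesis .
    qed
    also have "\<dots> = mm (pairs n) (mm (pairs n) ?U \<Lambda>) (tens ?X) x y"
      by (simp add: mm_def[of _ "mm (pairs n) ?U \<Lambda>"] sum_pairs)
    finally show "word_total n q (\<lambda>w. ?F (take j w) (w ! j) (drop (Suc j) w)) =
        mm (pairs n) (mm (pairs n) ?U \<Lambda>) (tens ?X) x y" .
  qed
  finally show ?thesis by simp
qed

section \<open>Factorising matrices\<close>

fun slot_prod :: "nat \<Rightarrow> (nat \<times> nat) fmat \<Rightarrow> nat list \<Rightarrow> (nat \<times> nat) fmat" where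
  "slot_prod n \<Lambda> [] = one_fmat"
| "slot_prod n \<Lambda> (g # gs) =
     mm (pairs n) \<Lambda> (mm (pairs n) (tens (fpow {..<n} (ptr n \<Lambda>) g)) (slot_prod n \<Lambda> gs))"

text \<open>
  The property of \<open>\<Lambda>\<close> that makes the limit law a free multiplicative convolution, with
  \<open>D = ptr n \<Lambda>\<close>: the partial trace of \<open>\<Lambda> (1 \<otimes> D\<^bsup>g1\<^esup>) \<Lambda> (1 \<otimes> D\<^bsup>g2\<^esup>) \<dots>\<close> factorises into traces of powers
  of \<open>\<Lambda>\<close> and of \<open>D\<close>.
\<close>

definition factorising :: "nat \<Rightarrow> (nat \<times> nat) fmat \<Rightarrow> bool" where
  "factorising n \<Lambda> \<longleftrightarrow> (\<forall>gs g b b'. b < n \<longrightarrow> b' < n \<longrightarrow>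
     ftr {..<n} (ptr n \<Lambda>) ^ Suc (length gs) * ptr n (slot_prod n \<Lambda> (gs @ [g])) b b' =
     ftr (pairs n) (fpow (pairs n) \<Lambda> (Suc (length gs))) *
       (\<Prod>h\<leftarrow>gs. ftr {..<n} (fpow {..<n} (ptr n \<Lambda>) (Suc h))) *
       fpow {..<n} (ptr n \<Lambda>) (Suc g) b b')"

text \<open>The linear span of the powers of \<open>D\<close> as an induction principle;
  \<open>cong\<close> identifies functions that agree on the index range.\<close>

inductive pow_span :: "nat \<Rightarrow> nat fmat \<Rightarrow> nat fmat \<Rightarrow> bool" for n D where
  pow: "pow_span n D (fpow {..<n} D i)"
| add: "pow_span n D X \<Longrightarrow> pow_span n D Y \<Longrightarrow> pow_span n D (\<lambda>b b'. X b b' + Y b b')"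
| cmult: "pow_span n D X \<Longrightarrow> pow_span n D (\<lambda>b b'. c * X b b')"
| cong: "pow_span n D X \<Longrightarrow> (\<And>b b'. b < n \<Longrightarrow> b' < n \<Longrightarrow> X b b' = Y b b') \<Longrightarrow> pow_span n D Y"

definition linear_fun :: "nat \<Rightarrow> (nat fmat \<Rightarrow> complex) \<Rightarrow> bool" where
  "linear_fun n \<Phi> \<longleftrightarrow> (\<forall>X Y. \<Phi> (\<lambda>b b'. X b b' + Y b b') = \<Phi> X + \<Phi> Y) \<and>
     (\<forall>c X. \<Phi> (\<lambda>b b'. c * X b b') = c * \<Phi> X) \<and>
     (\<forall>X Y. (\<forall>b<n. \<forall>b'<n. X b b' = Y b b') \<longrightarrow> \<Phi> X = \<Phi> Y)"

text \<open>Transfers an identity that \<open>factorising\<close> provides for powers of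
  \<open>D\<close> to a matrix known only to lie in their span.\<close>

lemma pow_span_linear_eq:
  assumes "pow_span n D X" "linear_fun n \<Phi>" "linear_fun n \<Psi>"
    and "\<And>i. \<Phi> (fpow {..<n} D i) = \<Psi> (fpow {..<n} D i)"
  shows "\<Phi> X = \<Psi> X"
  using assms(1)
proof induction
  case (cong X Y)
  then have "\<Phi> X = \<Phi> Y" "\<Psi> X = \<Psi> Y"
    using assms(2,3) unfolding linear_fun_def by blast+
  then show ?case using cong by simp
qed (use assms in \<open>auto simp: linear_fun_def\<close>)

lemma linear_fun_entry: "b < n \<Longrightarrow> b' < n \<Longrightarrow> linear_fun n (\<lambda>X. X b b')"
  by (simp add: linear_fun_def)

lemma linear_fun_sum: "(\<And>i. i \<in> A \<Longrightarrow> linear_fun n (\<Phi> i)) \<Longrightarrow> linear_fun n (\<lambda>X. \<Sum>i\<in>A. \<Phi> i X)"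
  unfolding linear_fun_def by (auto simp: sum.distrib sum_distrib_left intro!: sum.cong)

lemma linear_fun_cmult: "linear_fun n \<Phi> \<Longrightarrow> linear_fun n (\<lambda>X. c * \<Phi> X)"
  by (auto simp: linear_fun_def distrib_left)

lemma linear_fun_cmult_right: "linear_fun n \<Phi> \<Longrightarrow> linear_fun n (\<lambda>X. \<Phi> X * c)"
  by (auto simp: linear_fun_def distrib_right)

lemma linear_fun_if: "(P \<Longrightarrow> linear_fun n \<Phi>) \<Longrightarrow> linear_fun n (\<lambda>X. if P then \<Phi> X else 0)"
  by (cases P) (auto simp: linear_fun_def)

lemma linear_fun_tens:
  "x \<in> pairs n \<Longrightarrow> y \<in> pairs n \<Longrightarrow> linear_fun n (\<lambda>X. tens X x y)"
  unfolding tens_def by (intro linear_fun_if linear_fun_entry) (auto simp: pairs_def)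

lemma linear_fun_mm_tens:
  assumes "x \<in> pairs n"
  shows "linear_fun n (\<lambda>X. mm (pairs n) (tens X) B x y)"
  unfolding mm_def using assms by (intro linear_fun_sum linear_fun_cmult_right linear_fun_tens)

lemma linear_fun_mm_mm_tens:
  "linear_fun n (\<lambda>X. mm (pairs n) A (mm (pairs n) (tens X) B) x y)"
  unfolding mm_def[of _ A] by (intro linear_fun_sum linear_fun_cmult linear_fun_mm_tens)

lemma linear_fun_mm3_tens:
  "linear_fun n (\<lambda>X. mm (pairs n) A (mm (pairs n) A' (mm (pairs n) A'' (mm (pairs n) (tens X) B))) x y)"
  unfolding mm_def[of _ A] mm_def[of _ A']
  by (intro linear_fun_sum linear_fun_cmult linear_fun_mm_mm_tens)

lemma linear_fun_ptr: "(\<And>x y. linear_fun n (\<lambda>X. \<Phi> X x y)) \<Longrightarrow> linear_fun n (\<lambda>X. ptr n (\<Phi> X) b b')"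
  unfolding ptr_def by (intro linear_fun_sum)

lemma linear_fun_mm_right: "b < n \<Longrightarrow> b' < n \<Longrightarrow> linear_fun n (\<lambda>X. mm {..<n} A X b b')"
  unfolding mm_def by (intro linear_fun_sum linear_fun_cmult linear_fun_entry) auto

lemma linear_fun_ftr_mm: "linear_fun n (\<lambda>X. ftr {..<n} (mm {..<n} A X))"
  unfolding ftr_def by (intro linear_fun_sum linear_fun_mm_right) auto

lemma pow_span_sum:
  "(\<And>i. i \<in> A \<Longrightarrow> pow_span n D (X i)) \<Longrightarrow> pow_span n D (\<lambda>b b'. \<Sum>i\<in>A. X i b b')"
proof (induction A rule: infinite_finite_induct)
  case (insert x A)
  then have "pow_span n D (\<lambda>b b'. X x b b' + (\<Sum>i\<in>A. X i b b'))"
    by (intro pow_span.add) auto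
  then show ?case using insert by simp
next
  case (infinite A)
  then show ?case using pow_span.cmult[OF pow_span.pow, where c = 0] by simp
next
  case empty
  then show ?case using pow_span.cmult[OF pow_span.pow, where c = 0] by simp
qed

lemma pow_span_mult:
  assumes "pow_span n D X"
  shows "pow_span n D (mm {..<n} D X)"
  using assms
proof induction
  case (pow i)
  show ?case using pow_span.pow[of n D "Suc i"] by simp
next
  case (add X Y)
  have "mm {..<n} D (\<lambda>b b'. X b b' + Y b b') = (\<lambda>b b'. mm {..<n} D X b b' + mm {..<n} D Y b b')"
    by (simp add: mm_def fun_eq_iff distrib_left sum.distrib)
  then show ?case using add pow_span.add by simp
next
  case (cmult X c)
  have "mm {..<n} D (\<lambda>b b'. c * X b b') = (\<lambda>b b'. c * mm {..<n} D X b b')"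
    by (simp add: mm_def fun_eq_iff sum_distrib_left mult_ac)
  then show ?case using cmult pow_span.cmult by simp
next
  case (cong X Y)
  show ?case
    by (rule pow_span.cong[OF cong.IH]) (use cong in \<open>auto simp: mm_def intro!: sum.cong\<close>)
qed

lemma finite_pairs: "finite (pairs n)"
  by (simp add: pairs_def)

lemma ftr_ptr: "ftr {..<n} (ptr n \<Lambda>) = ftr (pairs n) \<Lambda>"
  unfolding ftr_def ptr_def sum_pairs by (rule sum.swap)

text \<open>\<open>slot_limit_rec\<close> inserted between \<Lambda> and a factor \<open>B\<close>,
  reassociated so that the newly exposed \<Lambda> and the matrix 1 \<otimes> X stand next to
  \<open>B\<close>. If X is a power of D, they extend a \<open>slot_prod\<close> by one
  exponent.\<close>

lemma slot_limit_product:
  assumes "x \<in> pairs n" "y \<in> pairs n"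
  shows "mm (pairs n) \<Lambda> (mm (pairs n) (slot_limit n m \<Lambda> q) B) x y =
    mm (pairs n) \<Lambda> (mm (pairs n) (tens (open_limit n m \<Lambda> q)) B) x y +
    (\<Sum>j<q. mm (pairs n) \<Lambda> (mm (pairs n) (slot_limit n m \<Lambda> j) (mm (pairs n) \<Lambda>
      (mm (pairs n) (tens (open_limit n m \<Lambda> (q - 1 - j))) B))) x y) / of_nat m"
proof -
  let ?U = "slot_limit n m \<Lambda>" and ?X = "open_limit n m \<Lambda>" and ?J = "pairs n"
  have 1: "mm ?J (?U q) B z y = mm ?J (tens (?X q)) B z y +
      (\<Sum>j<q. mm ?J (mm ?J (mm ?J (?U j) \<Lambda>) (tens (?X (q - 1 - j)))) B z y) / of_nat m"
    if z: "z \<in> ?J" for z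
  proof -
    have "mm ?J (?U q) B z y = (\<Sum>w\<in>?J. (tens (?X q) z w +
      (\<Sum>j<q. mm ?J (mm ?J (?U j) \<Lambda>) (tens (?X (q - 1 - j))) z w) / of_nat m) * B w y)"
      unfolding mm_def[of _ "?U q"] by (intro sum.cong refl) (simp add: slot_limit_rec[OF z])
    also have "\<dots> = mm ?J (tens (?X q)) B z y + (\<Sum>w\<in>?J. (\<Sum>j<q. mm ?J (mm ?J (?U j) \<Lambda>) (tens (?X (q - 1 - j))) z w * B w y) / of_nat m)"
      by (simp add: distrib_right sum.distrib mm_def[of _ "tens _" B] sum_distrib_right)
    also have "(\<Sum>w\<in>?J. (\<Sum>j<q. mm ?J (mm ?J (?U j) \<Lambda>) (tens (?X (q - 1 - j))) z w * B w y) / of_nat m) =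
      (\<Sum>j<q. mm ?J (mm ?J (mm ?J (?U j) \<Lambda>) (tens (?X (q - 1 - j)))) B z y) / of_nat m"
      unfolding sum_divide_distrib[symmetric] mm_def[of _ "mm ?J _ (tens _)" B]
      by (subst sum.swap) simp
    finally show ?thesis .
  qed
  have "mm ?J \<Lambda> (mm ?J (?U q) B) x y = (\<Sum>z\<in>?J. \<Lambda> x z * (mm ?J (tens (?X q)) B z y +
      (\<Sum>j<q. mm ?J (mm ?J (mm ?J (?U j) \<Lambda>) (tens (?X (q - 1 - j)))) B z y) / of_nat m))"
    unfolding mm_def[of _ \<Lambda>] by (intro sum.cong refl) (simp only: 1)
  also have "\<dots> = (\<Sum>z\<in>?J. \<Lambda> x z * mm ?J (tens (?X q)) B z y) +
      (\<Sum>z\<in>?J. (\<Sum>j<q. \<Lambda> x z * mm ?J (mm ?J (mm ?J (?U j) \<Lambda>) (tens (?X (q - 1 - j)))) B z y) / of_nat m)"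
    by (simp add: distrib_left sum.distrib sum_distrib_left)
  also have "(\<Sum>z\<in>?J. (\<Sum>j<q. \<Lambda> x z * mm ?J (mm ?J (mm ?J (?U j) \<Lambda>) (tens (?X (q - 1 - j)))) B z y) / of_nat m) =
      (\<Sum>j<q. \<Sum>z\<in>?J. \<Lambda> x z * mm ?J (mm ?J (mm ?J (?U j) \<Lambda>) (tens (?X (q - 1 - j)))) B z y) / of_nat m"
    unfolding sum_divide_distrib[symmetric] by (subst sum.swap) simp
  finally show ?thesis
    by (simp only: mm_assoc) (simp only: mm_def[of _ \<Lambda>])
qed

lemma open_limit_0: "open_limit n m \<Lambda> 0 = one_fmat"
  by (simp add: open_limit_def fun_eq_iff)

lemma ptr_add_sum_divide:
  "(\<And>a. a < n \<Longrightarrow> A (a, b) (a, b') = B (a, b) (a, b') + (\<Sum>j<q. C j (a, b) (a, b')) / c) \<Longrightarrow>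
    ptr n A b b' = ptr n B b b' + (\<Sum>j<q. ptr n (C j) b b') / c"
proof -
  assume "\<And>a. a < n \<Longrightarrow> A (a, b) (a, b') = B (a, b) (a, b') + (\<Sum>j<q. C j (a, b) (a, b')) / c"
  then have "ptr n A b b' = (\<Sum>a<n. B (a, b) (a, b')) + (\<Sum>a<n. (\<Sum>j<q. C j (a, b) (a, b')) / c)"
    by (simp add: ptr_def sum.distrib)
  also have "(\<Sum>a<n. (\<Sum>j<q. C j (a, b) (a, b')) / c) = (\<Sum>j<q. ptr n (C j) b b') / c"
    unfolding sum_divide_distrib[symmetric] ptr_def by (subst sum.swap) simp
  finally show ?thesis by (simp add: ptr_def)
qed

text \<open>Here \<open>s\<close> is \<delta> m, \<open>\<beta> c\<close> is the \<open>c\<close>-th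
  moment of D, and \<open>\<kappa> l\<close> is mn times the \<open>l\<close>-th moment of \<rho>:
  normalising the trace of \<Lambda> divides by n^2, which leaves m/n.\<close>

theorem open_limit_free_mom:
  fixes n m :: nat and \<Lambda> :: "(nat \<times> nat) fmat"
  assumes fac: "factorising n \<Lambda>" and n: "n \<ge> 1" and m: "m \<ge> 1"
    and \<tau>0: "ftr {..<n} (ptr n \<Lambda>) \<noteq> 0"
  defines "D \<equiv> ptr n \<Lambda>"
  defines "\<tau> \<equiv> ftr {..<n} D"
  defines "s \<equiv> of_nat m * (\<tau> / of_nat n)"
  defines "\<kappa> \<equiv> \<lambda>l. of_nat m / of_nat n * ftr (pairs n) (fpow (pairs n) \<Lambda> l)"
  defines "\<beta> \<equiv> \<lambda>c. ftr {..<n} (fpow {..<n} D c) / of_nat n"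
  shows "s ^ q * (ftr {..<n} (mm {..<n} (fpow {..<n} D g) (open_limit n m \<Lambda> q)) / of_nat n) =
    free_mom \<kappa> \<beta> g q"
proof -
  let ?X = "open_limit n m \<Lambda>" and ?U = "slot_limit n m \<Lambda>" and ?J = "pairs n" and ?I = "{..<n}"
  let ?Dp = "fpow ?I D"
  let ?T = "\<lambda>l. ftr ?J (fpow ?J \<Lambda> l)"
  let ?\<Pi> = "\<lambda>gs. \<Prod>h\<leftarrow>gs. ftr ?I (?Dp (Suc h))"
  let ?P = "slot_prod n \<Lambda>"
  let ?N = "of_nat n :: complex" and ?M = "of_nat m :: complex"
  have \<tau>: "\<tau> \<noteq> 0" using \<tau>0 by (simp add: \<tau>_def D_def)
  have N0: "?N \<noteq> 0" and M0: "?M \<noteq> 0" using n m by auto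
  have s0: "s \<noteq> 0" using \<tau> N0 M0 by (simp add: s_def)
  have F: "ptr n (?P (gs @ [g])) b b' = ?T (Suc (length gs)) / \<tau> ^ Suc (length gs) * ?\<Pi> gs * ?Dp (Suc g) b b'"
    if "b < n" "b' < n" for gs g b b'
    using fac that \<tau> unfolding factorising_def D_def[symmetric] \<tau>_def[symmetric]
    by (simp add: field_simps del: power_Suc fpow.simps)
  have T1: "?T 1 = \<tau>"
    using mm_one_right[OF finite_pairs, of _ n \<Lambda>] ftr_ptr[of n \<Lambda>] by (simp add: \<tau>_def D_def ftr_def)
  \<comment> \<open>The scalar with which a slot enters a block of \<open>l\<close> factors
    \<Lambda>. Its prefactor is dictated by the term in which the block gets no further element,
    \<open>?T l / \<tau> ^ l\<close> times n \<open>free_mom \<kappa> \<beta> 1 q\<close> / s^q,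
    since \<open>?T l\<close> is n \<open>\<kappa> l\<close> / m.\<close>
  define R where "R l q = ?N\<^sup>2 / (?M * \<tau> ^ l * s ^ q) * block_mom \<kappa> \<beta> 0 l q" for l q
  have P_Cons: "mm ?J \<Lambda> (mm ?J (tens (?Dp i)) (?P gs)) = ?P (i # gs)" for i gs
    by (simp add: D_def)
  \<comment> \<open>The three claims need each other: the first lets \<open>?X\<close> be replaced
    by powers of \<open>D\<close> between factors \<Lambda>, so that \<open>factorising\<close>
    yields the other two. In the third, the leading \<Lambda> and the \<open>length gs + 1\<close>
    factors of the product form one block, hence \<open>length gs + 2\<close>. Only the last
    exponent meets the open indices; the others close up to traces.\<close>
  have "pow_span n D (?X q) \<and>
    (\<forall>g. s ^ q * (ftr ?I (mm ?I (?Dp g) (?X q)) / ?N) = free_mom \<kappa> \<beta> g q) \<and>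
    (\<forall>gs g b b'. b < n \<longrightarrow> b' < n \<longrightarrow> ptr n (mm ?J \<Lambda> (mm ?J (?U q) (?P (gs @ [g])))) b b' =
       R (length gs + 2) q * ?\<Pi> gs * ?Dp (Suc g) b b')"
  proof (induction q rule: less_induct)
    case (less q)
    have span: "pow_span n D (?X j)"
      and V: "s ^ j * (ftr ?I (mm ?I (?Dp g) (?X j)) / ?N) = free_mom \<kappa> \<beta> g j"
      and B: "b < n \<Longrightarrow> b' < n \<Longrightarrow> ptr n (mm ?J \<Lambda> (mm ?J (?U j) (?P (gs @ [g])))) b b' =
       R (length gs + 2) j * ?\<Pi> gs * ?Dp (Suc g) b b'" if "j < q" for j g gs b b'
      using less.IH[OF that] by auto
    have step: "?X q b b' = mm ?I D (?X p) b b' + (\<Sum>j<p. R 2 j * mm ?I D (?X (p - 1 - j)) b b') / ?M"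
      if q: "q = Suc p" and b: "b < n" "b' < n" for p b b'
    proof -
      \<comment> \<open>Multiplying by the identity \<open>?P []\<close> brings the expression into
        the form that \<open>slot_limit_product\<close> unrolls.\<close>
      have "?X q b b' = ptr n (mm ?J \<Lambda> (mm ?J (?U p) (?P []))) b b'"
      proof -
        have "mm ?J \<Lambda> (?U p) (a, b) (a, b') = mm ?J \<Lambda> (mm ?J (?U p) (?P [])) (a, b) (a, b')" if "a < n" for a
        proof -
          have "(a, b') \<in> ?J" using that b by (simp add: pairs_def)
          then show ?thesis
            by (simp add: mm_one_right[OF finite_pairs] flip: mm_assoc)
        qed
        then show ?thesis unfolding q open_limit_Suc ptr_def by simp
      qed
      also have "\<dots> = ptr n (mm ?J \<Lambda> (mm ?J (tens (?X p)) (?P []))) b b' +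
          (\<Sum>j<p. ptr n (mm ?J \<Lambda> (mm ?J (?U j) (mm ?J \<Lambda> (mm ?J (tens (?X (p - 1 - j))) (?P []))))) b b') / ?M"
        by (rule ptr_add_sum_divide, rule slot_limit_product) (use b in \<open>auto simp: pairs_def\<close>)
      also have "ptr n (mm ?J \<Lambda> (mm ?J (tens (?X p)) (?P []))) b b' = mm ?I D (?X p) b b'"
      proof (rule pow_span_linear_eq[OF span])
        show "linear_fun n (\<lambda>X. ptr n (mm ?J \<Lambda> (mm ?J (tens X) (?P []))) b b')"
          by (intro linear_fun_ptr linear_fun_mm_mm_tens)
        show "ptr n (mm ?J \<Lambda> (mm ?J (tens (?Dp i)) (?P []))) b b' = mm ?I D (?Dp i) b b'" for i
          unfolding P_Cons using F[OF b, of "[]" i] T1 \<tau> by simp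
      qed (use b q in \<open>auto intro: linear_fun_mm_right\<close>)
      also have "(\<Sum>j<p. ptr n (mm ?J \<Lambda> (mm ?J (?U j) (mm ?J \<Lambda> (mm ?J (tens (?X (p - 1 - j))) (?P []))))) b b') =
        (\<Sum>j<p. R 2 j * mm ?I D (?X (p - 1 - j)) b b')"
      proof (intro sum.cong refl)
        fix j assume "j \<in> {..<p}"
        then have j: "j < q" "p - 1 - j < q" using q by auto
        show "ptr n (mm ?J \<Lambda> (mm ?J (?U j) (mm ?J \<Lambda> (mm ?J (tens (?X (p - 1 - j))) (?P []))))) b b' =
            R 2 j * mm ?I D (?X (p - 1 - j)) b b'"
        proof (rule pow_span_linear_eq[OF span[OF j(2)]])
          show "linear_fun n (\<lambda>X. ptr n (mm ?J \<Lambda> (mm ?J (?U j) (mm ?J \<Lambda> (mm ?J (tens X) (?P []))))) b b')"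
            by (intro linear_fun_ptr linear_fun_mm3_tens)
          show "linear_fun n (\<lambda>X. R 2 j * mm ?I D X b b')"
            by (intro linear_fun_cmult linear_fun_mm_right b)
          show "ptr n (mm ?J \<Lambda> (mm ?J (?U j) (mm ?J \<Lambda> (mm ?J (tens (?Dp i)) (?P []))))) b b' = R 2 j * mm ?I D (?Dp i) b b'" for i
            unfolding P_Cons using B[OF j(1) b, of "[]" i] by (simp add: numeral_2_eq_2)
        qed
      qed
      finally show ?thesis .
    qed
    have "pow_span n D (?X q)"
    proof (cases q)
      case 0
      then show ?thesis using pow_span.pow[of n D 0] by (simp add: open_limit_0)
    next
      case (Suc p)
      have "pow_span n D (\<lambda>b b'. mm ?I D (?X p) b b' + 1 / ?M * (\<Sum>j<p. R 2 j * mm ?I D (?X (p - 1 - j)) b b'))"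
        using span Suc by (intro pow_span.add pow_span.cmult pow_span_sum pow_span_mult) auto
      then show ?thesis by (rule pow_span.cong) (use step[OF Suc] in simp)
    qed
    moreover have Vq: "s ^ q * (ftr ?I (mm ?I (?Dp g) (?X q)) / ?N) = free_mom \<kappa> \<beta> g q" for g
    proof (cases q)
      case 0
      have "ftr ?I (mm ?I (?Dp g) one_fmat) = ftr ?I (?Dp g)"
        unfolding ftr_def by (intro sum.cong refl mm_one_right) auto
      then show ?thesis by (simp add: 0 open_limit_0 \<beta>_def)
    next
      case (Suc p)
      have comm: "ftr ?I (mm ?I (?Dp g) (mm ?I D Y)) = ftr ?I (mm ?I (?Dp (Suc g)) Y)" for Y
      proof -
        have "mm ?I (mm ?I (?Dp g) D) Y z z = mm ?I (mm ?I D (?Dp g)) Y z z" if "z \<in> ?I" for z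
          unfolding mm_def[of _ _ Y] using that by (intro sum.cong refl) (simp add: fpow_commute)
        then show ?thesis by (simp add: ftr_def mm_assoc)
      qed
      let ?t = "\<lambda>g j. ftr ?I (mm ?I (?Dp g) (?X j))"
      have "?t g q = ftr ?I (mm ?I (?Dp g) (\<lambda>b b'. mm ?I D (?X p) b b' + (\<Sum>j<p. R 2 j * mm ?I D (?X (p - 1 - j)) b b') * (1 / ?M)))"
        using step[OF Suc] by (simp add: ftr_def mm_def[of _ "?Dp g"])
      also have "\<dots> = ?t (Suc g) p + (\<Sum>j<p. R 2 j * ?t (Suc g) (p - 1 - j)) * (1 / ?M)"
      proof -
        have lin: "ftr ?I (mm ?I (?Dp g) (\<lambda>b b'. Y b b' + (\<Sum>j<p. R 2 j * Z j b b') * c)) =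
          ftr ?I (mm ?I (?Dp g) Y) + (\<Sum>j<p. R 2 j * ftr ?I (mm ?I (?Dp g) (Z j))) * c" for Y Z c
        proof -
          have "ftr ?I (mm ?I (?Dp g) (\<lambda>b b'. Y b b' + (\<Sum>j<p. R 2 j * Z j b b') * c)) =
            ftr ?I (mm ?I (?Dp g) Y) + (\<Sum>z<n. \<Sum>w<n. \<Sum>j<p. R 2 j * (?Dp g z w * Z j w z)) * c"
            by (simp add: ftr_def mm_def distrib_left sum.distrib sum_distrib_left sum_distrib_right mult_ac)
          also have "(\<Sum>z<n. \<Sum>w<n. \<Sum>j<p. R 2 j * (?Dp g z w * Z j w z)) = (\<Sum>j<p. \<Sum>w<n. \<Sum>z<n. R 2 j * (?Dp g z w * Z j w z))"
            by (rule sum_reverse3)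
          also have "\<dots> = (\<Sum>j<p. \<Sum>z<n. \<Sum>w<n. R 2 j * (?Dp g z w * Z j w z))"
            by (intro sum.cong refl sum.swap)
          finally show ?thesis by (simp add: ftr_def mm_def sum_distrib_left)
        qed
        show ?thesis unfolding lin comm ..
      qed
      finally have tq: "?t g q = ?t (Suc g) p + (\<Sum>j<p. R 2 j * ?t (Suc g) (p - 1 - j)) * (1 / ?M)" .
      have coef: "s ^ q * (R 2 j * ?t (Suc g) (p - 1 - j)) * (1 / ?M) / ?N =
          block_mom \<kappa> \<beta> 0 2 j * free_mom \<kappa> \<beta> (Suc g) (p - 1 - j)" if "j < p" for j
      proof -
        have "q = 2 + j + (p - 1 - j)" using that Suc by simp
        then have "s ^ q = s ^ 2 * s ^ j * s ^ (p - 1 - j)"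
          by (metis power_add)
        then have "s ^ q * (R 2 j * ?t (Suc g) (p - 1 - j)) * (1 / ?M) / ?N =
          (s\<^sup>2 * ?N\<^sup>2 / (?M * ?M * \<tau>\<^sup>2)) * block_mom \<kappa> \<beta> 0 2 j * (s ^ (p - 1 - j) * (?t (Suc g) (p - 1 - j) / ?N))"
          using s0 \<tau> M0 N0 by (simp add: R_def field_simps)
        \<comment> \<open>This fixes the scaling: it holds because \<open>s\<close> is m \<tau> /
          n.\<close>
        also have "s\<^sup>2 * ?N\<^sup>2 / (?M * ?M * \<tau>\<^sup>2) = 1"
          using \<tau> M0 N0 by (simp add: s_def power2_eq_square)
        also have "s ^ (p - 1 - j) * (?t (Suc g) (p - 1 - j) / ?N) = free_mom \<kappa> \<beta> (Suc g) (p - 1 - j)"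
          using that Suc by (intro V) auto
        finally show ?thesis by simp
      qed
      have "s ^ q * (?t g q / ?N) = s * (s ^ p * (?t (Suc g) p / ?N)) +
          (\<Sum>j<p. s ^ q * (R 2 j * ?t (Suc g) (p - 1 - j)) * (1 / ?M) / ?N)"
        unfolding tq by (simp add: Suc sum_distrib_left sum_distrib_right sum_divide_distrib algebra_simps add_divide_distrib)
      also have "(\<Sum>j<p. s ^ q * (R 2 j * ?t (Suc g) (p - 1 - j)) * (1 / ?M) / ?N) =
          (\<Sum>j<p. block_mom \<kappa> \<beta> 0 2 j * free_mom \<kappa> \<beta> (Suc g) (p - 1 - j))"
        by (intro sum.cong refl coef) auto
      also have "s ^ p * (?t (Suc g) p / ?N) = free_mom \<kappa> \<beta> (Suc g) p"
        using Suc by (intro V) auto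
      finally have E: "s ^ q * (?t g q / ?N) = s * free_mom \<kappa> \<beta> (Suc g) p +
          (\<Sum>j<p. block_mom \<kappa> \<beta> 0 2 j * free_mom \<kappa> \<beta> (Suc g) (p - 1 - j))" .
      have "\<kappa> 1 = s" by (simp only: \<kappa>_def T1) (simp add: s_def)
      then show ?thesis
        unfolding E by (simp add: Suc block_mom.simps[of \<kappa> \<beta> g "Suc 0" p] numeral_2_eq_2)
    qed
    moreover have "ptr n (mm ?J \<Lambda> (mm ?J (?U q) (?P (gs @ [g])))) b b' =
       R (length gs + 2) q * ?\<Pi> gs * ?Dp (Suc g) b b'" if b: "b < n" "b' < n" for gs g b b'
    proof -
      let ?l = "length gs + 2"
      let ?t = "\<lambda>j. ftr ?I (mm ?I D (?X j))"
      have spanq: "pow_span n D (?X q)" by fact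
      have D1: "mm ?I (?Dp 1) Y z z = mm ?I D Y z z" for Y z
        unfolding mm_def[of _ _ Y] by (intro sum.cong refl) (simp add: mm_one_right)
      have t: "?t j = ?N * free_mom \<kappa> \<beta> 1 j / s ^ j" if "j \<le> q" for j
      proof -
        have "s ^ j * (ftr ?I (mm ?I (?Dp 1) (?X j)) / ?N) = free_mom \<kappa> \<beta> 1 j"
          using that V[of j 1] Vq[of 1] by (cases "j = q") auto
        moreover have "ftr ?I (mm ?I (?Dp 1) (?X j)) = ?t j"
          unfolding ftr_def by (intro sum.cong refl D1)
        ultimately show ?thesis using s0 N0 by (simp add: field_simps)
      qed
      have "ptr n (mm ?J \<Lambda> (mm ?J (?U q) (?P (gs @ [g])))) b b' =
          ptr n (mm ?J \<Lambda> (mm ?J (tens (?X q)) (?P (gs @ [g])))) b b' +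
          (\<Sum>j<q. ptr n (mm ?J \<Lambda> (mm ?J (?U j) (mm ?J \<Lambda> (mm ?J (tens (?X (q - 1 - j))) (?P (gs @ [g])))))) b b') / ?M"
        by (rule ptr_add_sum_divide, rule slot_limit_product) (use b in \<open>auto simp: pairs_def\<close>)
      also have "ptr n (mm ?J \<Lambda> (mm ?J (tens (?X q)) (?P (gs @ [g])))) b b' =
          ?T ?l / \<tau> ^ ?l * ?t q * (?\<Pi> gs * ?Dp (Suc g) b b')"
      proof (rule pow_span_linear_eq[OF spanq])
        show "linear_fun n (\<lambda>X. ptr n (mm ?J \<Lambda> (mm ?J (tens X) (?P (gs @ [g])))) b b')"
          by (intro linear_fun_ptr linear_fun_mm_mm_tens)
        show "linear_fun n (\<lambda>X. ?T ?l / \<tau> ^ ?l * ftr ?I (mm ?I D X) * (?\<Pi> gs * ?Dp (Suc g) b b'))"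
          by (intro linear_fun_cmult linear_fun_cmult_right linear_fun_ftr_mm)
        show "ptr n (mm ?J \<Lambda> (mm ?J (tens (?Dp i)) (?P (gs @ [g])))) b b' =
            ?T ?l / \<tau> ^ ?l * ftr ?I (mm ?I D (?Dp i)) * (?\<Pi> gs * ?Dp (Suc g) b b')" for i
          unfolding P_Cons using F[OF b, of "i # gs" g] by (simp add: mult.assoc)
      qed
      also have "(\<Sum>j<q. ptr n (mm ?J \<Lambda> (mm ?J (?U j) (mm ?J \<Lambda> (mm ?J (tens (?X (q - 1 - j))) (?P (gs @ [g])))))) b b') =
        (\<Sum>j<q. R (Suc ?l) j * ?t (q - 1 - j) * (?\<Pi> gs * ?Dp (Suc g) b b'))"
      proof (intro sum.cong refl)
        fix j assume "j \<in> {..<q}"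
        then have j: "j < q" "q - 1 - j < q" by auto
        show "ptr n (mm ?J \<Lambda> (mm ?J (?U j) (mm ?J \<Lambda> (mm ?J (tens (?X (q - 1 - j))) (?P (gs @ [g])))))) b b' =
            R (Suc ?l) j * ?t (q - 1 - j) * (?\<Pi> gs * ?Dp (Suc g) b b')"
        proof (rule pow_span_linear_eq[OF span[OF j(2)]])
          show "linear_fun n (\<lambda>X. ptr n (mm ?J \<Lambda> (mm ?J (?U j) (mm ?J \<Lambda> (mm ?J (tens X) (?P (gs @ [g])))))) b b')"
            by (intro linear_fun_ptr linear_fun_mm3_tens)
          show "linear_fun n (\<lambda>X. R (Suc ?l) j * ftr ?I (mm ?I D X) * (?\<Pi> gs * ?Dp (Suc g) b b'))"
            by (intro linear_fun_cmult linear_fun_cmult_right linear_fun_ftr_mm)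
          show "ptr n (mm ?J \<Lambda> (mm ?J (?U j) (mm ?J \<Lambda> (mm ?J (tens (?Dp i)) (?P (gs @ [g])))))) b b' =
            R (Suc ?l) j * ftr ?I (mm ?I D (?Dp i)) * (?\<Pi> gs * ?Dp (Suc g) b b')" for i
            unfolding P_Cons using B[OF j(1) b, of "i # gs" g] by (simp add: mult.assoc)
        qed
      qed
      also have "?T ?l / \<tau> ^ ?l * ?t q * (?\<Pi> gs * ?Dp (Suc g) b b') +
          (\<Sum>j<q. R (Suc ?l) j * ?t (q - 1 - j) * (?\<Pi> gs * ?Dp (Suc g) b b')) / ?M =
        (?T ?l / \<tau> ^ ?l * ?t q + (\<Sum>j<q. R (Suc ?l) j * ?t (q - 1 - j) / ?M)) * (?\<Pi> gs * ?Dp (Suc g) b b')"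
        by (simp add: distrib_right sum_distrib_right sum_divide_distrib)
      also have "?T ?l / \<tau> ^ ?l * ?t q + (\<Sum>j<q. R (Suc ?l) j * ?t (q - 1 - j) / ?M) = R ?l q"
      proof -
        let ?c = "?N\<^sup>2 / (?M * \<tau> ^ ?l * s ^ q)"
        have 1: "?T ?l / \<tau> ^ ?l * ?t q = ?c * (\<kappa> ?l * free_mom \<kappa> \<beta> 1 q)"
        proof -
          have "\<kappa> ?l = ?M / ?N * ?T ?l" by (simp only: \<kappa>_def)
          then show ?thesis
            using s0 \<tau> M0 N0 by (simp add: t power2_eq_square mult_ac del: fpow.simps)
        qed
        have 2: "R (Suc ?l) j * ?t (q - 1 - j) / ?M =
            ?c * (block_mom \<kappa> \<beta> 0 (Suc ?l) j * free_mom \<kappa> \<beta> 1 (q - 1 - j))" if "j < q" for j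
        proof -
          have "q = 1 + j + (q - 1 - j)" using that by simp
          then have sq: "s ^ q = s * s ^ j * s ^ (q - 1 - j)"
            by (metis power_add power_one_right)
          have "R (Suc ?l) j * ?t (q - 1 - j) / ?M =
            ?N\<^sup>2 * (?N / (?M * \<tau>)) / (?M * \<tau> ^ ?l * (s ^ j * s ^ (q - 1 - j))) *
            (block_mom \<kappa> \<beta> 0 (Suc ?l) j * free_mom \<kappa> \<beta> 1 (q - 1 - j))"
            using that by (simp add: t R_def mult_ac del: power_add)
          also have "?N / (?M * \<tau>) = 1 / s" by (simp add: s_def)
          finally show ?thesis unfolding sq by (simp add: mult_ac del: power_add)
        qed
        have "?T ?l / \<tau> ^ ?l * ?t q + (\<Sum>j<q. R (Suc ?l) j * ?t (q - 1 - j) / ?M) =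
          ?c * (\<kappa> ?l * free_mom \<kappa> \<beta> 1 q) + (\<Sum>j<q. ?c * (block_mom \<kappa> \<beta> 0 (Suc ?l) j * free_mom \<kappa> \<beta> 1 (q - 1 - j)))"
          by (intro arg_cong2[of _ _ _ _ "(+)"] 1 sum.cong refl 2) auto
        also have "\<dots> = ?c * block_mom \<kappa> \<beta> 0 ?l q"
          unfolding block_mom.simps[of \<kappa> \<beta> 0 ?l q] by (simp add: distrib_left sum_distrib_left)
        finally show ?thesis by (simp only: R_def)
      qed
      finally show ?thesis by (simp add: mult.assoc)
    qed
    ultimately show ?case by blast
  qed
  then show ?thesis by blast
qed

section \<open>Strings and beads diagrams factorise\<close>

text \<open>An abstract form of mixed-radix digits: a sum over \<open>J\<close> of a product over
  positions factorises, and the digits determine the index. A tensor decomposition needs no more,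
  and the notion applies to pairs of indices as well as to single ones.\<close>

definition digit_system :: "nat set \<Rightarrow> 'i set \<Rightarrow> (nat \<Rightarrow> 'j set) \<Rightarrow> (nat \<Rightarrow> 'i \<Rightarrow> 'j) \<Rightarrow> bool" where
  "digit_system R J Jr dg \<longleftrightarrow> finite R \<and> finite J \<and>
     (\<forall>h :: nat \<Rightarrow> 'j \<Rightarrow> complex. (\<Sum>x\<in>J. \<Prod>r\<in>R. h r (dg r x)) = (\<Prod>r\<in>R. \<Sum>w\<in>Jr r. h r w)) \<and>
     (\<forall>x\<in>J. \<forall>y\<in>J. (\<forall>r\<in>R. dg r x = dg r y) \<longrightarrow> x = y) \<and>
     (\<forall>x\<in>J. \<forall>r\<in>R. dg r x \<in> Jr r)"

definition product_fmat ::
  "nat set \<Rightarrow> 'i set \<Rightarrow> (nat \<Rightarrow> 'i \<Rightarrow> 'j) \<Rightarrow> 'i fmat \<Rightarrow> (nat \<Rightarrow> 'j fmat) \<Rightarrow> bool" where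
  "product_fmat R J dg A Ar \<longleftrightarrow> (\<forall>x\<in>J. \<forall>y\<in>J. A x y = (\<Prod>r\<in>R. Ar r (dg r x) (dg r y)))"

context
  fixes R :: "nat set" and J :: "'i set" and Jr :: "nat \<Rightarrow> 'j set" and dg :: "nat \<Rightarrow> 'i \<Rightarrow> 'j"
  assumes dg: "digit_system R J Jr dg"
begin

lemma digit_system_sum: "(\<Sum>x\<in>J. \<Prod>r\<in>R. h r (dg r x)) = (\<Prod>r\<in>R. \<Sum>w\<in>Jr r. (h r w :: complex))"
  using dg by (simp add: digit_system_def)

lemma product_fmat_delta:
  assumes "x \<in> J" "y \<in> J"
  shows "(\<Prod>r\<in>R. if dg r x = dg r y then f r else 0) = (if x = y then \<Prod>r\<in>R. (f r :: complex) else 0)"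
proof (cases "x = y")
  case False
  then obtain r where "r \<in> R" "dg r x \<noteq> dg r y"
    using dg assms unfolding digit_system_def by blast
  then show ?thesis using False dg by (auto simp: digit_system_def)
qed simp

lemma product_fmat_one: "product_fmat R J dg one_fmat (\<lambda>r. one_fmat)"
  using product_fmat_delta[of _ _ "\<lambda>_. 1"] by (simp add: product_fmat_def one_fmat_def)

lemma product_fmat_mm:
  assumes "product_fmat R J dg A Ar" "product_fmat R J dg B Br"
  shows "product_fmat R J dg (mm J A B) (\<lambda>r. mm (Jr r) (Ar r) (Br r))"
  unfolding product_fmat_def
proof (intro ballI)
  fix x y assume xy: "x \<in> J" "y \<in> J"
  have "mm J A B x y = (\<Sum>z\<in>J. \<Prod>r\<in>R. Ar r (dg r x) (dg r z) * Br r (dg r z) (dg r y))"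
    using assms xy by (simp add: mm_def product_fmat_def prod.distrib)
  also have "\<dots> = (\<Prod>r\<in>R. mm (Jr r) (Ar r) (Br r) (dg r x) (dg r y))"
    unfolding mm_def by (rule digit_system_sum)
  finally show "mm J A B x y = (\<Prod>r\<in>R. mm (Jr r) (Ar r) (Br r) (dg r x) (dg r y))" .
qed

lemma product_fmat_fpow:
  "product_fmat R J dg A Ar \<Longrightarrow> product_fmat R J dg (fpow J A g) (\<lambda>r. fpow (Jr r) (Ar r) g)"
  by (induction g) (simp_all add: product_fmat_one product_fmat_mm)

lemma product_fmat_ftr:
  assumes "product_fmat R J dg A Ar"
  shows "ftr J A = (\<Prod>r\<in>R. ftr (Jr r) (Ar r))"
proof -
  have "ftr J A = (\<Sum>z\<in>J. \<Prod>r\<in>R. Ar r (dg r z) (dg r z))"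
    using assms by (simp add: ftr_def product_fmat_def)
  also have "\<dots> = (\<Prod>r\<in>R. ftr (Jr r) (Ar r))"
    unfolding ftr_def by (rule digit_system_sum)
  finally show ?thesis .
qed

end

lemma digit_system_pairs:
  assumes dg: "digit_system R {..<n} (\<lambda>r. {..<N r}) dg"
  shows "digit_system R (pairs n) (\<lambda>r. pairs (N r)) (\<lambda>r (a, b). (dg r a, dg r b))"
  unfolding digit_system_def
proof (intro conjI allI)
  show "finite R" using dg by (simp add: digit_system_def)
  show "finite (pairs n)" by (rule finite_pairs)
  fix h :: "nat \<Rightarrow> nat \<times> nat \<Rightarrow> complex"
  have "(\<Sum>x\<in>pairs n. \<Prod>r\<in>R. h r (case x of (a, b) \<Rightarrow> (dg r a, dg r b))) =
      (\<Sum>a<n. \<Sum>b<n. \<Prod>r\<in>R. h r (dg r a, dg r b))"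
    by (simp add: sum_pairs)
  also have "\<dots> = (\<Sum>a<n. \<Prod>r\<in>R. \<Sum>y<N r. h r (dg r a, y))"
    by (intro sum.cong refl digit_system_sum[OF dg, of "\<lambda>r y. h r (dg r _, y)"])
  also have "\<dots> = (\<Prod>r\<in>R. \<Sum>x<N r. \<Sum>y<N r. h r (x, y))"
    by (rule digit_system_sum[OF dg, of "\<lambda>r x. \<Sum>y<N r. h r (x, y)"])
  finally show "(\<Sum>x\<in>pairs n. \<Prod>r\<in>R. h r (case x of (a, b) \<Rightarrow> (dg r a, dg r b))) =
      (\<Prod>r\<in>R. \<Sum>w\<in>pairs (N r). h r w)"
    by (simp add: sum_pairs)
next
  show "\<forall>x\<in>pairs n. \<forall>y\<in>pairs n. (\<forall>r\<in>R. (case x of (a, b) \<Rightarrow> (dg r a, dg r b)) =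
      (case y of (a, b) \<Rightarrow> (dg r a, dg r b))) \<longrightarrow> x = y"
    using dg unfolding digit_system_def pairs_def by auto
  show "\<forall>x\<in>pairs n. \<forall>r\<in>R. (case x of (a, b) \<Rightarrow> (dg r a, dg r b)) \<in> pairs (N r)"
    using dg unfolding digit_system_def pairs_def by auto
qed

text \<open>Matrix products, powers, traces, partial traces and X \<mapsto> 1 \<otimes> X are all
  compatible with tensor products, and both sides of \<open>factorising\<close> are products of such
  expressions.\<close>

theorem factorising_product:
  assumes dg: "digit_system R {..<n} (\<lambda>r. {..<N r}) dg"
    and prod: "product_fmat R (pairs n) (\<lambda>r (a, b). (dg r a, dg r b)) \<Lambda> \<Lambda>r"
    and fac: "\<And>r. r \<in> R \<Longrightarrow> factorising (N r) (\<Lambda>r r)"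
  shows "factorising n \<Lambda>"
proof -
  let ?d2 = "\<lambda>r (a, b). (dg r a, dg r b)"
  note dg2 = digit_system_pairs[OF dg]
  have ptr: "product_fmat R {..<n} dg (ptr n A) (\<lambda>r. ptr (N r) (Ar r))"
    if "product_fmat R (pairs n) ?d2 A Ar" for A Ar
    unfolding product_fmat_def
  proof (intro ballI)
    fix b b' assume b: "b \<in> {..<n}" "b' \<in> {..<n}"
    have "ptr n A b b' = (\<Sum>a<n. \<Prod>r\<in>R. Ar r (dg r a, dg r b) (dg r a, dg r b'))"
      using that b by (simp add: ptr_def product_fmat_def pairs_def)
    also have "\<dots> = (\<Prod>r\<in>R. ptr (N r) (Ar r) (dg r b) (dg r b'))"
      unfolding ptr_def by (rule digit_system_sum[OF dg, of "\<lambda>r a. Ar r (a, dg r b) (a, dg r b')"])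
    finally show "ptr n A b b' = (\<Prod>r\<in>R. ptr (N r) (Ar r) (dg r b) (dg r b'))" .
  qed
  have tens: "product_fmat R (pairs n) ?d2 (tens X) (\<lambda>r. tens (Xr r))"
    if "product_fmat R {..<n} dg X Xr" for X Xr
    unfolding product_fmat_def
  proof (intro ballI)
    fix x y assume "x \<in> pairs n" "y \<in> pairs n"
    moreover obtain a b a' b' where xy: "x = (a, b)" "y = (a', b')" by (cases x, cases y) auto
    ultimately have lt: "a \<in> {..<n}" "b \<in> {..<n}" "a' \<in> {..<n}" "b' \<in> {..<n}" by (auto simp: pairs_def)
    have "(\<Prod>r\<in>R. tens (Xr r) (?d2 r x) (?d2 r y)) =
        (\<Prod>r\<in>R. if dg r a = dg r a' then Xr r (dg r b) (dg r b') else 0)"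
      by (simp add: xy tens_def cong: if_cong)
    also have "\<dots> = (if a = a' then \<Prod>r\<in>R. Xr r (dg r b) (dg r b') else 0)"
      by (rule product_fmat_delta[OF dg lt(1,3)])
    also have "\<dots> = tens X x y"
      using that lt by (simp add: xy tens_def product_fmat_def)
    finally show "tens X x y = (\<Prod>r\<in>R. tens (Xr r) (?d2 r x) (?d2 r y))" ..
  qed
  let ?D = "ptr n \<Lambda>" and ?Dr = "\<lambda>r. ptr (N r) (\<Lambda>r r)"
  have D: "product_fmat R {..<n} dg ?D ?Dr" by (rule ptr[OF prod])
  have Dp: "product_fmat R {..<n} dg (fpow {..<n} ?D g) (\<lambda>r. fpow {..<N r} (?Dr r) g)" for g
    by (rule product_fmat_fpow[OF dg D])
  have sp: "product_fmat R (pairs n) ?d2 (slot_prod n \<Lambda> gs) (\<lambda>r. slot_prod (N r) (\<Lambda>r r) gs)" for gs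
  proof (induction gs)
    case Nil
    show ?case using product_fmat_one[OF dg2] by simp
  next
    case (Cons g gs)
    show ?case
      using product_fmat_mm[OF dg2 prod product_fmat_mm[OF dg2 tens[OF Dp] Cons]] by simp
  qed
  show ?thesis
    unfolding factorising_def
  proof (intro allI impI)
    fix gs :: "nat list" and g b b' assume b: "b < n" "b' < n"
    have prods: "(\<Prod>h\<leftarrow>gs. \<Prod>r\<in>R. f r h) = (\<Prod>r\<in>R. \<Prod>h\<leftarrow>gs. (f r h :: complex))" for f
      by (induction gs) (simp_all add: prod.distrib)
    have "ftr {..<n} ?D ^ Suc (length gs) * ptr n (slot_prod n \<Lambda> (gs @ [g])) b b' =
      (\<Prod>r\<in>R. ftr {..<N r} (?Dr r) ^ Suc (length gs) * ptr (N r) (slot_prod (N r) (\<Lambda>r r) (gs @ [g])) (dg r b) (dg r b'))"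
      using product_fmat_ftr[OF dg D] ptr[OF sp, of "gs @ [g]"] b
      by (simp add: product_fmat_def prod.distrib prod_power_distrib)
    also have "\<dots> = (\<Prod>r\<in>R. ftr (pairs (N r)) (fpow (pairs (N r)) (\<Lambda>r r) (Suc (length gs))) *
       (\<Prod>h\<leftarrow>gs. ftr {..<N r} (fpow {..<N r} (?Dr r) (Suc h))) * fpow {..<N r} (?Dr r) (Suc g) (dg r b) (dg r b'))"
    proof (intro prod.cong refl)
      fix r assume r: "r \<in> R"
      then have "dg r b < N r" "dg r b' < N r" using dg b unfolding digit_system_def by auto
      then show "ftr {..<N r} (?Dr r) ^ Suc (length gs) * ptr (N r) (slot_prod (N r) (\<Lambda>r r) (gs @ [g])) (dg r b) (dg r b') =
        ftr (pairs (N r)) (fpow (pairs (N r)) (\<Lambda>r r) (Suc (length gs))) *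
       (\<Prod>h\<leftarrow>gs. ftr {..<N r} (fpow {..<N r} (?Dr r) (Suc h))) * fpow {..<N r} (?Dr r) (Suc g) (dg r b) (dg r b')"
        using fac[OF r] unfolding factorising_def by blast
    qed
    also have "\<dots> = ftr (pairs n) (fpow (pairs n) \<Lambda> (Suc (length gs))) *
       (\<Prod>h\<leftarrow>gs. ftr {..<n} (fpow {..<n} ?D (Suc h))) * fpow {..<n} ?D (Suc g) b b'"
    proof -
      have 1: "ftr (pairs n) (fpow (pairs n) \<Lambda> (Suc (length gs))) =
          (\<Prod>r\<in>R. ftr (pairs (N r)) (fpow (pairs (N r)) (\<Lambda>r r) (Suc (length gs))))"
        by (rule product_fmat_ftr[OF dg2 product_fmat_fpow[OF dg2 prod]])
      have 2: "ftr {..<n} (fpow {..<n} ?D h) = (\<Prod>r\<in>R. ftr {..<N r} (fpow {..<N r} (?Dr r) h))" for h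
        by (rule product_fmat_ftr[OF dg Dp])
      have 3: "fpow {..<n} ?D (Suc g) b b' = (\<Prod>r\<in>R. fpow {..<N r} (?Dr r) (Suc g) (dg r b) (dg r b'))"
        using Dp[of "Suc g"] b unfolding product_fmat_def by auto
      show ?thesis unfolding 1 2 3 prods by (simp only: prod.distrib)
    qed
    finally show "ftr {..<n} ?D ^ Suc (length gs) * ptr n (slot_prod n \<Lambda> (gs @ [g])) b b' =
       ftr (pairs n) (fpow (pairs n) \<Lambda> (Suc (length gs))) *
       (\<Prod>h\<leftarrow>gs. ftr {..<n} (fpow {..<n} ?D (Suc h))) * fpow {..<n} ?D (Suc g) b b'" .
  qed
qed

section \<open>The possible shapes of a single colour\<close>

lemma mm_cong:
  assumes "\<And>x y. x \<in> J \<Longrightarrow> y \<in> J \<Longrightarrow> A x y = A' x y" "\<And>x y. x \<in> J \<Longrightarrow> y \<in> J \<Longrightarrow> B x y = B' x y"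
    and "x \<in> J" "y \<in> J"
  shows "mm J A B x y = mm J A' B' x y"
  using assms by (simp add: mm_def)

lemma mm_cmult: "mm J (\<lambda>x y. c * A x y) B = (\<lambda>x y. c * mm J A B x y)"
  "mm J A (\<lambda>x y. c * B x y) = (\<lambda>x y. c * mm J A B x y)"
  by (simp_all add: mm_def fun_eq_iff sum_distrib_left mult_ac)

lemma ftr_cmult: "ftr J (\<lambda>x y. c * A x y) = c * ftr J A"
  by (simp add: ftr_def sum_distrib_left)

lemma ftr_cong: "(\<And>x. x \<in> J \<Longrightarrow> A x x = B x x) \<Longrightarrow> ftr J A = ftr J B"
  by (simp add: ftr_def)

text \<open>If D is \<open>c\<close> times the identity, the inserted powers of D come out as
  scalars and \<open>slot_prod\<close> becomes a power of \<Lambda>. With L factors and exponents of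
  total E, both sides are e c^(E+L) N^L times the identity.\<close>

lemma factorising_scalar:
  assumes D: "\<And>b b'. b < N \<Longrightarrow> b' < N \<Longrightarrow> ptr N \<Lambda> b b' = c * one_fmat b b'"
    and pw: "\<And>l. \<exists>e. \<forall>b<N. \<forall>b'<N. ptr N (fpow (pairs N) \<Lambda> (Suc l)) b b' = e * one_fmat b b'"
  shows "factorising N \<Lambda>"
proof -
  let ?J = "pairs N" and ?D = "ptr N \<Lambda>"
  have Dp: "fpow {..<N} ?D g b b' = c ^ g * one_fmat b b'" if "b < N" "b' < N" for g b b'
    using that
  proof (induction g arbitrary: b b')
    case (Suc g)
    have "fpow {..<N} ?D (Suc g) b b' = mm {..<N} (\<lambda>x y. c * one_fmat x y) (\<lambda>x y. c ^ g * one_fmat x y) b b'"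
      unfolding fpow.simps using Suc D by (intro mm_cong) auto
    then show ?case using Suc.prems by (simp add: mm_cmult mm_one_left)
  qed simp
  have tens: "tens (fpow {..<N} ?D g) x y = c ^ g * one_fmat x y" if "x \<in> ?J" "y \<in> ?J" for g x y
    using that Dp[of "snd x" "snd y" g]
    by (auto simp: tens_def one_fmat_def pairs_def split: if_splits)
  have sp: "slot_prod N \<Lambda> gs x y = c ^ sum_list gs * fpow ?J \<Lambda> (length gs) x y"
    if "x \<in> ?J" "y \<in> ?J" for gs x y
    using that
  proof (induction gs arbitrary: x y)
    case (Cons g gs)
    have "mm ?J (tens (fpow {..<N} ?D g)) (slot_prod N \<Lambda> gs) z w =
        c ^ (g + sum_list gs) * fpow ?J \<Lambda> (length gs) z w" if "z \<in> ?J" "w \<in> ?J" for z w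
    proof -
      have "mm ?J (tens (fpow {..<N} ?D g)) (slot_prod N \<Lambda> gs) z w =
        mm ?J (\<lambda>x y. c ^ g * one_fmat x y) (\<lambda>x y. c ^ sum_list gs * fpow ?J \<Lambda> (length gs) x y) z w"
        using that Cons.IH tens by (intro mm_cong) auto
      then show ?thesis using that by (simp add: mm_cmult mm_one_left finite_pairs power_add)
    qed
    then have "slot_prod N \<Lambda> (g # gs) x y =
        mm ?J \<Lambda> (\<lambda>z w. c ^ (g + sum_list gs) * fpow ?J \<Lambda> (length gs) z w) x y"
      unfolding slot_prod.simps using Cons.prems by (intro mm_cong) auto
    then show ?case by (simp add: mm_cmult)
  qed simp
  have ftr1: "ftr {..<N} one_fmat = of_nat N" by (simp add: ftr_def one_fmat_def)
  have ftrD: "ftr {..<N} (fpow {..<N} ?D g) = c ^ g * of_nat N" for g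
  proof -
    have "ftr {..<N} (fpow {..<N} ?D g) = ftr {..<N} (\<lambda>x y. c ^ g * one_fmat x y)"
      by (intro ftr_cong) (simp add: Dp)
    then show ?thesis by (simp add: ftr_cmult ftr1)
  qed
  have ftrD1: "ftr {..<N} ?D = c * of_nat N"
  proof -
    have "ftr {..<N} ?D = ftr {..<N} (\<lambda>x y. c * one_fmat x y)"
      by (intro ftr_cong) (simp add: D)
    then show ?thesis by (simp add: ftr_cmult ftr1)
  qed
  show ?thesis
    unfolding factorising_def
  proof (intro allI impI)
    fix gs :: "nat list" and g b b' assume b: "b < N" "b' < N"
    let ?l = "length gs"
    obtain e where e: "\<And>b b'. b < N \<Longrightarrow> b' < N \<Longrightarrow> ptr N (fpow ?J \<Lambda> (Suc ?l)) b b' = e * one_fmat b b'"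
      using pw[of ?l] by blast
    have "ftr ?J (fpow ?J \<Lambda> (Suc ?l)) = ftr {..<N} (\<lambda>b b'. e * one_fmat b b')"
      unfolding ftr_ptr[symmetric] using e by (intro ftr_cong) auto
    then have tr: "ftr ?J (fpow ?J \<Lambda> (Suc ?l)) = e * of_nat N" by (simp add: ftr_cmult ftr1)
    have "ptr N (slot_prod N \<Lambda> (gs @ [g])) b b' = c ^ (sum_list gs + g) * ptr N (fpow ?J \<Lambda> (Suc ?l)) b b'"
      using b by (simp add: ptr_def sp pairs_def sum_distrib_left)
    then have 1: "ptr N (slot_prod N \<Lambda> (gs @ [g])) b b' = c ^ (sum_list gs + g) * (e * one_fmat b b')"
      using e b by simp
    have 2: "(\<Prod>h\<leftarrow>gs. ftr {..<N} (fpow {..<N} ?D (Suc h))) = c ^ sum_list gs * (c * of_nat N) ^ ?l"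
      unfolding ftrD by (induction gs) (simp_all add: power_add mult_ac)
    show "ftr {..<N} ?D ^ Suc ?l * ptr N (slot_prod N \<Lambda> (gs @ [g])) b b' =
      ftr ?J (fpow ?J \<Lambda> (Suc ?l)) * (\<Prod>h\<leftarrow>gs. ftr {..<N} (fpow {..<N} ?D (Suc h))) * fpow {..<N} ?D (Suc g) b b'"
      unfolding 1 2 tr ftrD1 Dp[OF b] by (simp add: power_add mult_ac)
  qed
qed

text \<open>The pairing of each leg with the opposite one.\<close>

lemma factorising_id:
  assumes \<Lambda>: "\<And>x y. x \<in> pairs N \<Longrightarrow> y \<in> pairs N \<Longrightarrow> \<Lambda> x y = one_fmat x y"
  shows "factorising N \<Lambda>"
proof -
  have ptr1: "ptr N A b b' = of_nat N * one_fmat b b'"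
    if "\<And>x y. x \<in> pairs N \<Longrightarrow> y \<in> pairs N \<Longrightarrow> A x y = one_fmat x y" "b < N" "b' < N" for A b b'
    using that by (auto simp: ptr_def pairs_def one_fmat_def)
  have "fpow (pairs N) \<Lambda> l x y = one_fmat x y" if "x \<in> pairs N" "y \<in> pairs N" for l x y
    using that
  proof (induction l arbitrary: x y)
    case (Suc l)
    have "fpow (pairs N) \<Lambda> (Suc l) x y = mm (pairs N) one_fmat one_fmat x y"
      unfolding fpow.simps using Suc \<Lambda> by (intro mm_cong) auto
    then show ?case using Suc.prems by (simp add: mm_one_left finite_pairs)
  qed simp
  then show ?thesis
    using \<Lambda> ptr1 by (intro factorising_scalar[where c = "of_nat N"]) blast+
qed

text \<open>The crossing pairing. Powers alternate between the identity and the flip, whose partial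
  traces are \<open>N\<close> and 1 times the identity.\<close>

lemma factorising_flip:
  assumes \<Lambda>: "\<And>a b c d. a < N \<Longrightarrow> b < N \<Longrightarrow> c < N \<Longrightarrow> d < N \<Longrightarrow>
    \<Lambda> (a, b) (c, d) = (if a = d \<and> b = c then 1 else 0)"
  shows "factorising N \<Lambda>"
proof -
  let ?J = "pairs N"
  have ptr1: "ptr N A b b' = of_nat N * one_fmat b b'"
    if "\<And>x y. x \<in> ?J \<Longrightarrow> y \<in> ?J \<Longrightarrow> A x y = one_fmat x y" "b < N" "b' < N" for A b b'
    using that by (auto simp: ptr_def pairs_def one_fmat_def)
  have ptrF: "ptr N A b b' = one_fmat b b'"
    if "\<And>x y. x \<in> ?J \<Longrightarrow> y \<in> ?J \<Longrightarrow> A x y = \<Lambda> x y" "b < N" "b' < N" for A b b'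
  proof -
    have "ptr N A b b' = (\<Sum>a<N. if a = b then one_fmat b b' else 0)"
      unfolding ptr_def using that \<Lambda> by (intro sum.cong) (auto simp: pairs_def one_fmat_def)
    then show ?thesis using that by simp
  qed
  have FF: "mm ?J \<Lambda> \<Lambda> x y = one_fmat x y" if "x \<in> ?J" "y \<in> ?J" for x y
  proof -
    obtain a b where x: "x = (a, b)" by (cases x)
    then have ab: "a < N" "b < N" using that by (auto simp: pairs_def)
    have "mm ?J \<Lambda> \<Lambda> x y = (\<Sum>z\<in>?J. if z = (b, a) then \<Lambda> (b, a) y else 0)"
      unfolding mm_def using ab \<Lambda> by (intro sum.cong) (auto simp: x pairs_def split: if_splits)
    also have "\<dots> = \<Lambda> (b, a) y" using ab finite_pairs by (simp add: pairs_def)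
    also have "\<dots> = one_fmat x y" using that ab \<Lambda> by (cases y) (auto simp: x pairs_def one_fmat_def)
    finally show ?thesis .
  qed
  have pw: "(\<forall>x\<in>?J. \<forall>y\<in>?J. fpow ?J \<Lambda> l x y = one_fmat x y) \<or> (\<forall>x\<in>?J. \<forall>y\<in>?J. fpow ?J \<Lambda> l x y = \<Lambda> x y)" for l
  proof (induction l)
    case (Suc l)
    then show ?case
    proof
      assume "\<forall>x\<in>?J. \<forall>y\<in>?J. fpow ?J \<Lambda> l x y = one_fmat x y"
      then have "mm ?J \<Lambda> (fpow ?J \<Lambda> l) x y = mm ?J \<Lambda> one_fmat x y" if "x \<in> ?J" "y \<in> ?J" for x y
        using that by (intro mm_cong) auto
      then show ?thesis by (simp add: mm_one_right finite_pairs)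
    next
      assume "\<forall>x\<in>?J. \<forall>y\<in>?J. fpow ?J \<Lambda> l x y = \<Lambda> x y"
      then have "mm ?J \<Lambda> (fpow ?J \<Lambda> l) x y = mm ?J \<Lambda> \<Lambda> x y" if "x \<in> ?J" "y \<in> ?J" for x y
        using that by (intro mm_cong) auto
      then show ?thesis by (simp add: FF)
    qed
  qed simp
  show ?thesis
  proof (rule factorising_scalar[where c = 1])
    show "ptr N \<Lambda> b b' = 1 * one_fmat b b'" if "b < N" "b' < N" for b b'
      using ptrF[of \<Lambda> b b'] that by simp
    fix l
    show "\<exists>e. \<forall>b<N. \<forall>b'<N. ptr N (fpow ?J \<Lambda> (Suc l)) b b' = e * one_fmat b b'"
      using pw[of "Suc l"]
    proof
      assume "\<forall>x\<in>?J. \<forall>y\<in>?J. fpow ?J \<Lambda> (Suc l) x y = one_fmat x y"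
      then show ?thesis using ptr1[of "fpow ?J \<Lambda> (Suc l)"] by (intro exI[of _ "of_nat N"]) blast
    next
      assume "\<forall>x\<in>?J. \<forall>y\<in>?J. fpow ?J \<Lambda> (Suc l) x y = \<Lambda> x y"
      then show ?thesis using ptrF[of "fpow ?J \<Lambda> (Suc l)"] by (intro exI[of _ 1]) (metis mult_1)
    qed
  qed
qed

text \<open>One string through all four legs: \<Lambda> is \<gamma> times the projection onto the
  span of the vectors e_a \<otimes> e_a, so positive powers change only the scalar.\<close>

lemma factorising_center:
  assumes \<Lambda>: "\<And>a b c d. a < N \<Longrightarrow> b < N \<Longrightarrow> c < N \<Longrightarrow> d < N \<Longrightarrow>
    \<Lambda> (a, b) (c, d) = (if a = b \<and> a = c \<and> a = d then \<gamma> else 0)"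
  shows "factorising N \<Lambda>"
proof -
  let ?J = "pairs N"
  have ptr: "ptr N A b b' = e * one_fmat b b'"
    if A: "\<And>a b c d. a < N \<Longrightarrow> b < N \<Longrightarrow> c < N \<Longrightarrow> d < N \<Longrightarrow>
      A (a, b) (c, d) = (if a = b \<and> a = c \<and> a = d then e else 0)" and b: "b < N" "b' < N" for A e b b'
  proof -
    have "ptr N A b b' = (\<Sum>a<N. if a = b then e * one_fmat b b' else 0)"
      unfolding ptr_def using A b by (intro sum.cong) (auto simp: one_fmat_def)
    then show ?thesis using b by simp
  qed
  have pw: "fpow ?J \<Lambda> (Suc l) (a, b) (c, d) = (if a = b \<and> a = c \<and> a = d then \<gamma> ^ Suc l else 0)"
    if "a < N" "b < N" "c < N" "d < N" for l a b c d
    using that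
  proof (induction l arbitrary: a b)
    case 0
    then show ?case
      using \<Lambda>[of a b c d] mm_one_right[OF finite_pairs, of "(c, d)" N \<Lambda>] by (simp add: pairs_def)
  next
    case (Suc l)
    have "fpow ?J \<Lambda> (Suc (Suc l)) (a, b) (c, d) =
        (\<Sum>z\<in>?J. if z = (a, a) then (if a = b \<and> a = c \<and> a = d then \<gamma> ^ Suc (Suc l) else 0) else 0)"
      unfolding fpow.simps(2)[of _ _ "Suc l"] mm_def[of _ \<Lambda>]
    proof (intro sum.cong refl)
      fix z assume "z \<in> ?J"
      moreover obtain z1 z2 where z: "z = (z1, z2)" by (cases z)
      ultimately have "z1 < N" "z2 < N" by (auto simp: pairs_def)
      then show "\<Lambda> (a, b) z * fpow ?J \<Lambda> (Suc l) z (c, d) =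
          (if z = (a, a) then (if a = b \<and> a = c \<and> a = d then \<gamma> ^ Suc (Suc l) else 0) else 0)"
        using Suc.prems Suc.IH[of z1 z2] \<Lambda>[of a b z1 z2] by (auto simp: z simp del: fpow.simps)
    qed
    then show ?case using Suc.prems finite_pairs by (simp add: pairs_def del: fpow.simps)
  qed
  show ?thesis
  proof (rule factorising_scalar[where c = \<gamma>])
    show "ptr N \<Lambda> b b' = \<gamma> * one_fmat b b'" if "b < N" "b' < N" for b b'
      using that \<Lambda> by (intro ptr) auto
    show "\<exists>e. \<forall>b<N. \<forall>b'<N. ptr N (fpow ?J \<Lambda> (Suc l)) b b' = e * one_fmat b b'" for l
      using ptr[OF pw] by blast
  qed
qed

text \<open>The left legs are joined to each other and so are the right ones, beads allowed:
  \<Lambda> has rank at most one and D is A transposed times B. Two consecutive factors meeting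
  across 1 \<otimes> D^h close up to the scalar Tr(D^(h+1)), and Tr(\<Lambda>^l) = (Tr D)^l for l at
  least 1.\<close>

lemma factorising_rank_one:
  assumes \<Lambda>: "\<And>a b c d. a < N \<Longrightarrow> b < N \<Longrightarrow> c < N \<Longrightarrow> d < N \<Longrightarrow> \<Lambda> (a, b) (c, d) = A a b * B c d"
  shows "factorising N \<Lambda>"
proof -
  let ?J = "pairs N" and ?D = "ptr N \<Lambda>"
  let ?Dp = "fpow {..<N} ?D"
  have D: "?D b b' = (\<Sum>a<N. A a b * B a b')" if "b < N" "b' < N" for b b'
    using that \<Lambda> by (simp add: ptr_def)
  have trD: "(\<Sum>z\<in>?J. A (fst z) (snd z) * B (fst z) (snd z)) = ftr {..<N} ?D"
    unfolding sum_pairs ftr_def by (subst sum.swap) (simp add: D)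
  have pw: "fpow ?J \<Lambda> (Suc l) x y = ftr {..<N} ?D ^ l * (A (fst x) (snd x) * B (fst y) (snd y))"
    if "x \<in> ?J" "y \<in> ?J" for l x y
    using that
  proof (induction l arbitrary: x)
    case 0
    then show ?case
      using mm_one_right[OF finite_pairs, of y N \<Lambda>] \<Lambda> by (auto simp: pairs_def)
  next
    case (Suc l)
    have "fpow ?J \<Lambda> (Suc (Suc l)) x y = (\<Sum>z\<in>?J. (A (fst z) (snd z) * B (fst z) (snd z)) *
        (ftr {..<N} ?D ^ l * (A (fst x) (snd x) * B (fst y) (snd y))))"
      unfolding fpow.simps(2)[of _ _ "Suc l"] mm_def[of _ \<Lambda>]
    proof (intro sum.cong refl)
      fix z assume z: "z \<in> ?J"
      have "\<Lambda> x z = A (fst x) (snd x) * B (fst z) (snd z)"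
        using \<Lambda>[of "fst x" "snd x" "fst z" "snd z"] Suc.prems z by (auto simp: pairs_def)
      then show "\<Lambda> x z * fpow ?J \<Lambda> (Suc l) z y = (A (fst z) (snd z) * B (fst z) (snd z)) *
        (ftr {..<N} ?D ^ l * (A (fst x) (snd x) * B (fst y) (snd y)))"
        using Suc.IH[OF z Suc.prems(2)] by (simp add: mult_ac del: fpow.simps)
    qed
    then show ?case unfolding sum_distrib_right[symmetric] trD by (simp add: mult_ac)
  qed
  have tr: "ftr ?J (fpow ?J \<Lambda> (Suc l)) = ftr {..<N} ?D ^ Suc l" for l
  proof -
    have "ftr ?J (fpow ?J \<Lambda> (Suc l)) = (\<Sum>z\<in>?J. ftr {..<N} ?D ^ l * (A (fst z) (snd z) * B (fst z) (snd z)))"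
      unfolding ftr_def[of ?J] by (intro sum.cong refl) (simp add: pw del: fpow.simps)
    then show ?thesis unfolding sum_distrib_left[symmetric] trD by simp
  qed
  have sp: "slot_prod N \<Lambda> (gs @ [g]) (a, b) (c, d) =
      A a b * (\<Prod>h\<leftarrow>gs. ftr {..<N} (?Dp (Suc h))) * (\<Sum>w<N. B c w * ?Dp g w d)"
    if "a < N" "b < N" "c < N" "d < N" for gs g a b c d
    using that
  proof (induction gs arbitrary: a b)
    case Nil
    have "slot_prod N \<Lambda> ([] @ [g]) (a, b) (c, d) = mm ?J \<Lambda> (tens (?Dp g)) (a, b) (c, d)"
      using Nil mm_one_right[OF finite_pairs, of "(c, d)" N] by (simp add: pairs_def flip: mm_assoc)
    also have "\<dots> = (\<Sum>z1<N. if z1 = c then A a b * (\<Sum>w<N. B c w * ?Dp g w d) else 0)"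
      unfolding mm_def[of _ \<Lambda>] sum_pairs using Nil \<Lambda>
      by (intro sum.cong refl) (auto simp: tens_def sum_distrib_left mult_ac)
    finally show ?case using Nil by simp
  next
    case (Cons h gs)
    let ?Y = "(\<Prod>h\<leftarrow>gs. ftr {..<N} (?Dp (Suc h))) * (\<Sum>w<N. B c w * ?Dp g w d)"
    have "slot_prod N \<Lambda> ((h # gs) @ [g]) (a, b) (c, d) = (\<Sum>z1<N. \<Sum>z2<N. \<Lambda> (a, b) (z1, z2) *
        (\<Sum>w1<N. \<Sum>w2<N. tens (?Dp h) (z1, z2) (w1, w2) * slot_prod N \<Lambda> (gs @ [g]) (w1, w2) (c, d)))"
      by (simp add: mm_def sum_pairs)
    also have "\<dots> = (\<Sum>z1<N. \<Sum>z2<N. (A a b * B z1 z2) * (\<Sum>w2<N. ?Dp h z2 w2 * (A z1 w2 * ?Y)))"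
    proof (intro sum.cong refl)
      fix z1 z2 assume z: "z1 \<in> {..<N}" "z2 \<in> {..<N}"
      have "(\<Sum>w1<N. \<Sum>w2<N. tens (?Dp h) (z1, z2) (w1, w2) * slot_prod N \<Lambda> (gs @ [g]) (w1, w2) (c, d)) =
        (\<Sum>w1<N. if w1 = z1 then (\<Sum>w2<N. ?Dp h z2 w2 * slot_prod N \<Lambda> (gs @ [g]) (z1, w2) (c, d)) else 0)"
        by (intro sum.cong refl) (auto simp: tens_def)
      also have "\<dots> = (\<Sum>w2<N. ?Dp h z2 w2 * (A z1 w2 * ?Y))"
        using z Cons by (simp add: mult.assoc)
      finally show "\<Lambda> (a, b) (z1, z2) *
        (\<Sum>w1<N. \<Sum>w2<N. tens (?Dp h) (z1, z2) (w1, w2) * slot_prod N \<Lambda> (gs @ [g]) (w1, w2) (c, d)) =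
        (A a b * B z1 z2) * (\<Sum>w2<N. ?Dp h z2 w2 * (A z1 w2 * ?Y))"
        using z Cons.prems \<Lambda> by simp
    qed
    also have "\<dots> = (\<Sum>z1<N. \<Sum>z2<N. \<Sum>w2<N. (A z1 w2 * B z1 z2) * ?Dp h z2 w2) * (A a b * ?Y)"
    proof -
      have "(\<Sum>z1<N. \<Sum>z2<N. (u * B z1 z2) * (\<Sum>w2<N. E z2 w2 * (A z1 w2 * Y))) =
          (\<Sum>z1<N. \<Sum>z2<N. \<Sum>w2<N. (A z1 w2 * B z1 z2) * E z2 w2) * (u * Y)" for u Y :: complex and E
        by (simp add: sum_distrib_left sum_distrib_right mult_ac)
      then show ?thesis .
    qed
    also have "(\<Sum>z1<N. \<Sum>z2<N. \<Sum>w2<N. (A z1 w2 * B z1 z2) * ?Dp h z2 w2) =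
        (\<Sum>w2<N. \<Sum>z2<N. \<Sum>z1<N. (A z1 w2 * B z1 z2) * ?Dp h z2 w2)"
      by (rule sum_reverse3)
    also have "\<dots> = ftr {..<N} (?Dp (Suc h))"
      by (simp add: ftr_def mm_def D sum_distrib_right)
    finally show ?case by (simp add: mult_ac del: fpow.simps)
  qed
  show ?thesis
    unfolding factorising_def
  proof (intro allI impI)
    fix gs :: "nat list" and g b b' assume b: "b < N" "b' < N"
    have "ptr N (slot_prod N \<Lambda> (gs @ [g])) b b' =
        (\<Prod>h\<leftarrow>gs. ftr {..<N} (?Dp (Suc h))) * (\<Sum>a<N. \<Sum>w<N. A a b * B a w * ?Dp g w b')"
      unfolding ptr_def[of N "slot_prod N \<Lambda> (gs @ [g])"]
      using b by (simp add: sp sum_distrib_left mult_ac del: fpow.simps)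
    also have "(\<Sum>a<N. \<Sum>w<N. A a b * B a w * ?Dp g w b') = ?Dp (Suc g) b b'"
      using b by (subst sum.swap) (simp add: mm_def D sum_distrib_right)
    finally show "ftr {..<N} ?D ^ Suc (length gs) * ptr N (slot_prod N \<Lambda> (gs @ [g])) b b' =
      ftr ?J (fpow ?J \<Lambda> (Suc (length gs))) * (\<Prod>h\<leftarrow>gs. ftr {..<N} (?Dp (Suc h))) * ?Dp (Suc g) b b'"
      unfolding tr by (simp only: mult.assoc)
  qed
qed

section \<open>Multi-indices as mixed-radix digits\<close>

lemma sum_div_mod:
  fixes f :: "nat \<Rightarrow> complex"
  shows "(\<Sum>a<N * q. f a) = (\<Sum>y<N. \<Sum>z<q. f (y * q + z))"
proof -
  have "(\<Sum>a<N * q. f a) = (\<Sum>y<N. sum f {y * q..<y * q + q})"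
    by (rule sum.nat_group[symmetric])
  also have "\<dots> = (\<Sum>y<N. \<Sum>z<q. f (y * q + z))"
  proof (rule sum.cong[OF refl])
    fix y
    show "sum f {y * q..<y * q + q} = (\<Sum>z<q. f (y * q + z))"
      using sum.shift_bounds_nat_ivl[of f 0 "y * q" q] by (simp add: atLeast0LessThan add.commute)
  qed
  finally show ?thesis .
qed

lemma mult_add_div: "z < q \<Longrightarrow> (y * q + z) div q = (y :: nat)"
  by (cases "q = 0") simp_all

lemma digit_add:
  assumes "r < length ns" "\<And>s. s < length ns \<Longrightarrow> ns ! s \<ge> 1"
  shows "digit ns r (y * prod_list ns + a) = digit ns r a"
proof -
  let ?M = "prod_list (drop (Suc r) ns)"
  have "prod_list ns = prod_list (take r ns @ ns ! r # drop (Suc r) ns)"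
    using id_take_nth_drop[OF assms(1)] by simp
  then have eq: "y * prod_list ns + a = (y * prod_list (take r ns) * ns ! r) * ?M + a"
    by simp
  have "0 \<notin> set (drop (Suc r) ns)"
  proof
    assume "0 \<in> set (drop (Suc r) ns)"
    then have "0 \<in> set ns" by (rule in_set_dropD)
    then obtain s where "s < length ns" "ns ! s = 0" by (auto simp: in_set_conv_nth)
    then show False using assms(2)[of s] by simp
  qed
  then have "?M \<noteq> 0" by (simp add: prod_list_zero_iff)
  then show ?thesis unfolding digit_def eq by simp
qed

lemma digit_Cons_0: "z < prod_list ns \<Longrightarrow> y < N \<Longrightarrow> digit (N # ns) 0 (y * prod_list ns + z) = y"
  by (simp add: digit_def mult_add_div)

lemma digit_Cons_Suc: "digit (N # ns) (Suc r) a = digit ns r a"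
  by (simp add: digit_def)

lemma digit_less:
  assumes "r < length ns" "\<And>s. s < length ns \<Longrightarrow> ns ! s \<ge> 1"
  shows "digit ns r a < ns ! r"
  using assms(2)[OF assms(1)] by (simp add: digit_def)

lemma digit_sum:
  fixes h :: "nat \<Rightarrow> nat \<Rightarrow> complex"
  assumes "\<And>s. s < length ns \<Longrightarrow> ns ! s \<ge> 1"
  shows "(\<Sum>a<prod_list ns. \<Prod>r<length ns. h r (digit ns r a)) = (\<Prod>r<length ns. \<Sum>y<ns ! r. h r y)"
  using assms
proof (induction ns arbitrary: h)
  case (Cons N ns)
  have pos: "\<And>s. s < length ns \<Longrightarrow> ns ! s \<ge> 1"
    using Cons.prems[of "Suc _"] by simp
  have "(\<Sum>a<prod_list (N # ns). \<Prod>r<length (N # ns). h r (digit (N # ns) r a)) =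
      (\<Sum>y<N. \<Sum>z<prod_list ns. \<Prod>r<Suc (length ns). h r (digit (N # ns) r (y * prod_list ns + z)))"
    by (simp add: sum_div_mod del: prod.lessThan_Suc)
  also have "\<dots> = (\<Sum>y<N. \<Sum>z<prod_list ns. h 0 y * (\<Prod>r<length ns. h (Suc r) (digit ns r z)))"
    unfolding prod.lessThan_Suc_shift using pos
    by (intro sum.cong refl arg_cong2[of _ _ _ _ "(*)"] prod.cong)
      (simp_all add: digit_Cons_0 digit_Cons_Suc digit_add)
  also have "\<dots> = (\<Sum>y<N. h 0 y) * (\<Prod>r<length ns. \<Sum>y<ns ! r. h (Suc r) y)"
    using Cons.IH[OF pos, of "\<lambda>r. h (Suc r)"] by (simp add: sum_distrib_right flip: sum_distrib_left)
  finally show ?case by (simp add: prod.lessThan_Suc_shift del: prod.lessThan_Suc)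
qed simp

lemma digit_inj:
  assumes "\<And>s. s < length ns \<Longrightarrow> ns ! s \<ge> 1"
    and "a < prod_list ns" "b < prod_list ns" "\<And>r. r < length ns \<Longrightarrow> digit ns r a = digit ns r b"
  shows "a = b"
  using assms
proof (induction ns arbitrary: a b)
  case (Cons N ns)
  let ?q = "prod_list ns"
  have pos: "\<And>s. s < length ns \<Longrightarrow> ns ! s \<ge> 1"
    using Cons.prems(1)[of "Suc _"] by simp
  have q: "?q > 0"
  proof (rule ccontr)
    assume "\<not> ?q > 0"
    then show False using Cons.prems(2) by (simp del: prod_list_zero_iff)
  qed
  have dm: "x = x div ?q * ?q + x mod ?q" for x by simp
  have lt: "a div ?q < N" "b div ?q < N"
    using Cons.prems(2,3) by (simp_all add: less_mult_imp_div_less)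
  have "digit (N # ns) 0 a = a div ?q" "digit (N # ns) 0 b = b div ?q"
    using lt by (simp_all add: digit_def)
  then have 1: "a div ?q = b div ?q" using Cons.prems(4)[of 0] by simp
  have "a mod ?q = b mod ?q"
  proof (rule Cons.IH[OF pos])
    fix r assume r: "r < length ns"
    have "digit ns r (a mod ?q) = digit ns r a" "digit ns r (b mod ?q) = digit ns r b"
      using digit_add[OF r pos, of "a div ?q" "a mod ?q"] digit_add[OF r pos, of "b div ?q" "b mod ?q"] by simp_all
    then show "digit ns r (a mod ?q) = digit ns r (b mod ?q)"
      using Cons.prems(4)[of "Suc r"] r by (simp add: digit_Cons_Suc)
  qed (use q in auto)
  with 1 dm show ?case by metis
qed simp

lemma digit_system_digit:
  assumes "\<And>s. s < length ns \<Longrightarrow> ns ! s \<ge> 1"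
  shows "digit_system {..<length ns} {..<prod_list ns} (\<lambda>r. {..<ns ! r}) (digit ns)"
  unfolding digit_system_def
  using digit_sum[of ns] digit_inj[of ns] digit_less[of _ ns] assms by auto

section \<open>Splitting a diagram into its colours\<close>

definition tensor_fmat :: "nat \<Rightarrow> complex mat \<Rightarrow> (nat \<times> nat) fmat" where
  "tensor_fmat n \<Lambda> x y = \<Lambda> $$ (fst x * n + snd x, fst y * n + snd y)"

text \<open>Within one colour, the upper and lower left legs read the two components of
  \<open>x\<close>, the upper and lower right legs those of \<open>y\<close>.\<close>

definition colour_index :: "nat \<Rightarrow> nat \<times> nat \<Rightarrow> nat \<times> nat \<Rightarrow> leg \<Rightarrow> nat" where
  "colour_index k x y l = (case l of LeftLeg p \<Rightarrow> if p < k then fst x else snd x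
     | RightLeg p \<Rightarrow> if p < k then fst y else snd y)"

definition colour_strings :: "nat list \<Rightarrow> diagram \<Rightarrow> nat \<Rightarrow> leg set set" where
  "colour_strings ns P r = {B \<in> strings P. \<forall>l\<in>B. leg_colour (length ns) l = r}"

definition colour_fmat :: "nat list \<Rightarrow> diagram \<Rightarrow> nat \<Rightarrow> (nat \<times> nat) fmat" where
  "colour_fmat ns P r x y =
     (\<Prod>B\<in>colour_strings ns P r. contribution ns P (colour_index (length ns) x y) B)"

context
  fixes ns :: "nat list" and P :: diagram
  assumes P: "is_diagram ns P" and pos: "\<And>s. s < length ns \<Longrightarrow> ns ! s \<ge> 1"
begin

lemma strings_partition: "partition_on (legs (length ns)) (strings P)"
  using P by (simp add: is_diagram_def)

lemma finite_strings: "finite (strings P)"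
  using finite_elements[OF _ strings_partition] by (simp add: legs_def)

lemma string_subset: "B \<in> strings P \<Longrightarrow> B \<subseteq> legs (length ns)" "B \<in> strings P \<Longrightarrow> B \<noteq> {}"
  using strings_partition by (auto simp: partition_on_def)

lemma string_props:
  assumes "B \<in> strings P"
  shows "even (card B)" "l \<in> B \<Longrightarrow> l' \<in> B \<Longrightarrow> leg_colour (length ns) l = leg_colour (length ns) l'"
    "card B = 2 \<Longrightarrow> B = {fst (ends P B), snd (ends P B)}"
proof -
  have "even (card B) \<and> (\<forall>l\<in>B. \<forall>l'\<in>B. leg_colour (length ns) l = leg_colour (length ns) l') \<and>
        (if card B = 2
         then B = {fst (ends P B), snd (ends P B)} \<and>
              bead P B \<in> carrier_mat (string_dim ns B) (string_dim ns B)
         else \<forall>l\<in>B. leg_bead P l \<in> carrier_mat (string_dim ns B) (string_dim ns B))"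
    using P assms unfolding is_diagram_def by blast
  then show "even (card B)" "l \<in> B \<Longrightarrow> l' \<in> B \<Longrightarrow> leg_colour (length ns) l = leg_colour (length ns) l'"
    "card B = 2 \<Longrightarrow> B = {fst (ends P B), snd (ends P B)}"
    by (meson, meson, simp)
qed

lemma leg_colour_less: "l \<in> legs k \<Longrightarrow> leg_colour k l < k"
  by (auto simp: legs_def colour_at_def)

lemma contribution_cong:
  assumes "B \<in> strings P" "\<And>l. l \<in> B \<Longrightarrow> u l = u' l"
  shows "contribution ns P u B = contribution ns P u' B"
proof (cases "card B = 2")
  case True
  then have "fst (ends P B) \<in> B" "snd (ends P B) \<in> B" using string_props(3)[OF assms(1)] by blast+
  then show ?thesis using True assms(2) by (simp add: contribution_def)
next
  case False
  then show ?thesis using assms(2) by (simp add: contribution_def cong: prod.cong)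
qed

lemma leg_index_colour:
  assumes "l \<in> legs (length ns)" and lt: "b < prod_list ns" "d < prod_list ns"
  shows "leg_index ns (a * prod_list ns + b) (c * prod_list ns + d) l =
    colour_index (length ns) (digit ns (leg_colour (length ns) l) a, digit ns (leg_colour (length ns) l) b)
      (digit ns (leg_colour (length ns) l) c, digit ns (leg_colour (length ns) l) d) l"
  using assms by (cases l) (auto simp: legs_def index_at_def colour_index_def mult_add_div)

text \<open>Every string has a single colour, so the product over strings can be grouped by colours,
  and the strings of colour \<open>r\<close> see only the \<open>r\<close>-th digits.\<close>

lemma product_diagram:
  "product_fmat {..<length ns} (pairs (prod_list ns)) (\<lambda>r (a, b). (digit ns r a, digit ns r b))
     (tensor_fmat (prod_list ns) (diagram_mat ns P)) (colour_fmat ns P)"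
  unfolding product_fmat_def
proof (intro ballI)
  fix x y assume "x \<in> pairs (prod_list ns)" "y \<in> pairs (prod_list ns)"
  moreover obtain a b c d where xy: "x = (a, b)" "y = (c, d)" by (cases x, cases y) auto
  ultimately have lt: "a < prod_list ns" "b < prod_list ns" "c < prod_list ns" "d < prod_list ns"
    by (auto simp: pairs_def)
  let ?n = "prod_list ns" and ?S = "colour_strings ns P"
  let ?u = "leg_index ns (a * ?n + b) (c * ?n + d)"
  have bound: "i * ?n + j < ?n * ?n" if "i < ?n" "j < ?n" for i j
  proof -
    have "i * ?n + j < Suc i * ?n" using that by simp
    also have "\<dots> \<le> ?n * ?n" using that by (intro mult_le_mono) auto
    finally show ?thesis .
  qed
  have cover: "strings P = (\<Union>r\<in>{..<length ns}. ?S r)"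
  proof (intro equalityI subsetI)
    fix B assume B: "B \<in> strings P"
    then obtain l where l: "l \<in> B" using string_subset by blast
    then have "leg_colour (length ns) l < length ns"
      by (intro leg_colour_less subsetD[OF string_subset(1)[OF B]])
    moreover have "B \<in> ?S (leg_colour (length ns) l)"
    proof -
      have "leg_colour (length ns) l' = leg_colour (length ns) l" if "l' \<in> B" for l'
        by (rule string_props(2)[OF B that l])
      then show ?thesis using B by (simp add: colour_strings_def)
    qed
    ultimately show "B \<in> (\<Union>r\<in>{..<length ns}. ?S r)" by blast
  qed (auto simp: colour_strings_def)
  have "tensor_fmat ?n (diagram_mat ns P) x y = (\<Prod>B\<in>strings P. contribution ns P ?u B)"
    using lt bound by (simp add: tensor_fmat_def diagram_mat_def xy)
  also have "\<dots> = (\<Prod>r<length ns. \<Prod>B\<in>?S r. contribution ns P ?u B)"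
    unfolding cover
  proof (rule prod.UNION_disjoint)
    show "\<forall>r\<in>{..<length ns}. finite (?S r)"
      using finite_strings by (auto simp: colour_strings_def)
    show "\<forall>i\<in>{..<length ns}. \<forall>j\<in>{..<length ns}. i \<noteq> j \<longrightarrow> ?S i \<inter> ?S j = {}"
    proof (intro ballI impI equals0I)
      fix i j B assume "i \<noteq> j" and B: "B \<in> ?S i \<inter> ?S j"
      then have "B \<noteq> {}" using string_subset(2)[of B] by (simp add: colour_strings_def)
      then obtain l where "l \<in> B" by blast
      then show False using B \<open>i \<noteq> j\<close> by (auto simp: colour_strings_def)
    qed
  qed simp
  also have "\<dots> = (\<Prod>r<length ns. colour_fmat ns P r (digit ns r a, digit ns r b) (digit ns r c, digit ns r d))"
    unfolding colour_fmat_def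
  proof (intro prod.cong refl contribution_cong)
    fix r B l assume B: "B \<in> ?S r" and l: "l \<in> B"
    then have "leg_colour (length ns) l = r" "l \<in> legs (length ns)"
      using string_subset by (auto simp: colour_strings_def)
    then show "?u l = colour_index (length ns) (digit ns r a, digit ns r b) (digit ns r c, digit ns r d) l"
      using leg_index_colour lt by blast
  qed (auto simp: colour_strings_def)
  finally show "tensor_fmat ?n (diagram_mat ns P) x y =
      (\<Prod>r<length ns. colour_fmat ns P r (case x of (a, b) \<Rightarrow> (digit ns r a, digit ns r b))
        (case y of (a, b) \<Rightarrow> (digit ns r a, digit ns r b)))"
    by (simp add: xy)
qed

text \<open>The function \<open>A\<close> absorbs the orientation of the string, reading the bead or
  its transpose.\<close>

lemma pair_contribution:
  assumes "B \<in> strings P" "B = {p, q}" "p \<noteq> q"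
  shows "\<exists>A. \<forall>u. contribution ns P u B = A (u p) (u q)"
proof -
  have c: "card B = 2" using assms by simp
  then have "{p, q} = {fst (ends P B), snd (ends P B)}"
    using string_props(3)[OF assms(1)] assms(2) by simp
  then consider "fst (ends P B) = p" "snd (ends P B) = q" | "fst (ends P B) = q" "snd (ends P B) = p"
    by (auto simp: doubleton_eq_iff)
  then show ?thesis
  proof cases
    case 1
    then show ?thesis using c by (intro exI[of _ "\<lambda>i j. bead P B $$ (i, j)"]) (simp add: contribution_def)
  next
    case 2
    then show ?thesis using c by (intro exI[of _ "\<lambda>i j. bead P B $$ (j, i)"]) (simp add: contribution_def)
  qed
qed

lemma undecorated_pair_contribution:
  assumes "B \<in> strings P" "B = {p, q}" "p \<noteq> q" "undecorated ns P B"
    and "u p < string_dim ns B" "u q < string_dim ns B"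
  shows "contribution ns P u B = (if u p = u q then 1 else 0)"
proof -
  have c: "card B = 2" using assms by simp
  then have "{p, q} = {fst (ends P B), snd (ends P B)}"
    using string_props(3)[OF assms(1)] assms(2) by simp
  then consider "fst (ends P B) = p" "snd (ends P B) = q" | "fst (ends P B) = q" "snd (ends P B) = p"
    by (auto simp: doubleton_eq_iff)
  then show ?thesis
    using c assms(4-) by cases (auto simp: contribution_def undecorated_def)
qed

text \<open>A colour owns four legs, at positions \<open>r\<close> and \<open>2 * k - 1 - r\<close>
  on each side, and strings have even size. So one string takes all four, or there are two pairs and
  the partner of the upper left leg decides between three pairings. Strings are through, hence
  undecorated, in every case except left with left and right with right, where beads do no
  harm.\<close>

lemma factorising_colour:
  assumes und: "\<forall>B\<in>strings P. through B \<longrightarrow> undecorated ns P B" and r: "r < length ns"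
  shows "factorising (ns ! r) (colour_fmat ns P r)"
proof -
  let ?k = "length ns" and ?S = "colour_strings ns P r" and ?N = "ns ! r"
  define r' where "r' = 2 * ?k - 1 - r"
  have r': "r' < 2 * ?k" "\<not> r' < ?k" "2 * ?k - 1 - r' = r" "r \<noteq> r'" using r by (auto simp: r'_def)
  define l1 l2 l3 l4 where l: "l1 = LeftLeg r" "l2 = LeftLeg r'" "l3 = RightLeg r" "l4 = RightLeg r'"
  let ?X = "{l1, l2, l3, l4}"
  have dist: "l1 \<noteq> l2" "l1 \<noteq> l3" "l1 \<noteq> l4" "l2 \<noteq> l3" "l2 \<noteq> l4" "l3 \<noteq> l4"
    using r' by (auto simp: l)
  have u: "colour_index ?k (a, b) (c, d) l1 = a" "colour_index ?k (a, b) (c, d) l2 = b"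
    "colour_index ?k (a, b) (c, d) l3 = c" "colour_index ?k (a, b) (c, d) l4 = d" for a b c d
    using r r' by (auto simp: colour_index_def l)
  have X: "{x \<in> legs ?k. leg_colour ?k x = r} = ?X"
    using r r' by (auto simp: legs_def colour_at_def l image_iff r'_def split: if_splits)
  have sub: "B \<subseteq> ?X" if "B \<in> ?S" for B
    using that string_subset(1)[of B] unfolding X[symmetric] by (auto simp: colour_strings_def)
  have in_strings: "B \<in> strings P" if "B \<in> ?S" for B using that by (simp add: colour_strings_def)
  have disj: "B = B'" if "B \<in> ?S" "B' \<in> ?S" "x \<in> B" "x \<in> B'" for B B' x
  proof -
    have "disjoint (strings P)" using strings_partition by (simp add: partition_on_def)
    then show ?thesis
      using in_strings[OF that(1)] in_strings[OF that(2)] that(3,4) unfolding disjoint_def by blast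
  qed
  have cover: "\<exists>B\<in>?S. x \<in> B" if "x \<in> ?X" for x
  proof -
    have "x \<in> {x \<in> legs ?k. leg_colour ?k x = r}" unfolding X by (rule that)
    then have x: "x \<in> legs ?k" "leg_colour ?k x = r" by simp_all
    then obtain B where B: "B \<in> strings P" "x \<in> B"
      using strings_partition unfolding partition_on_def by blast
    have "leg_colour ?k x' = r" if "x' \<in> B" for x'
      using string_props(2)[OF B(1) that B(2)] x(2) by simp
    then have "B \<in> ?S" using B(1) by (simp add: colour_strings_def)
    with B show ?thesis by blast
  qed
  have dim: "string_dim ns B = ?N" if B: "B \<in> ?S" for B
  proof -
    obtain x where "x \<in> B" using string_subset(2)[OF in_strings[OF B]] by blast
    then have "(THE s. \<forall>x\<in>B. leg_colour ?k x = s) = r"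
      using B by (intro the_equality) (auto simp: colour_strings_def)
    then show ?thesis by (simp add: string_dim_def)
  qed
  have card: "card B = 2 \<or> card B = 4" if "B \<in> ?S" for B
  proof -
    have "card B \<le> card ?X" using sub[OF that] by (intro card_mono) auto
    then have "card B \<le> 4" using dist by simp
    moreover have "card B \<noteq> 0"
      using sub[OF that] string_subset(2) in_strings[OF that] finite_subset[of B ?X] by auto
    moreover have "even (card B)" by (rule string_props(1)[OF in_strings[OF that]])
    ultimately show ?thesis by (auto elim!: evenE) presburger?
  qed
  obtain B1 where B1: "B1 \<in> ?S" "l1 \<in> B1" using cover by blast
  show ?thesis
  proof (cases "card B1 = 4")
    case True
    then have BX: "B1 = ?X" using sub[OF B1(1)] dist by (intro card_subset_eq) auto
    have S: "?S = {B1}"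
    proof -
      have "B = B1" if B: "B \<in> ?S" for B
      proof -
        obtain x where "x \<in> B" using string_subset(2)[OF in_strings[OF B]] by blast
        then show ?thesis using disj[OF B B1(1)] sub[OF B] BX by blast
      qed
      then show ?thesis using B1 by blast
    qed
    have "through B1" unfolding through_def BX l by blast
    then have bead: "leg_bead P x = 1\<^sub>m ?N" if "x \<in> B1" for x
      using und in_strings[OF B1(1)] True that dim[OF B1(1)] by (auto simp: undecorated_def)
    have "colour_fmat ns P r (a, b) (c, d) = (if a = b \<and> a = c \<and> a = d then center P B1 else 0)"
      if lt: "a < ?N" "b < ?N" "c < ?N" "d < ?N" for a b c d
    proof -
      have "colour_fmat ns P r (a, b) (c, d) = center P B1 *
          (\<Sum>y<?N. \<Prod>x\<in>B1. leg_bead P x $$ (y, colour_index ?k (a, b) (c, d) x))"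
        using True by (simp add: colour_fmat_def S contribution_def dim[OF B1(1)])
      also have "(\<Sum>y<?N. \<Prod>x\<in>B1. leg_bead P x $$ (y, colour_index ?k (a, b) (c, d) x)) =
          (\<Sum>y<?N. if y = a then (if a = b \<and> a = c \<and> a = d then 1 else 0) else 0)"
      proof (intro sum.cong refl)
        fix y assume y: "y \<in> {..<?N}"
        have "(\<Prod>x\<in>B1. leg_bead P x $$ (y, colour_index ?k (a, b) (c, d) x)) =
            (\<Prod>x\<in>?X. 1\<^sub>m ?N $$ (y, colour_index ?k (a, b) (c, d) x))"
          using bead BX by (intro prod.cong) auto
        also have "\<dots> = (if y = a then (if a = b \<and> a = c \<and> a = d then 1 else 0) else 0)"
          using dist lt y by (auto simp: u)
        finally show "(\<Prod>x\<in>B1. leg_bead P x $$ (y, colour_index ?k (a, b) (c, d) x)) = \<dots>" .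
      qed
      finally show ?thesis using lt by simp
    qed
    then show ?thesis by (rule factorising_center)
  next
    case False
    then have "card B1 = 2" using card[OF B1(1)] by simp
    then obtain q where q: "B1 = {l1, q}" "q \<noteq> l1"
      using B1(2) by (auto simp: card_2_iff doubleton_eq_iff)
    let ?C = "?X - B1"
    have q': "q \<in> {l2, l3, l4}" using sub[OF B1(1)] q by auto
    have cC: "card ?C = 2" using dist q' q(1) by (auto simp: insert_Diff_if)
    have other: "B = ?C" if "B \<in> ?S" "B \<noteq> B1" for B
    proof -
      have "B \<subseteq> ?C" using sub[OF that(1)] disj[OF that(1) B1(1)] that(2) by blast
      moreover then have "card B \<le> 2" using card_mono[of ?C B] cC by simp
      then have "card B = card ?C" using card[OF that(1)] cC by auto
      ultimately show ?thesis by (intro card_subset_eq) auto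
    qed
    have C: "?C \<in> ?S"
    proof -
      have "?C \<noteq> {}" using cC by (metis card.empty zero_neq_numeral)
      then obtain x where x: "x \<in> ?C" by blast
      then obtain B where "B \<in> ?S" "x \<in> B" using cover by blast
      with x other show ?thesis by blast
    qed
    have BC: "B1 \<noteq> ?C" using B1(2) by blast
    have S: "?S = {B1, ?C}" using other C B1(1) by blast
    have L: "colour_fmat ns P r x y = contribution ns P (colour_index ?k x y) B1 * contribution ns P (colour_index ?k x y) ?C" for x y
      unfolding colour_fmat_def S using BC by simp
    note s1 = in_strings[OF B1(1)] and sC = in_strings[OF C]
    consider "q = l2" | "q = l3" | "q = l4" using q' by blast
    then show ?thesis
    proof cases
      case 1
      have Ceq: "?C = {l3, l4}" unfolding q(1) 1 using dist by auto
      obtain A1 where A1: "\<And>u. contribution ns P u B1 = A1 (u l1) (u l2)"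
        using pair_contribution[OF s1, of l1 l2] q 1 dist by blast
      obtain A2 where A2: "\<And>u. contribution ns P u ?C = A2 (u l3) (u l4)"
        using pair_contribution[OF sC Ceq dist(6)] by blast
      show ?thesis
        by (rule factorising_rank_one[of _ _ A1 A2]) (simp add: L A1 A2 u)
    next
      case 2
      have Ceq: "?C = {l2, l4}" unfolding q(1) 2 using dist by auto
      have "through B1" unfolding q(1) 2 l through_def by auto
      moreover have "through ?C" unfolding Ceq unfolding l through_def by auto
      ultimately have und': "undecorated ns P B1" "undecorated ns P ?C" using und s1 sC by blast+
      have "colour_fmat ns P r x y = one_fmat x y" if xy: "x \<in> pairs ?N" "y \<in> pairs ?N" for x y
      proof -
        obtain a b c d where e: "x = (a, b)" "y = (c, d)" by (cases x, cases y) auto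
        have lt: "a < ?N" "b < ?N" "c < ?N" "d < ?N" using xy by (auto simp: pairs_def e)
        have 1: "contribution ns P (colour_index ?k x y) B1 = (if a = c then 1 else 0)"
          using undecorated_pair_contribution[OF s1 _ dist(2) und'(1), of "colour_index ?k x y"] q 2 lt
            dim[OF B1(1)]
          by (simp add: e u)
        have 2: "contribution ns P (colour_index ?k x y) ?C = (if b = d then 1 else 0)"
          using undecorated_pair_contribution[OF sC Ceq dist(5) und'(2), of "colour_index ?k x y"] lt
          by (simp add: e u dim[OF C])
        show ?thesis unfolding L 1 2 by (simp add: one_fmat_def e)
      qed
      then show ?thesis by (rule factorising_id)
    next
      case 3
      have Ceq: "?C = {l2, l3}" unfolding q(1) 3 using dist by auto
      have "through B1" unfolding q(1) 3 l through_def by auto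
      moreover have "through ?C" unfolding Ceq unfolding l through_def by auto
      ultimately have und': "undecorated ns P B1" "undecorated ns P ?C" using und s1 sC by blast+
      have "colour_fmat ns P r (a, b) (c, d) = (if a = d \<and> b = c then 1 else 0)"
        if lt: "a < ?N" "b < ?N" "c < ?N" "d < ?N" for a b c d
      proof -
        let ?u = "colour_index ?k (a, b) (c, d)"
        have 1: "contribution ns P ?u B1 = (if a = d then 1 else 0)"
          using undecorated_pair_contribution[OF s1 _ dist(3) und'(1), of ?u] q 3 lt dim[OF B1(1)]
          by (simp add: u)
        have 2: "contribution ns P ?u ?C = (if b = c then 1 else 0)"
          using undecorated_pair_contribution[OF sC Ceq dist(4) und'(2), of ?u] lt
          by (simp add: u dim[OF C])
        show ?thesis unfolding L 1 2 by simp
      qed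
      then show ?thesis by (rule factorising_flip)
    qed
  qed
qed

theorem factorising_diagram:
  assumes "\<forall>B\<in>strings P. through B \<longrightarrow> undecorated ns P B"
  shows "factorising (prod_list ns) (tensor_fmat (prod_list ns) (diagram_mat ns P))"
  by (rule factorising_product[OF digit_system_digit[OF pos] product_diagram])
    (auto intro: factorising_colour[OF assms])

end

section \<open>Eigenvalue laws\<close>

lemma mat_adjoint_index:
  "i < dim_col A \<Longrightarrow> j < dim_row A \<Longrightarrow> mat_adjoint A $$ (i, j) = cnj (A $$ (j, i))" for A :: "complex mat"
  by (simp add: mat_adjoint_def mat_of_rows_index)

lemma pow_mat_Suc_left:
  assumes "A \<in> carrier_mat n n"
  shows "A ^\<^sub>m Suc k = A * A ^\<^sub>m k"
proof (induction k)
  case 0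
  then show ?case using assms by simp
next
  case (Suc k)
  have "A ^\<^sub>m Suc (Suc k) = A * A ^\<^sub>m k * A" using Suc by simp
  also have "\<dots> = A * (A ^\<^sub>m k * A)"
    using assms pow_carrier_mat[OF assms] by (intro assoc_mult_mat) auto
  finally show ?case by simp
qed

lemma pow_mat_smult:
  fixes A :: "complex mat"
  assumes "A \<in> carrier_mat n n"
  shows "(c \<cdot>\<^sub>m A) ^\<^sub>m k = c ^ k \<cdot>\<^sub>m A ^\<^sub>m k"
proof (induction k)
  case 0
  then show ?case using assms by (intro eq_matI) auto
next
  case (Suc k)
  have "(c \<cdot>\<^sub>m A) ^\<^sub>m Suc k = (c ^ k \<cdot>\<^sub>m A ^\<^sub>m k) * (c \<cdot>\<^sub>m A)" using Suc by simp
  also have "\<dots> = c \<cdot>\<^sub>m (c ^ k \<cdot>\<^sub>m A ^\<^sub>m k * A)"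
    using assms pow_carrier_mat[OF assms, of k] by (intro mult_smult_distrib) auto
  also have "c ^ k \<cdot>\<^sub>m A ^\<^sub>m k * A = c ^ k \<cdot>\<^sub>m (A ^\<^sub>m k * A)"
    using assms pow_carrier_mat[OF assms, of k] by (intro mult_smult_assoc_mat) auto
  also have "c \<cdot>\<^sub>m (c ^ k \<cdot>\<^sub>m (A ^\<^sub>m k * A)) = c ^ Suc k \<cdot>\<^sub>m (A ^\<^sub>m Suc k)"
    by (intro eq_matI) auto
  finally show ?case .
qed

lemma ntr_smult: "ntr (c \<cdot>\<^sub>m A) = c * ntr A" if "A \<in> carrier_mat n n"
  using that by (simp add: ntr_def sum_distrib_left)

lemma mult_mat_entry:
  "A \<in> carrier_mat n m \<Longrightarrow> B \<in> carrier_mat m l \<Longrightarrow> i < n \<Longrightarrow> j < l \<Longrightarrow>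
    (A * B) $$ (i, j) = (\<Sum>k<m. A $$ (i, k) * B $$ (k, j))"
  by (simp add: scalar_prod_def atLeast0LessThan)

lemma fpow_cong:
  assumes "\<And>x y. x \<in> J \<Longrightarrow> y \<in> J \<Longrightarrow> A x y = B x y" "x \<in> J" "y \<in> J"
  shows "fpow J A g x y = fpow J B g x y"
  using assms(2)
proof (induction g arbitrary: x)
  case (Suc g)
  then show ?case using assms by (simp add: mm_def)
qed simp

lemma pow_mat_entry:
  assumes "A \<in> carrier_mat n n" "i < n" "j < n"
  shows "(A ^\<^sub>m k) $$ (i, j) = fpow {..<n} (\<lambda>i j. A $$ (i, j)) k i j"
  using assms(2)
proof (induction k arbitrary: i)
  case 0
  then show ?case using assms by (simp add: one_fmat_def)
next
  case (Suc k)
  have "(A ^\<^sub>m Suc k) $$ (i, j) = (\<Sum>l<n. A $$ (i, l) * (A ^\<^sub>m k) $$ (l, j))"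
    unfolding pow_mat_Suc_left[OF assms(1)]
    using assms Suc.prems pow_carrier_mat[OF assms(1), of k] by (intro mult_mat_entry) auto
  then show ?case using Suc by (simp add: mm_def)
qed

lemma hermitian_eigenvalue_real:
  fixes A :: "complex mat"
  assumes A: "A \<in> carrier_mat n n" and herm: "mat_adjoint A = A" and ev: "eigenvalue A k"
  shows "cnj k = k"
proof -
  obtain v where v: "v \<in> carrier_vec n" "v \<noteq> 0\<^sub>v n" "A *\<^sub>v v = k \<cdot>\<^sub>v v"
    using ev A by (auto simp: eigenvalue_def eigenvector_def)
  let ?s = "\<Sum>i<n. v $ i * cnj (v $ i)"
  let ?t = "\<Sum>i<n. \<Sum>j<n. cnj (v $ i) * A $$ (i, j) * v $ j"
  have "?t = (\<Sum>i<n. cnj (v $ i) * (A *\<^sub>v v) $ i)"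
    using A v(1) by (intro sum.cong refl)
      (simp add: scalar_prod_def sum_distrib_left mult.assoc atLeast0LessThan)
  also have "\<dots> = k * ?s"
    using v by (simp add: sum_distrib_left mult_ac)
  finally have t: "?t = k * ?s" .
  have adj: "cnj (A $$ (i, j)) = A $$ (j, i)" if "i < n" "j < n" for i j
    using mat_adjoint_index[of j A i] A herm that by simp
  have "cnj ?t = (\<Sum>i<n. \<Sum>j<n. cnj (v $ j) * A $$ (j, i) * v $ i)"
    by (simp add: adj mult_ac)
  also have "\<dots> = ?t" by (rule sum.swap)
  finally have "cnj ?t = ?t" .
  then have "cnj (k * ?s) = k * ?s" unfolding t .
  moreover have "cnj ?s = ?s" by (simp add: mult.commute)
  ultimately have "cnj k * ?s = k * ?s" by (simp only: complex_cnj_mult)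
  moreover have "?s \<noteq> 0"
  proof -
    obtain i where i: "i < n" "v $ i \<noteq> 0"
      using v(1,2) by (metis carrier_vecD eq_vecI index_zero_vec)
    have s: "?s = of_real (\<Sum>i<n. (cmod (v $ i))\<^sup>2)"
      by (simp only: complex_norm_square[symmetric] of_real_sum of_real_power)
    have "0 < (cmod (v $ i))\<^sup>2" using i by simp
    also have "\<dots> \<le> (\<Sum>i<n. (cmod (v $ i))\<^sup>2)"
      using i by (intro member_le_sum) auto
    finally show ?thesis unfolding s by (simp only: of_real_eq_0_iff)
  qed
  ultimately show ?thesis by simp
qed

lemma upper_triangular_pow_diag:
  fixes B :: "complex mat"
  assumes B: "B \<in> carrier_mat n n" and ut: "upper_triangular B"
  shows "upper_triangular (B ^\<^sub>m k) \<and> (\<forall>i<n. (B ^\<^sub>m k) $$ (i, i) = (B $$ (i, i)) ^ k)"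
proof (induction k)
  case 0
  then show ?case using B by auto
next
  case (Suc k)
  note Bk = pow_carrier_mat[OF B, of k]
  have e: "(B ^\<^sub>m Suc k) $$ (i, j) = (\<Sum>l<n. B $$ (i, l) * (B ^\<^sub>m k) $$ (l, j))" if "i < n" "j < n" for i j
    unfolding pow_mat_Suc_left[OF B] using B Bk that by (intro mult_mat_entry) auto
  have zB: "B $$ (i, j) = 0" if "j < i" "i < n" for i j using ut B that by auto
  have zBk: "(B ^\<^sub>m k) $$ (i, j) = 0" if "j < i" "i < n" for i j
    using Suc Bk that unfolding upper_triangular_def by auto
  have "(B ^\<^sub>m Suc k) $$ (i, j) = 0" if "j < i" "i < n" for i j
  proof -
    have "B $$ (i, l) * (B ^\<^sub>m k) $$ (l, j) = 0" if "l < n" for l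
      using zB[of l i] zBk[of j l] \<open>j < i\<close> \<open>i < n\<close> that by (cases "l < i") auto
    then show ?thesis unfolding e[OF \<open>i < n\<close> less_trans[OF that]] by (intro sum.neutral) auto
  qed
  moreover have "(B ^\<^sub>m Suc k) $$ (i, i) = (B $$ (i, i)) ^ Suc k" if "i < n" for i
  proof -
    have "B $$ (i, l) * (B ^\<^sub>m k) $$ (l, i) = (if l = i then (B $$ (i, i)) ^ Suc k else 0)" if "l < n" for l
      using zB[of l i] zBk[of i l] \<open>i < n\<close> that Suc by (cases l i rule: linorder_cases) auto
    then show ?thesis unfolding e[OF that that] using that by (simp del: pow_mat.simps power_Suc)
  qed
  ultimately show ?case
    using pow_carrier_mat[OF B, of "Suc k"] unfolding upper_triangular_def by auto
qed

lemma sum_list_eq_sum_set: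
  "(\<Sum>a\<leftarrow>as. f a) = (\<Sum>a\<in>set as. of_nat (count_list as a) * f a)" for f :: "'b \<Rightarrow> 'c :: comm_semiring_1"
proof -
  have "(\<Sum>a\<leftarrow>as. f a) = (\<Sum>a\<in>A. of_nat (count_list as a) * f a)" if "finite A" "set as \<subseteq> A" for A
    using that(2)
  proof (induction as)
    case (Cons b as)
    have "(\<Sum>a\<in>A. of_nat (count_list (b # as) a) * f a) =
        (\<Sum>a\<in>A. (if a = b then f a else 0) + of_nat (count_list as a) * f a)"
      by (intro sum.cong) (auto simp: distrib_right)
    then show ?case using Cons that(1) by (simp add: sum.distrib)
  qed simp
  then show ?thesis by simp
qed

text \<open>Schur triangularisation puts the eigenvalues, with algebraic multiplicity, on a
  diagonal, and powers of a triangular matrix have the powers of its diagonal. As \<open>A\<close>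
  is Hermitian its eigenvalues are real, so the real part taken in \<open>eigenvalue_law\<close>
  loses nothing.\<close>

theorem moments_eigenvalue_law:
  fixes A :: "complex mat"
  assumes A: "A \<in> carrier_mat n n" and n: "n \<ge> 1" and herm: "mat_adjoint A = A"
  shows "finite (set_pmf (eigenvalue_law A))"
    and "moments (measure_pmf (eigenvalue_law A)) p = ntr (A ^\<^sub>m p)"
proof -
  obtain as where as: "char_poly A = (\<Prod>a\<leftarrow>as. [:- a, 1:])" "length as = n"
    using char_poly_factorized[OF A] by blast
  have "0 \<notin> set (map (\<lambda>a. [:- a, 1:]) as)" by auto
  from proots_prod_list[OF this]
  have "proots (char_poly A) = (\<Sum>a\<leftarrow>as. {#a#})"
    unfolding as(1) by (simp add: o_def)
  also have "\<dots> = mset as" by (induction as) simp_all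
  finally have roots: "proots (char_poly A) = mset as" .
  have ne: "mset as \<noteq> {#}" using n as(2) by auto
  have law: "eigenvalue_law A = map_pmf Re (pmf_of_multiset (mset as))"
    by (simp add: eigenvalue_law_def roots)
  show "finite (set_pmf (eigenvalue_law A))"
    unfolding law using ne by (simp add: set_pmf_of_multiset)
  obtain B P Q where schur: "schur_decomposition A as = (B, P, Q)" by (cases "schur_decomposition A as") auto
  from schur_decomposition[OF A as(1) schur]
  have wit: "similar_mat_wit A B P Q" and ut: "upper_triangular B" and diag: "diag_mat B = as" by auto
  have c: "B \<in> carrier_mat n n" "P \<in> carrier_mat n n" "Q \<in> carrier_mat n n" and QP: "Q * P = 1\<^sub>m n"
    using similar_mat_witD2[OF A wit] by auto
  note Bp = pow_carrier_mat[OF c(1), of p]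
  have pow: "A ^\<^sub>m p = P * B ^\<^sub>m p * Q" by (rule similar_mat_wit_pow_id[OF wit])
  have "(\<Sum>i<n. (A ^\<^sub>m p) $$ (i, i)) = (\<Sum>i<n. \<Sum>k<n. \<Sum>j<n. P $$ (i, j) * (B ^\<^sub>m p) $$ (j, k) * Q $$ (k, i))"
  proof (intro sum.cong refl)
    fix i assume i: "i \<in> {..<n}"
    have "(A ^\<^sub>m p) $$ (i, i) = (\<Sum>k<n. (P * B ^\<^sub>m p) $$ (i, k) * Q $$ (k, i))"
      unfolding pow using c Bp i by (intro mult_mat_entry) auto
    also have "\<dots> = (\<Sum>k<n. (\<Sum>j<n. P $$ (i, j) * (B ^\<^sub>m p) $$ (j, k)) * Q $$ (k, i))"
      using c Bp i by (intro sum.cong refl arg_cong2[of _ _ _ _ "(*)"] mult_mat_entry) auto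
    finally show "(A ^\<^sub>m p) $$ (i, i) = (\<Sum>k<n. \<Sum>j<n. P $$ (i, j) * (B ^\<^sub>m p) $$ (j, k) * Q $$ (k, i))"
      by (simp add: sum_distrib_right)
  qed
  also have "\<dots> = (\<Sum>j<n. \<Sum>k<n. \<Sum>i<n. P $$ (i, j) * (B ^\<^sub>m p) $$ (j, k) * Q $$ (k, i))"
    by (rule sum_reverse3)
  also have "\<dots> = (\<Sum>j<n. \<Sum>k<n. (B ^\<^sub>m p) $$ (j, k) * (Q * P) $$ (k, j))"
  proof (intro sum.cong refl)
    fix j k assume jk: "j \<in> {..<n}" "k \<in> {..<n}"
    then have "(Q * P) $$ (k, j) = (\<Sum>i<n. Q $$ (k, i) * P $$ (i, j))"
      using c by (intro mult_mat_entry) auto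
    then show "(\<Sum>i<n. P $$ (i, j) * (B ^\<^sub>m p) $$ (j, k) * Q $$ (k, i)) = (B ^\<^sub>m p) $$ (j, k) * (Q * P) $$ (k, j)"
      by (simp add: sum_distrib_left mult_ac)
  qed
  also have "\<dots> = (\<Sum>j<n. \<Sum>k<n. if k = j then (B ^\<^sub>m p) $$ (j, j) else 0)"
    unfolding QP by (intro sum.cong refl) auto
  also have "\<dots> = (\<Sum>j<n. (as ! j) ^ p)"
  proof (intro sum.cong refl)
    fix j assume j: "j \<in> {..<n}"
    have "as ! j = B $$ (j, j)" using j c(1) unfolding diag[symmetric] by (simp add: diag_mat_def)
    then show "(\<Sum>k<n. if k = j then (B ^\<^sub>m p) $$ (j, j) else 0) = (as ! j) ^ p"
      using upper_triangular_pow_diag[OF c(1) ut, of p] j by simp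
  qed
  also have "\<dots> = (\<Sum>a\<leftarrow>as. a ^ p)"
    using as(2) by (simp add: sum_list_sum_nth atLeast0LessThan)
  finally have tr: "ntr (A ^\<^sub>m p) = (\<Sum>a\<leftarrow>as. a ^ p) / of_nat n"
    using carrier_matD(1)[OF A] by (simp add: ntr_def)
  have real: "of_real (Re a) = a" if "a \<in> set as" for a
  proof -
    have "poly (char_poly A) a = 0"
      using that unfolding as(1) by (auto simp: poly_prod_list prod_list_zero_iff)
    then have "eigenvalue A a" using eigenvalue_root_char_poly[OF A] by simp
    from hermitian_eigenvalue_real[OF A herm this] show ?thesis
      by (simp add: complex_eq_iff)
  qed
  have "(LINT x|measure_pmf (eigenvalue_law A). x ^ p) = (LINT a|measure_pmf (pmf_of_multiset (mset as)). Re a ^ p)"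
    unfolding law by simp
  also have "\<dots> = (\<Sum>a\<in>set as. Re a ^ p * (count (mset as) a / real n))"
    using ne as(2) by (subst integral_measure_pmf_real[of "set as"]) (auto simp: set_pmf_of_multiset pmf_of_multiset)
  finally have "moments (measure_pmf (eigenvalue_law A)) p =
      of_real (\<Sum>a\<in>set as. Re a ^ p * (count (mset as) a / real n))"
    by (simp add: moments_def)
  also have "\<dots> = (\<Sum>a\<in>set as. of_nat (count_list as a) * a ^ p) / of_nat n"
    unfolding of_real_sum sum_divide_distrib
    by (intro sum.cong refl) (simp add: real count_mset)
  also have "(\<Sum>a\<in>set as. of_nat (count_list as a) * a ^ p) = (\<Sum>a\<leftarrow>as. a ^ p)"
    by (simp add: sum_list_eq_sum_set)
  finally show "moments (measure_pmf (eigenvalue_law A)) p = ntr (A ^\<^sub>m p)"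
    using tr by simp
qed

section \<open>The limit law\<close>

lemma mult_add_less: "x < d \<Longrightarrow> a < n \<Longrightarrow> x * n + a < d * n" for x a d n :: nat
proof -
  assume "x < d" "a < n"
  then have "x * n + a < Suc x * n" by simp
  also have "\<dots> \<le> d * n" using \<open>x < d\<close> by (intro mult_le_mono1) simp
  finally show ?thesis .
qed

lemma mult_add_inject: "b < n \<Longrightarrow> e < n \<Longrightarrow> x * n + b = y * n + e \<longleftrightarrow> x = y \<and> b = e" for x y b e n :: nat
  by (metis add_left_cancel mult_add_div)

section \<open>Traces of powers as contractions over words\<close>

lemma tensor_pow_entry:
  assumes L: "\<Lambda> \<in> carrier_mat (n * n) (n * n)" and "a < n" "b < n" "c < n" "e < n"
  shows "(\<Lambda> ^\<^sub>m s) $$ (a * n + b, c * n + e) = fpow (pairs n) (tensor_fmat n \<Lambda>) s (a, b) (c, e)"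
  using assms(2,3)
proof (induction s arbitrary: a b)
  case 0
  then show ?case using L assms mult_add_less[of a n b n] mult_add_less[of c n e n]
    by (simp add: one_fmat_def mult_add_inject)
next
  case (Suc s)
  have "(\<Lambda> ^\<^sub>m Suc s) $$ (a * n + b, c * n + e) =
      (\<Sum>l<n * n. \<Lambda> $$ (a * n + b, l) * (\<Lambda> ^\<^sub>m s) $$ (l, c * n + e))"
    unfolding pow_mat_Suc_left[OF L]
    by (rule mult_mat_entry[OF L pow_carrier_mat[OF L]])
      (use Suc.prems assms(4,5) in \<open>auto intro: mult_add_less\<close>)
  also have "\<dots> = (\<Sum>y<n. \<Sum>z<n. tensor_fmat n \<Lambda> (a, b) (y, z) *
      fpow (pairs n) (tensor_fmat n \<Lambda>) s (y, z) (c, e))"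
    unfolding sum_div_mod by (intro sum.cong refl) (simp add: Suc.IH, simp add: tensor_fmat_def)
  finally show ?case by (simp add: mm_def sum_pairs)
qed

lemma ntr_tensor_pow:
  assumes "\<Lambda> \<in> carrier_mat (n * n) (n * n)"
  shows "ntr (\<Lambda> ^\<^sub>m s) = ftr (pairs n) (fpow (pairs n) (tensor_fmat n \<Lambda>) s) / of_nat (n * n)"
proof -
  have "(\<Sum>i<n * n. (\<Lambda> ^\<^sub>m s) $$ (i, i)) = ftr (pairs n) (fpow (pairs n) (tensor_fmat n \<Lambda>) s)"
    unfolding sum_div_mod ftr_def sum_pairs using assms
    by (intro sum.cong refl tensor_pow_entry) auto
  then show ?thesis using carrier_matD(1)[OF assms] by (simp add: ntr_def)
qed

text \<open>Expanding the power over words of index pairs (a, c) separates the tensor factors: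
  \<Lambda> enters through \<open>word_chain\<close> alone, the Gaussian matrix through
  \<open>gram_word\<close> alone.\<close>

lemma block_pow_entry:
  assumes X: "X \<in> carrier_mat (d * n) (d * n)"
    and entry: "\<And>x z b e. x < d \<Longrightarrow> z < d \<Longrightarrow> b < n \<Longrightarrow> e < n \<Longrightarrow>
      X $$ (x * n + b, z * n + e) = (\<Sum>a<n. \<Sum>c<n. L (a, b) (c, e) * gram K g a c x z)"
    and "x < d" "y < d" "b < n" "e < n"
  shows "(X ^\<^sub>m p) $$ (x * n + b, y * n + e) =
    word_total n p (\<lambda>w. word_chain n L w b e * gram_word d K g w x y)"
  using assms(3,5)
proof (induction p arbitrary: x b)
  case 0
  then show ?case using X assms mult_add_less[of x d b n] mult_add_less[of y d e n]
    by (simp add: one_fmat_def mult_add_inject)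
next
  case (Suc p)
  let ?Y = "\<lambda>z b2. word_total n p (\<lambda>w. word_chain n L w b2 e * gram_word d K g w z y)"
  have "(X ^\<^sub>m Suc p) $$ (x * n + b, y * n + e) =
      (\<Sum>l<d * n. X $$ (x * n + b, l) * (X ^\<^sub>m p) $$ (l, y * n + e))"
    unfolding pow_mat_Suc_left[OF X]
    by (rule mult_mat_entry[OF X pow_carrier_mat[OF X]])
      (use Suc.prems assms(4,6) in \<open>auto intro: mult_add_less\<close>)
  also have "\<dots> = (\<Sum>z<d. \<Sum>b2<n. \<Sum>a<n. \<Sum>c<n. L (a, b) (c, b2) * gram K g a c x z * ?Y z b2)"
    unfolding sum_div_mod using Suc.prems
    by (intro sum.cong refl) (simp add: Suc.IH entry sum_distrib_right)
  also have "\<dots> = (\<Sum>a<n. \<Sum>c<n. \<Sum>b2<n. \<Sum>z<d. L (a, b) (c, b2) * gram K g a c x z * ?Y z b2)"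
    by (subst sum_reverse4) (rule sum.swap)
  also have "\<dots> = word_total n (Suc p) (\<lambda>w. word_chain n L w b e * gram_word d K g w x y)"
  proof -
    have "(\<Sum>b2<n. \<Sum>z<d. L (a, b) (c, b2) * gram K g a c x z * ?Y z b2) =
        word_total n p (\<lambda>w. word_chain n L ((a, c) # w) b e * gram_word d K g ((a, c) # w) x y)" for a c
    proof -
      have "(\<Sum>b2<n. \<Sum>z<d. L (a, b) (c, b2) * gram K g a c x z * ?Y z b2) =
          word_total n p (\<lambda>w. \<Sum>b2<n. \<Sum>z<d. L (a, b) (c, b2) * gram K g a c x z *
            (word_chain n L w b2 e * gram_word d K g w z y))"
        by (simp only: word_total_sum word_total_cmult)
      also have "\<dots> = word_total n p (\<lambda>w. word_chain n L ((a, c) # w) b e * gram_word d K g ((a, c) # w) x y)"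
        by (intro word_total_cong) (simp add: sum_product mult_ac)
      finally show ?thesis .
    qed
    then show ?thesis by (simp only: word_total.simps)
  qed
  finally show ?case .
qed

lemma ntr_block_pow:
  assumes X: "X \<in> carrier_mat (d * n) (d * n)"
    and entry: "\<And>x z b e. x < d \<Longrightarrow> z < d \<Longrightarrow> b < n \<Longrightarrow> e < n \<Longrightarrow>
      X $$ (x * n + b, z * n + e) = (\<Sum>a<n. \<Sum>c<n. L (a, b) (c, e) * gram K g a c x z)"
  shows "ntr (X ^\<^sub>m p) =
    (\<Sum>b<n. word_total n p (\<lambda>w. word_chain n L w b b * word_trace d K g w)) / of_nat n"
proof -
  have "(\<Sum>i<d * n. (X ^\<^sub>m p) $$ (i, i)) =
      (\<Sum>x<d. \<Sum>b<n. word_total n p (\<lambda>w. word_chain n L w b b * gram_word d K g w x x))"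
    unfolding sum_div_mod by (intro sum.cong refl block_pow_entry[OF X entry]) auto
  also have "\<dots> = (\<Sum>b<n. \<Sum>x<d. word_total n p (\<lambda>w. word_chain n L w b b * gram_word d K g w x x))"
    by (rule sum.swap)
  finally have "ntr (X ^\<^sub>m p) =
      (\<Sum>b<n. \<Sum>x<d. word_total n p (\<lambda>w. word_chain n L w b b * gram_word d K g w x x)) / of_nat d / of_nat n"
    using carrier_matD(1)[OF X] by (simp add: ntr_def)
  also have "\<dots> = (\<Sum>b<n. word_total n p (\<lambda>w. word_chain n L w b b * word_trace d K g w)) / of_nat n"
  proof -
    have "(\<Sum>x<d. word_total n p (\<lambda>w. word_chain n L w b b * gram_word d K g w x x)) / of_nat d =
        word_total n p (\<lambda>w. word_chain n L w b b * word_trace d K g w)" for b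
      unfolding word_total_sum[symmetric]
      unfolding divide_inverse word_total_cmult_right[symmetric]
      by (intro word_total_cong) (simp add: word_trace_def sum_distrib_left sum_distrib_right divide_inverse mult.assoc)
    then show ?thesis by (simp add: sum_divide_distrib)
  qed
  finally show ?thesis .
qed

lemma integral_word_total:
  fixes f :: "'w \<Rightarrow> (nat \<times> nat) list \<Rightarrow> complex"
  assumes "\<And>w. set w \<subseteq> {..<n} \<times> {..<n} \<Longrightarrow> integrable M (\<lambda>\<omega>. f \<omega> w)"
  shows "integrable M (\<lambda>\<omega>. word_total n p (\<lambda>w. c w * f \<omega> w)) \<and>
    (LINT \<omega>|M. word_total n p (\<lambda>w. c w * f \<omega> w)) = word_total n p (\<lambda>w. c w * (LINT \<omega>|M. f \<omega> w))"
  using assms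
proof (induction p arbitrary: f c)
  case 0
  then show ?case using 0[of "[]"] by simp
next
  case (Suc p)
  have IH: "integrable M (\<lambda>\<omega>. word_total n p (\<lambda>w. c ((a, b) # w) * f \<omega> ((a, b) # w)))"
    "(LINT \<omega>|M. word_total n p (\<lambda>w. c ((a, b) # w) * f \<omega> ((a, b) # w))) =
      word_total n p (\<lambda>w. c ((a, b) # w) * (LINT \<omega>|M. f \<omega> ((a, b) # w)))"
    if "a < n" "b < n" for a b
    using Suc.IH[of "\<lambda>\<omega> w. f \<omega> ((a, b) # w)" "\<lambda>w. c ((a, b) # w)"] Suc.prems that by auto
  have inner: "integrable M (\<lambda>\<omega>. \<Sum>b<n. word_total n p (\<lambda>w. c ((a, b) # w) * f \<omega> ((a, b) # w)))"
    if "a < n" for a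
    using IH(1)[OF that] by (intro Bochner_Integration.integrable_sum) simp
  have "(LINT \<omega>|M. word_total n (Suc p) (\<lambda>w. c w * f \<omega> w)) =
      (\<Sum>a<n. (LINT \<omega>|M. (\<Sum>b<n. word_total n p (\<lambda>w. c ((a, b) # w) * f \<omega> ((a, b) # w)))))"
    unfolding word_total.simps using inner by (intro Bochner_Integration.integral_sum) simp
  also have "\<dots> = (\<Sum>a<n. \<Sum>b<n. (LINT \<omega>|M. word_total n p (\<lambda>w. c ((a, b) # w) * f \<omega> ((a, b) # w))))"
    using IH(1) by (intro sum.cong refl Bochner_Integration.integral_sum) simp
  also have "\<dots> = word_total n (Suc p) (\<lambda>w. c w * (LINT \<omega>|M. f \<omega> w))"
    unfolding word_total.simps using IH(2) by (intro sum.cong refl) simp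
  finally show ?case
    unfolding word_total.simps(2)[of n p "\<lambda>w. c w * f _ w"]
    using IH(1) by (auto intro!: Bochner_Integration.integrable_sum)
qed

lemma block_modified_wishart_entry:
  assumes A: "G \<in> carrier_mat (d * n) (d * m)" and assoc: "associated_matrix n \<phi> \<Lambda>"
    and "x < d" "z < d" "b < n" "e < n"
  shows "block_modified d n \<phi> ((1 / of_nat (d * m)) \<cdot>\<^sub>m (G * mat_adjoint G)) $$ (x * n + b, z * n + e) =
    (\<Sum>a<n. \<Sum>c<n. tensor_fmat n \<Lambda> (a, b) (c, e) * gram (d * m) (\<lambda>x a k. G $$ (x * n + a, k)) a c x z)"
proof -
  let ?W = "(1 / of_nat (d * m)) \<cdot>\<^sub>m (G * mat_adjoint G)"
  have adj: "mat_adjoint G \<in> carrier_mat (d * m) (d * n)"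
    using carrier_matD[OF A] by (intro carrier_matI) (simp_all add: mat_adjoint_def)
  have W: "?W $$ (x * n + a, z * n + c) = gram (d * m) (\<lambda>x a k. G $$ (x * n + a, k)) a c x z"
    if "a < n" "c < n" for a c
  proof -
    have lt: "x * n + a < d * n" "z * n + c < d * n" using that assms by (auto intro: mult_add_less)
    then have "?W $$ (x * n + a, z * n + c) = 1 / of_nat (d * m) * (G * mat_adjoint G) $$ (x * n + a, z * n + c)"
      using carrier_matD[OF A] carrier_matD[OF adj] by (subst index_smult_mat) auto
    also have "(G * mat_adjoint G) $$ (x * n + a, z * n + c) =
        (\<Sum>k<d * m. G $$ (x * n + a, k) * mat_adjoint G $$ (k, z * n + c))"
      by (rule mult_mat_entry[OF A adj lt])
    also have "\<dots> = (\<Sum>k<d * m. G $$ (x * n + a, k) * cnj (G $$ (z * n + c, k)))"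
      using lt A by (intro sum.cong refl) (simp add: mat_adjoint_index)
    finally show ?thesis by (simp add: gram_def)
  qed
  have "block_modified d n \<phi> ?W $$ (x * n + b, z * n + e) = \<phi> (block_of n ?W x z) $$ (b, e)"
    using assms mult_add_less[of x d b n] mult_add_less[of z d e n]
    by (simp add: block_modified_def mult_add_div)
  also have "\<dots> = (\<Sum>a<n. \<Sum>c<n. \<Lambda> $$ (a * n + b, c * n + e) * block_of n ?W x z $$ (a, c))"
    using assoc assms(5,6) unfolding associated_matrix_def by (simp add: block_of_def)
  also have "\<dots> = (\<Sum>a<n. \<Sum>c<n. tensor_fmat n \<Lambda> (a, b) (c, e) * ?W $$ (x * n + a, z * n + c))"
    by (intro sum.cong refl) (simp add: block_of_def tensor_fmat_def del: index_smult_mat)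
  also have "\<dots> = (\<Sum>a<n. \<Sum>c<n. tensor_fmat n \<Lambda> (a, b) (c, e) *
      gram (d * m) (\<lambda>x a k. G $$ (x * n + a, k)) a c x z)"
    by (intro sum.cong refl arg_cong2[of _ _ _ _ "(*)"] W) auto
  finally show ?thesis .
qed

lemma gaussian_blocks_wishart:
  assumes "complex_wishart M (d * n) (d * m) W" "d \<ge> 1" "m \<ge> 1"
  obtains G where "gaussian_blocks M ({..<d * n} \<times> {..<d * m}) (\<lambda>(x, y) \<omega>. G \<omega> $$ (x, y)) d n m"
    and "\<And>\<omega>. \<omega> \<in> space M \<Longrightarrow> G \<omega> \<in> carrier_mat (d * n) (d * m)"
    and "\<And>\<omega>. \<omega> \<in> space M \<Longrightarrow> W \<omega> = (1 / of_nat (d * m)) \<cdot>\<^sub>m (G \<omega> * mat_adjoint (G \<omega>))"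
proof -
  obtain G where ps: "prob_space M" and G: "complex_gaussian_matrix M (d * n) (d * m) G"
    and W: "\<forall>\<omega>\<in>space M. W \<omega> = (1 / of_nat (d * m)) \<cdot>\<^sub>m (G \<omega> * mat_adjoint (G \<omega>))"
    using assms(1) unfolding complex_wishart_def by blast
  show ?thesis
  proof (rule that)
    interpret prob_space M by (rule ps)
    show "gaussian_blocks M ({..<d * n} \<times> {..<d * m}) (\<lambda>(x, y) \<omega>. G \<omega> $$ (x, y)) d n m"
      using G assms(2,3) unfolding complex_gaussian_matrix_def
      by unfold_locales auto
  qed (use G W in \<open>auto simp: complex_gaussian_matrix_def\<close>)
qed

text \<open>Convergence of the moments for an arbitrary associated matrix; the diagram serves only
  to evaluate the limit.\<close>

theorem block_modified_wishart_limit: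
  fixes M :: "nat \<Rightarrow> 'w measure"
  assumes n: "n \<ge> 1" and m: "m \<ge> 1"
    and wishart: "\<And>d. d \<ge> 1 \<Longrightarrow> complex_wishart (M d) (d * n) (d * m) (W d)"
    and assoc: "associated_matrix n \<phi> \<Lambda>"
  shows "(\<lambda>d. LINT \<omega>|M d. ntr ((c \<cdot>\<^sub>m block_modified d n \<phi> (W d \<omega>)) ^\<^sub>m p)) \<longlonglongrightarrow>
    c ^ p * (ftr {..<n} (open_limit n m (tensor_fmat n \<Lambda>) p) / of_nat n)"
proof -
  let ?L = "tensor_fmat n \<Lambda>"
  have "\<exists>G. \<forall>d\<ge>1. gaussian_blocks (M d) ({..<d * n} \<times> {..<d * m}) (\<lambda>(x, y) \<omega>. G d \<omega> $$ (x, y)) d n m \<and>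
      (\<forall>\<omega>\<in>space (M d). G d \<omega> \<in> carrier_mat (d * n) (d * m) \<and>
        W d \<omega> = (1 / of_nat (d * m)) \<cdot>\<^sub>m (G d \<omega> * mat_adjoint (G d \<omega>)))"
  proof (intro choice allI)
    fix d
    show "\<exists>G. d \<ge> 1 \<longrightarrow> gaussian_blocks (M d) ({..<d * n} \<times> {..<d * m}) (\<lambda>(x, y) \<omega>. G \<omega> $$ (x, y)) d n m \<and>
      (\<forall>\<omega>\<in>space (M d). G \<omega> \<in> carrier_mat (d * n) (d * m) \<and>
        W d \<omega> = (1 / of_nat (d * m)) \<cdot>\<^sub>m (G \<omega> * mat_adjoint (G \<omega>)))"
    proof (cases "d \<ge> 1")
      case True
      from gaussian_blocks_wishart[OF wishart[OF True] True m] show ?thesis by metis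
    qed simp
  qed
  then obtain G where
    blocks: "\<And>d. d \<ge> 1 \<Longrightarrow> gaussian_blocks (M d) ({..<d * n} \<times> {..<d * m}) (\<lambda>(x, y) \<omega>. G d \<omega> $$ (x, y)) d n m" and
    G: "\<And>d \<omega>. d \<ge> 1 \<Longrightarrow> \<omega> \<in> space (M d) \<Longrightarrow> G d \<omega> \<in> carrier_mat (d * n) (d * m)" and
    W: "\<And>d \<omega>. d \<ge> 1 \<Longrightarrow> \<omega> \<in> space (M d) \<Longrightarrow> W d \<omega> = (1 / of_nat (d * m)) \<cdot>\<^sub>m (G d \<omega> * mat_adjoint (G d \<omega>))"
    by auto
  define t where "t d \<omega> = word_trace d (d * m) (\<lambda>x a k. G d \<omega> $$ (x * n + a, k))" for d \<omega>
  define E where "E d ws = (LINT \<omega>|M d. (\<Prod>w\<leftarrow>ws. t d \<omega> w))" for d ws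
  have E_eq: "E d ws = gaussian_blocks.trace_moment (M d) (\<lambda>(x, y) \<omega>. G d \<omega> $$ (x, y)) d n m ws"
    if "d \<ge> 1" for d ws
    unfolding E_def t_def gaussian_blocks.trace_moment_def[OF blocks[OF that]] by simp
  have lim: "(\<lambda>d. E d [w]) \<longlonglongrightarrow> limit_word m w" if "set w \<subseteq> {..<n} \<times> {..<n}" for w
  proof -
    have "(\<lambda>d. E d [w]) \<longlonglongrightarrow> (\<Prod>w\<leftarrow>[w]. limit_word m w)"
    proof (rule loop_equation_limit)
      fix d :: nat
      assume d: "d \<ge> 1"
      interpret gaussian_blocks "M d" "{..<d * n} \<times> {..<d * m}" "\<lambda>(x, y) \<omega>. G d \<omega> $$ (x, y)" d n m
        by (rule blocks[OF d])
      show "E d [] = 1" by (simp add: E_def prob_space)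
      show "E d ([] # ws) = E d ws" for ws by (simp add: E_def t_def word_trace_Nil[OF d])
      show "E d (((a, c) # r) # ws) = (if a = c then E d (r # ws) else 0) +
        (\<Sum>j<length r. if snd (r ! j) = a then
          E d (((fst (r ! j), c) # take j r) # drop (Suc j) r # ws) else 0) / of_nat m +
        (\<Sum>i<length ws. \<Sum>j<length (ws ! i). if snd (ws ! i ! j) = a then
          E d (((fst (ws ! i ! j), c) # r @ drop (Suc j) (ws ! i) @ take j (ws ! i)) # remove_nth i ws)
          else 0) / of_nat (d * d * m)"
        if "set r \<subseteq> {..<n} \<times> {..<n}" "a < n" "c < n" "\<Union> (set ` set ws) \<subseteq> {..<n} \<times> {..<n}" for a c r ws
        unfolding E_eq[OF d] by (rule loop_equation[OF that])
    qed (use that in auto)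
    then show ?thesis by simp
  qed
  have ev: "(LINT \<omega>|M d. ntr ((c \<cdot>\<^sub>m block_modified d n \<phi> (W d \<omega>)) ^\<^sub>m p)) =
      c ^ p * ((\<Sum>b<n. word_total n p (\<lambda>w. word_chain n ?L w b b * E d [w])) / of_nat n)"
    if d: "d \<ge> 1" for d
  proof -
    interpret gaussian_blocks "M d" "{..<d * n} \<times> {..<d * m}" "\<lambda>(x, y) \<omega>. G d \<omega> $$ (x, y)" d n m
      by (rule blocks[OF d])
    have int: "integrable (M d) (\<lambda>\<omega>. t d \<omega> w)" if "set w \<subseteq> {..<n} \<times> {..<n}" for w
      using traces_integrable[of "[w]"] that n by (simp add: t_def)
    note total = integral_word_total[of n "M d" "t d", OF int]
    have "(LINT \<omega>|M d. ntr ((c \<cdot>\<^sub>m block_modified d n \<phi> (W d \<omega>)) ^\<^sub>m p)) =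
        (LINT \<omega>|M d. c ^ p * ((\<Sum>b<n. word_total n p (\<lambda>w. word_chain n ?L w b b * t d \<omega> w)) / of_nat n))"
    proof (intro Bochner_Integration.integral_cong refl)
      fix \<omega>
      assume \<omega>: "\<omega> \<in> space (M d)"
      let ?X = "block_modified d n \<phi> (W d \<omega>)"
      have X: "?X \<in> carrier_mat (d * n) (d * n)" by (simp add: block_modified_def)
      have "ntr (?X ^\<^sub>m p) = (\<Sum>b<n. word_total n p (\<lambda>w. word_chain n ?L w b b * t d \<omega> w)) / of_nat n"
        unfolding t_def
        by (rule ntr_block_pow[OF X]) (simp only: W[OF d \<omega>] block_modified_wishart_entry[OF G[OF d \<omega>] assoc])
      then show "ntr ((c \<cdot>\<^sub>m ?X) ^\<^sub>m p) =
          c ^ p * ((\<Sum>b<n. word_total n p (\<lambda>w. word_chain n ?L w b b * t d \<omega> w)) / of_nat n)"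
        by (simp only: pow_mat_smult[OF X] ntr_smult[OF pow_carrier_mat[OF X]])
    qed
    also have "\<dots> = c ^ p * ((\<Sum>b<n. (LINT \<omega>|M d. word_total n p (\<lambda>w. word_chain n ?L w b b * t d \<omega> w))) / of_nat n)"
      using total by (simp add: Bochner_Integration.integral_sum)
    also have "\<dots> = c ^ p * ((\<Sum>b<n. word_total n p (\<lambda>w. word_chain n ?L w b b * E d [w])) / of_nat n)"
      using total by (simp add: E_def)
    finally show ?thesis .
  qed
  have "(\<lambda>d. c ^ p * ((\<Sum>b<n. word_total n p (\<lambda>w. word_chain n ?L w b b * E d [w])) / of_nat n)) \<longlonglongrightarrow>
      c ^ p * ((\<Sum>b<n. word_total n p (\<lambda>w. word_chain n ?L w b b * limit_word m w)) / of_nat n)"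
    using n by (intro tendsto_intros word_total_tendsto lim) auto
  then show ?thesis
    unfolding open_limit_def ftr_def
    \<comment> \<open>The expectation has been computed for \<open>d \<ge> 1\<close>, which suffices
      for the limit.\<close>
    by (rule Lim_transform_eventually) (auto simp: ev intro!: eventually_sequentiallyI[of 1])
qed

text \<open>Both a and b are centred, so (ab)^p with positive p is an alternating product of centred
  elements. In the recursion, \<open>free_mom \<kappa> \<beta> 1 q\<close>, the moment of b (ab)^q,
  vanishes for all \<open>q\<close>, and every term of
  \<open>block_mom \<kappa> \<beta> 0 l q\<close> contains such a factor.\<close>

lemma free_mom_trivial:
  assumes "\<kappa> 1 = 0" "\<beta> 1 = 0"
  shows "free_mom \<kappa> \<beta> 0 (Suc q) = 0"
proof -
  have block: "block_mom \<kappa> \<beta> 0 l q = 0" if "\<And>i. i \<le> q \<Longrightarrow> free_mom \<kappa> \<beta> 1 i = 0" for l q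
    unfolding block_mom.simps[of _ _ 0 l q] using that by simp
  have "free_mom \<kappa> \<beta> 1 q = 0" for q
  proof (induction q rule: less_induct)
    case (less q)
    show ?case
    proof (cases q)
      case 0
      then show ?thesis using assms by simp
    next
      case (Suc q')
      have "block_mom \<kappa> \<beta> 0 (Suc 1) j = 0" if "j < q'" for j
        using less that Suc by (intro block) simp
      then show ?thesis unfolding Suc free_mom.simps block_mom.simps[of _ _ 1 1 q']
        using assms(1) by simp
    qed
  qed
  then show ?thesis by (simp add: block)
qed

text \<open>All free cumulants of the free Poisson law of parameter c equal c. By homogeneity and
  additivity the \<open>l\<close>-th cumulant of the compound law is the \<open>l\<close>-th moment
  of the measure with weights \<open>w\<close>.\<close>

lemma compound_free_poisson_moment:
  assumes law: "compound_free_poisson_law S w s" and e: "e \<le> N"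
  shows "s e = height_moment N (\<lambda>l. \<Sum>z | w z > 0. of_real (w z) * of_real z ^ l) e 0"
proof -
  obtain \<alpha> where S: "tracial_ncps S" and fin: "finite {z. w z > 0}"
    and \<alpha>: "\<And>z. w z > 0 \<Longrightarrow> has_law S (\<alpha> z) (moments (free_poisson (w z)))"
    and free: "free_elements S \<alpha> {z. w z > 0}"
    and sum: "has_law S (\<Sum>z | w z > 0. scl S (complex_of_real z) (\<alpha> z)) s"
    using law unfolding compound_free_poisson_law_def by blast
  have "st S (\<alpha> z ^ i) = height_moment N (\<lambda>_. of_real (w z)) i 0" if "w z > 0" "i \<le> N" for z i
  proof (cases "i = 0")
    case True
    then show ?thesis by (simp add: st_one[OF S])
  next
    case False
    then show ?thesis using \<alpha>[OF that(1)] that moments_free_poisson[of "w z" i N]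
      by (simp add: has_law_def)
  qed
  then have "st S ((\<Sum>z | w z > 0. scl S (complex_of_real z) (\<alpha> z)) ^ e) =
      height_moment N (\<lambda>l. \<Sum>z | w z > 0. of_real (w z) * of_real z ^ l) e 0"
    by (intro free_sum_moment[OF S free fin _ e]) simp
  then show ?thesis using sum by (simp add: has_law_def)
qed

lemma free_mult_conv_moment:
  assumes "free_mult_conv_law T \<mu> \<beta> s"
    and "\<And>N e. e \<le> N \<Longrightarrow> \<mu> e = height_moment N \<kappa> e 0"
  shows "s p = free_mom \<kappa> \<beta> 0 p"
proof -
  obtain a b where T: "tracial_ncps T" and a: "has_law T a \<mu>" and b: "has_law T b \<beta>"
    and free: "free_elements T (\<lambda>i. if i then a else b) (UNIV :: bool set)"
    and s: "s p = st T ((a * b) ^ p)"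
    using assms(1) unfolding free_mult_conv_law_def by blast
  have "st T ((a * b) ^ p) = free_mom \<kappa> \<beta> 0 p"
  proof (rule free_product_moment[OF T free _ _ order_refl])
    show "st T (a ^ e) = height_moment (2 * p) \<kappa> e 0" if "e \<le> 2 * p" for e
      using a assms(2)[OF that] by (simp add: has_law_def)
    show "st T (b ^ e) = \<beta> e" for e using b by (simp add: has_law_def)
  qed
  then show ?thesis using s by simp
qed

lemma scaled_law_moments:
  fixes \<rho> :: "real pmf"
  assumes fin: "finite (set_pmf \<rho>)" and c: "c > 0"
  shows "(\<Sum>z | c * pmf \<rho> z > 0. of_real (c * pmf \<rho> z) * of_real z ^ l) =
    of_real c * moments (measure_pmf \<rho>) l"
proof -
  have set: "{z. c * pmf \<rho> z > 0} = set_pmf \<rho>"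
    using c by (simp add: set_pmf_eq' zero_less_mult_iff)
  have "(LINT x|measure_pmf \<rho>. x ^ l) = (\<Sum>z\<in>set_pmf \<rho>. z ^ l * pmf \<rho> z)"
    by (rule integral_measure_pmf_real[OF fin]) simp
  then have "moments (measure_pmf \<rho>) l = (\<Sum>z\<in>set_pmf \<rho>. of_real z ^ l * of_real (pmf \<rho> z))"
    by (simp add: moments_def)
  then show ?thesis
    unfolding set by (simp add: sum_distrib_left mult.commute mult.left_commute)
qed

lemma partial_trace_associated:
  assumes assoc: "associated_matrix n \<phi> \<Lambda>" and "b < n" "e < n"
  shows "\<phi> (1\<^sub>m n) $$ (b, e) = ptr n (tensor_fmat n \<Lambda>) b e"
proof -
  have "\<phi> (1\<^sub>m n) $$ (b, e) = (\<Sum>a<n. \<Sum>c<n. \<Lambda> $$ (a * n + b, c * n + e) * (1\<^sub>m n) $$ (a, c))"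
    using assoc assms(2,3) one_carrier_mat[of n] unfolding associated_matrix_def by blast
  also have "\<dots> = (\<Sum>a<n. \<Sum>c<n. if c = a then \<Lambda> $$ (a * n + b, a * n + e) else 0)"
    by (intro sum.cong refl) auto
  finally show ?thesis by (simp add: ptr_def tensor_fmat_def)
qed

text \<open>D inherits self-adjointness from \<Lambda>, so its eigenvalue law has the moments given
  by traces of powers.\<close>

lemma mat_adjoint_partial_trace:
  assumes L: "\<Lambda> \<in> carrier_mat (n * n) (n * n)" and adj: "mat_adjoint \<Lambda> = \<Lambda>"
    and D: "D \<in> carrier_mat n n"
    and entry: "\<And>b e. b < n \<Longrightarrow> e < n \<Longrightarrow> D $$ (b, e) = ptr n (tensor_fmat n \<Lambda>) b e"
  shows "mat_adjoint D = D"
proof (rule eq_matI)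
  show dim: "dim_row (mat_adjoint D) = dim_row D" "dim_col (mat_adjoint D) = dim_col D"
    using carrier_matD[OF D] by (simp_all add: mat_adjoint_def)
  fix b e assume "b < dim_row D" "e < dim_col D"
  then have be: "b < n" "e < n" using D by auto
  have "cnj (\<Lambda> $$ (a * n + e, a * n + b)) = \<Lambda> $$ (a * n + b, a * n + e)" if "a < n" for a
    using mat_adjoint_index[of "a * n + b" \<Lambda> "a * n + e"] adj L be that by (simp add: mult_add_less)
  then show "mat_adjoint D $$ (b, e) = D $$ (b, e)"
    using mat_adjoint_index[of b D e] D be by (simp add: entry ptr_def tensor_fmat_def)
qed

theorem theorem4p6:
  fixes k m n :: nat and ns :: "nat list"
    and M :: "nat \<Rightarrow> 'w measure" and W :: "nat \<Rightarrow> 'w \<Rightarrow> complex mat"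
    and \<phi> :: "complex mat \<Rightarrow> complex mat" and \<Lambda> D :: "complex mat"
    and P :: diagram
    and \<rho> \<nu> :: "real pmf" and \<delta> :: complex
    and S :: "('a::ring_1) nc_space" and T :: "('b::ring_1) nc_space"
    and poisson conv :: moment_seq
  assumes "k \<ge> 1" and "m \<ge> 1"
    and "length ns = k" and "\<forall>r<k. ns ! r \<ge> 1" and "n = prod_list ns"
    and "\<And>d. d \<ge> 1 \<Longrightarrow> complex_wishart (M d) (d * n) (d * m) (W d)"
    and "linear_on_mats n \<phi>" and "associated_matrix n \<phi> \<Lambda>"
    and "is_diagram ns P" and "\<Lambda> = diagram_mat ns P"
    and "mat_adjoint \<Lambda> = \<Lambda>"
    and "\<forall>B \<in> strings P. through B \<longrightarrow> undecorated ns P B"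
    and "D = \<phi> (1\<^sub>m n)" and "\<delta> = ntr D"
    and "\<rho> = eigenvalue_law \<Lambda>" and "\<nu> = eigenvalue_law D"
    and "compound_free_poisson_law S (\<lambda>z. real m * real n * pmf \<rho> z) poisson"
    and "free_mult_conv_law T poisson (moments (measure_pmf \<nu>)) conv"
  shows "asymptotic_law M (\<lambda>d \<omega>. (\<delta> * of_nat m) \<cdot>\<^sub>m block_modified d n \<phi> (W d \<omega>)) conv"
proof -
  note m = assms(2) and assoc = assms(8)
  have "ns ! r \<ge> 1" if "r < length ns" for r using assms(3,4) that by simp
  then have "0 \<notin> set ns" by (metis in_set_conv_nth not_one_le_zero)
  then have "n \<noteq> 0" unfolding assms(5) by (simp add: prod_list_zero_iff)
  then have n: "n \<ge> 1" by simp
  let ?L = "tensor_fmat n \<Lambda>"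
  let ?D = "ptr n ?L"
  let ?I = "{..<n}" and ?J = "pairs n"
  let ?\<tau> = "ftr ?I ?D"
  have fac: "factorising n ?L"
    unfolding assms(5,10) using assms(3,4,9,12) by (intro factorising_diagram) auto
  have L: "\<Lambda> \<in> carrier_mat (n * n) (n * n)"
    using assoc by (simp add: associated_matrix_def)
  have D: "D \<in> carrier_mat n n"
    using assms(7,13) by (simp add: linear_on_mats_def)
  have D_entry: "D $$ (b, e) = ?D b e" if "b < n" "e < n" for b e
    unfolding assms(13) by (rule partial_trace_associated[OF assoc that])
  have D_adj: "mat_adjoint D = D"
    by (rule mat_adjoint_partial_trace[OF L assms(11) D D_entry])
  have ntr_D: "ntr (D ^\<^sub>m e) = ftr ?I (fpow ?I ?D e) / of_nat n" for e
  proof -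
    have "(D ^\<^sub>m e) $$ (i, i) = fpow ?I ?D e i i" if "i \<in> ?I" for i
      using pow_mat_entry[OF D, of i i e] that
        fpow_cong[of ?I "\<lambda>i j. D $$ (i, j)" ?D i i e] D_entry by auto
    then show ?thesis using carrier_matD(1)[OF D] by (simp add: ntr_def ftr_def)
  qed
  define \<kappa> where "\<kappa> l = of_nat m / of_nat n * ftr ?J (fpow ?J ?L l)" for l
  define \<beta> where "\<beta> e = ftr ?I (fpow ?I ?D e) / of_nat n" for e
  have \<nu>: "moments (measure_pmf \<nu>) = \<beta>"
    using moments_eigenvalue_law(2)[OF D n D_adj] by (simp add: fun_eq_iff assms(16) ntr_D \<beta>_def)
  have nn: "n * n \<ge> 1" using n by simp
  have \<kappa>: "(\<Sum>z | real m * real n * pmf \<rho> z > 0. of_real (real m * real n * pmf \<rho> z) * of_real z ^ l) = \<kappa> l" for l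
  proof -
    have "(\<Sum>z | real m * real n * pmf \<rho> z > 0. of_real (real m * real n * pmf \<rho> z) * of_real z ^ l) =
        of_real (real m * real n) * moments (measure_pmf \<rho>) l"
      using m n moments_eigenvalue_law(1)[OF L nn assms(11)]
      by (intro scaled_law_moments) (simp_all add: assms(15))
    also have "\<dots> = \<kappa> l"
      unfolding assms(15) moments_eigenvalue_law(2)[OF L nn assms(11)] ntr_tensor_pow[OF L] \<kappa>_def
      using n by (simp add: field_simps)
    finally show ?thesis .
  qed
  have "poisson e = height_moment N \<kappa> e 0" if "e \<le> N" for N e
    using compound_free_poisson_moment[OF assms(17) that] unfolding \<kappa> .
  from free_mult_conv_moment[OF assms(18)[unfolded \<nu>] this]
  have conv: "conv p = free_mom \<kappa> \<beta> 0 p" for p .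
  have \<delta>: "\<delta> = ?\<tau> / of_nat n"
    using D_entry carrier_matD(1)[OF D] by (simp add: assms(14) ntr_def ftr_def)
  have lim: "(\<delta> * of_nat m) ^ p * (ftr ?I (open_limit n m ?L p) / of_nat n) = free_mom \<kappa> \<beta> 0 p" for p
  \<comment> \<open>\<open>open_limit_free_mom\<close> divides by \<tau>. For \<tau> = 0 and
    positive \<open>p\<close> the left side contains the factor \<delta> = 0, while
    \<open>\<kappa> 1\<close> and \<open>\<beta> 1\<close> are multiples of \<tau>, so the right
    side vanishes too.\<close>
  proof (cases "?\<tau> = 0")
    case False
    have "ftr ?I (mm ?I (fpow ?I ?D 0) (open_limit n m ?L p)) = ftr ?I (open_limit n m ?L p)"
      unfolding ftr_def by (intro sum.cong refl) (simp add: mm_one_left)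
    then show ?thesis
      using open_limit_free_mom[OF fac n m False, of p 0] unfolding \<kappa>_def \<beta>_def \<delta> by (simp add: mult.commute)
  next
    case True
    show ?thesis
    proof (cases p)
      case 0
      then show ?thesis by (simp add: open_limit_0 \<beta>_def)
    next
      case (Suc q)
      have "\<beta> 1 = ?\<tau> / of_nat n"
        unfolding \<beta>_def ftr_def by (simp add: mm_one_right)
      moreover have "\<kappa> 1 = of_nat m / of_nat n * ?\<tau>"
        unfolding \<kappa>_def ftr_ptr by (simp add: ftr_def mm_one_right finite_pairs)
      ultimately show ?thesis
        using True Suc free_mom_trivial[of \<kappa> \<beta> q] by (simp add: \<delta>)
    qed
  qed
  show ?thesis
    unfolding asymptotic_law_def conv
    using block_modified_wishart_limit[OF n m assms(6) assoc, of "\<delta> * of_nat m"] by (simp only: lim) simp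
qed

end
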